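(* Let $k\ge1$. In $\bigotimes_{BP_*}^kBP_*(B\mathbb{Z}/2)$, $v_0$ acts as $\sum_{\ell\ge k}v_\ell\cdot p_{\ell,0}$ modulo higher filtration (i.e. as a map $F_s/F_{s+1}\to F_{s+1}/F_{s+2}$ for each $s\ge0$), where $p_{\ell,0}\in\mathbb{F}_2[x_1,\ldots,x_k]$ (the polynomial $m_{2^1,\ldots,2^{k-1},2^\ell}/m_{2^0,\ldots,2^{k-1}}$) is given by $$p_{\ell,0}=\sum_f\prod_{i=0}^{\ell-1}x_{f(i)}^{2^i},$$ where $f$ ranges over all surjective functions $\{0,\ldots,\ell-1\}\to\{1,\ldots,k\}$. Equivalently, $p_{\ell,0}=\sum m_{\|S_1\|,\ldots,\|S_k\|}$, where the sum ranges over all $\|S_1\|>\cdots>\|S_k\|$ with $S_1,\ldots,S_k$ a partition of $\{1,2,4,\ldots,2^{\ell-1}\}$ into $k$ nonempty subsets. Here $\|S\|$ is the sum of the elements of $S$.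
   Context: $BP_*(-)$ is Brown-Peterson homology localized at $2$, with coefficients $BP_*=\mathbb{Z}_{(2)}[v_1,v_2,\ldots]$, $|v_j|=2(2^j-1)$, and $v_0=2$. $BP_*(B\mathbb{Z}/2)$ has $BP_*$-generators $z_i\in BP_{2i-1}(B\mathbb{Z}/2)$, $i\ge1$, with only relations $\sum_{j\ge0}a_jz_{i-j}=0$ ($z_n=0$ for $n\le 0$), where $a_j\in BP_{2j}$ are the coefficients of the $[2]$-series; modulo $(v_0,v_1,\ldots)^2$, $a_{2^i-1}\equiv v_i$ for $i\ge 0$, and $a_j\equiv0$ if $j+1$ is not a $2$-power. Let $Q=\bigotimes^k_{BP_*}BP_*(B\mathbb{Z}/2)$. It is spanned over $BP_*$ by the classes $z_I=z_{i_1}\otimes\cdots\otimes z_{i_k}$ with $I=(i_1,\ldots,i_k)$, $i_j\ge1$; $Z_k$ is the set of these classes. $F_s=(v_0,v_1,\ldots)^sQ$. It is known that $F_s/F_{s+1}$ is an $\mathbb{F}_2$-vector space with basis all $(v_k^{t_k}v_{k+1}^{t_{k+1}}\cdots)z_I$ with $z_I\in Z_k$, $t_i\ge0$, $\sum t_i=s$. The polynomial ring $\mathbb{F}_2[x_1,\ldots,x_k]$ acts on the $\mathbb{F}_2$-vector space with basis $Z_k$ by $x_1^{e_1}\cdots x_k^{e_k}\cdot z_I=z_{I-E}$, where $I-E=(i_1-e_1,\ldots,i_k-e_k)$ and $z_J=0$ if any entry of $J$ is $\le0$. Acting as $\sum_{\ell\ge k} v_\ell\cdot p_{\ell,0}$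 means sending $v^Tz_I$ (with $v^T$ a monomial in $v_k,v_{k+1},\ldots$) to $\sum_{\ell\ge k}v_\ell v^T(p_{\ell,0}\cdot z_I)$. For positive integers $t_1,\ldots,t_k$, $m_{t_1,\ldots,t_k}$ is the monomial symmetric polynomial over $\mathbb{F}_2$ in $x_1,\ldots,x_k$: the sum of all distinct monomials obtained from $x_1^{t_1}\cdots x_k^{t_k}$ by permuting the variables. *)

theory Defs
  imports
    "HOL-Library.Poly_Mapping"
    "HOL-Library.Z2"
    "HOL-Library.FuncSet"
    "HOL-Library.Cardinality"
    "HOL-Computational_Algebra.Formal_Power_Series"
begin

section \<open>The coefficient ring\<close>

text \<open>The ring of integers localized at 2.\<close>

typedef zloc2 = "{r :: rat. \<exists>a b. odd b \<and> r = of_int a / of_int b}"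
  morphisms rat_of_zloc2 Abs_zloc2
proof
  show "(0 :: rat) \<in> {r. \<exists>a b. odd b \<and> r = of_int a / of_int b}"
    unfolding mem_Collect_eq by (rule exI[of _ 0], rule exI[of _ 1]) simp
qed

setup_lifting type_definition_zloc2

instantiation zloc2 :: comm_ring_1
begin

lift_definition zero_zloc2 :: zloc2 is 0
  by (rule exI[of _ 0], rule exI[of _ 1]) simp

lift_definition one_zloc2 :: zloc2 is 1
  by (rule exI[of _ 1], rule exI[of _ 1]) simp

lift_definition uminus_zloc2 :: "zloc2 \<Rightarrow> zloc2" is uminus
  by (metis minus_divide_left of_int_minus)

lift_definition plus_zloc2 :: "zloc2 \<Rightarrow> zloc2 \<Rightarrow> zloc2" is plus
proof -
  fix r s :: rat
  assume "\<exists>a b. odd b \<and> r = of_int a / of_int b" "\<exists>a b. odd b \<and> s = of_int a / of_int b"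
  then obtain a b c d :: int where
    bd: "odd b" "odd d" and rs: "r = of_int a / of_int b" "s = of_int c / of_int d"
    by blast
  have "b \<noteq> 0" "d \<noteq> 0" using bd by auto
  then have "r + s = of_int (a * d + c * b) / of_int (b * d)"
    by (simp add: rs field_simps)
  moreover have "odd (b * d)" using bd by simp
  ultimately show "\<exists>a b. odd b \<and> r + s = of_int a / of_int b" by blast
qed

lift_definition minus_zloc2 :: "zloc2 \<Rightarrow> zloc2 \<Rightarrow> zloc2" is minus
proof -
  fix r s :: rat
  assume "\<exists>a b. odd b \<and> r = of_int a / of_int b" "\<exists>a b. odd b \<and> s = of_int a / of_int b"
  then obtain a b c d :: int where
    bd: "odd b" "odd d" and rs: "r = of_int a / of_int b" "s = of_int c / of_int d"
    by blast
  have "b \<noteq> 0" "d \<noteq> 0" using bd by auto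
  then have "r - s = of_int (a * d - c * b) / of_int (b * d)"
    by (simp add: rs field_simps)
  moreover have "odd (b * d)" using bd by simp
  ultimately show "\<exists>a b. odd b \<and> r - s = of_int a / of_int b" by blast
qed

lift_definition times_zloc2 :: "zloc2 \<Rightarrow> zloc2 \<Rightarrow> zloc2" is times
proof -
  fix r s :: rat
  assume "\<exists>a b. odd b \<and> r = of_int a / of_int b" "\<exists>a b. odd b \<and> s = of_int a / of_int b"
  then obtain a b c d :: int where
    bd: "odd b" "odd d" and rs: "r = of_int a / of_int b" "s = of_int c / of_int d"
    by blast
  have "r * s = of_int (a * c) / of_int (b * d)"
    by (simp add: rs)
  moreover have "odd (b * d)" using bd by simp
  ultimately show "\<exists>a b. odd b \<and> r * s = of_int a / of_int b" by blast
qed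

instance
  by standard (transfer; simp add: algebra_simps)+

end

text \<open>
  The variable with index \<open>i\<close> of the polynomial ring \<open>bp\<close> is the generator \<open>v\<^sub>i\<^sub>+\<^sub>1\<close>;
  \<open>bpq\<close> is the rationalization of \<open>bp\<close>.
\<close>

type_synonym bp = "(nat \<Rightarrow>\<^sub>0 nat) \<Rightarrow>\<^sub>0 zloc2"
type_synonym bpq = "(nat \<Rightarrow>\<^sub>0 nat) \<Rightarrow>\<^sub>0 rat"

definition rationalize :: "bp \<Rightarrow> bpq"
  where "rationalize = Poly_Mapping.map rat_of_zloc2"

definition v :: "nat \<Rightarrow> bp"
  where "v j = (if j = 0 then 2 else Poly_Mapping.single (Poly_Mapping.single (j - 1) 1) 1)"

section \<open>The 2-series\<close>

text \<open>
  The generators are Hazewinkel's: the logarithm of the formal group law is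
  \<open>\<Sum> \<ell>\<^sub>n x^(2^n)\<close> with \<open>\<ell>\<^sub>0 = 1\<close> and \<open>2 \<ell>\<^sub>n = \<Sum>i<n. \<ell>\<^sub>i v\<^sub>n\<^sub>-\<^sub>i^(2^i)\<close>.
\<close>

fun log_coeff :: "nat \<Rightarrow> bpq" where
  "log_coeff n =
     (if n = 0 then 1
      else Poly_Mapping.single 0 (1 / 2) *
        (\<Sum>i\<in>{..<n}. log_coeff i * rationalize (v (n - i)) ^ (2 ^ i)))"

declare log_coeff.simps [simp del]

definition bp_log :: "bpq fps"
  where "bp_log = Abs_fps (\<lambda>n. \<Sum>i | 2 ^ i = n. log_coeff i)"

text \<open>
  The 2-series \<open>[2](x) = \<Sum>j. a\<^sub>j x^(j+1)\<close> is determined by \<open>log ([2](x)) = 2 log x\<close>;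
  its coefficients lie in \<open>bp\<close>.
\<close>

definition two_series_coeff :: "nat \<Rightarrow> bp"
  where "two_series_coeff =
    (THE a. bp_log oo Abs_fps (\<lambda>n. if n = 0 then 0 else rationalize (a (n - 1)))
            = fps_const 2 * bp_log)"

section \<open>Free modules over the coefficient ring\<close>

definition scale_free :: "bp \<Rightarrow> ('a \<Rightarrow>\<^sub>0 bp) \<Rightarrow> ('a \<Rightarrow>\<^sub>0 bp)"
  where "scale_free c = Poly_Mapping.map ((*) c)"

lemma lookup_scale_free [simp]:
  "Poly_Mapping.lookup (scale_free c x) i = c * Poly_Mapping.lookup x i"
  by (simp add: scale_free_def Poly_Mapping.map.rep_eq when_def)

global_interpretation free: module scale_free
  by standard
    (auto intro!: poly_mapping_eqI simp: lookup_add distrib_left distrib_right mult.assoc)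

lemma diff_diff_swap: "(a - b) - (c - d) = (a - c) - (b - d)" for a b c d :: "'a::ab_group_add"
  by (simp add: algebra_simps)

section \<open>The homology of the classifying space\<close>

text \<open>
  In the free module on the natural numbers the basis element \<open>i\<close> represents \<open>z\<^sub>i\<close>;
  \<open>z\<^sub>0\<close> is included and set to zero.
\<close>

definition bpz2_relations :: "(nat \<Rightarrow>\<^sub>0 bp) set"
  where "bpz2_relations =
    insert (Poly_Mapping.single 0 1)
      {\<Sum>j\<le>i. Poly_Mapping.single (i - j) (two_series_coeff j) | i. i \<ge> 1}"

quotient_type bpz2 = "nat \<Rightarrow>\<^sub>0 bp" / "\<lambda>x y. x - y \<in> free.span bpz2_relations"
proof (rule equivpI)
  show "reflp (\<lambda>x y. x - y \<in> free.span bpz2_relations)"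
    by (simp add: reflp_def free.span_zero)
  show "symp (\<lambda>x y. x - y \<in> free.span bpz2_relations)"
    by (metis (mono_tags, lifting) free.span_neg minus_diff_eq sympI)
  show "transp (\<lambda>x y. x - y \<in> free.span bpz2_relations)"
    by (metis (mono_tags, lifting) diff_add_cancel add_diff_eq free.span_add transpI)
qed

instantiation bpz2 :: ab_group_add
begin

lift_definition zero_bpz2 :: bpz2 is 0 .

lift_definition plus_bpz2 :: "bpz2 \<Rightarrow> bpz2 \<Rightarrow> bpz2" is plus
  by (metis (no_types, lifting) add_diff_add free.span_add)

lift_definition uminus_bpz2 :: "bpz2 \<Rightarrow> bpz2" is uminus
  by (metis (no_types, lifting) free.span_neg minus_diff_minus)

lift_definition minus_bpz2 :: "bpz2 \<Rightarrow> bpz2 \<Rightarrow> bpz2" is minus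
  by (subst diff_diff_swap) (rule free.span_diff)

instance
  by standard (transfer; simp add: free.span_zero algebra_simps)+

end

lift_definition scale_bpz2 :: "bp \<Rightarrow> bpz2 \<Rightarrow> bpz2" is scale_free
  by (metis free.scale_right_diff_distrib free.span_scale)

global_interpretation bpz2: module scale_bpz2
  by standard (transfer; simp add: free.span_zero free.scale_right_distrib free.scale_left_distrib)+

lift_definition z :: "nat \<Rightarrow> bpz2" is "\<lambda>i. Poly_Mapping.single i 1" .

section \<open>The tensor power\<close>

text \<open>
  The number \<open>k\<close> of factors is the cardinality of the finite index type \<open>'k\<close>. The tensor power
  is the quotient of the free module on all \<open>'k\<close>-tuples by the multilinearity relations.
\<close>

definition multilinear_relations :: "(('k \<Rightarrow> bpz2) \<Rightarrow>\<^sub>0 bp) set"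
  where "multilinear_relations =
    {Poly_Mapping.single (t(j := x + y)) 1 - Poly_Mapping.single (t(j := x)) 1
       - Poly_Mapping.single (t(j := y)) 1 | t j x y. True} \<union>
    {Poly_Mapping.single (t(j := scale_bpz2 c x)) 1
       - Poly_Mapping.single (t(j := x)) c | t j c x. True}"

quotient_type 'k tensor_power = "('k \<Rightarrow> bpz2) \<Rightarrow>\<^sub>0 bp"
  / "\<lambda>x y. x - y \<in> free.span multilinear_relations"
proof (rule equivpI)
  show "reflp (\<lambda>x y. x - y \<in> free.span multilinear_relations)"
    by (simp add: reflp_def free.span_zero)
  show "symp (\<lambda>x y. x - y \<in> free.span multilinear_relations)"
    by (metis (mono_tags, lifting) free.span_neg minus_diff_eq sympI)
  show "transp (\<lambda>x y. x - y \<in> free.span multilinear_relations)"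
    by (metis (mono_tags, lifting) diff_add_cancel add_diff_eq free.span_add transpI)
qed

instantiation tensor_power :: (type) ab_group_add
begin

lift_definition zero_tensor_power :: "'a tensor_power" is 0 .

lift_definition plus_tensor_power ::
    "'a tensor_power \<Rightarrow> 'a tensor_power \<Rightarrow> 'a tensor_power" is plus
  by (metis (no_types, lifting) add_diff_add free.span_add)

lift_definition uminus_tensor_power :: "'a tensor_power \<Rightarrow> 'a tensor_power" is uminus
  by (metis (no_types, lifting) free.span_neg minus_diff_minus)

lift_definition minus_tensor_power ::
    "'a tensor_power \<Rightarrow> 'a tensor_power \<Rightarrow> 'a tensor_power" is minus
  by (subst diff_diff_swap) (rule free.span_diff)

instance
  by standard (transfer; simp add: free.span_zero algebra_simps)+

end

lift_definition scale_tensor :: "bp \<Rightarrow> 'k tensor_power \<Rightarrow> 'k tensor_power" is scale_free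
  by (metis free.scale_right_diff_distrib free.span_scale)

global_interpretation tensor: module scale_tensor
  by standard (transfer; simp add: free.span_zero free.scale_right_distrib free.scale_left_distrib)+

definition pure_tensor :: "('k \<Rightarrow> bpz2) \<Rightarrow> 'k tensor_power"
  where "pure_tensor t = abs_tensor_power (Poly_Mapping.single t 1)"

definition z_tensor :: "('k \<Rightarrow> nat) \<Rightarrow> 'k tensor_power"
  where "z_tensor I = pure_tensor (\<lambda>j. z (I j))"

section \<open>The filtration\<close>

global_interpretation bp_ideal: module "(*) :: bp \<Rightarrow> bp \<Rightarrow> bp"
  by standard (simp_all add: algebra_simps)

definition v_ideal :: "bp set"
  where "v_ideal = bp_ideal.span (range v)"

definition v_ideal_power :: "nat \<Rightarrow> bp set"
  where "v_ideal_power s = bp_ideal.span {\<Prod>i<s. c i | c. \<forall>i<s. c i \<in> v_ideal}"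

definition filt :: "nat \<Rightarrow> 'k tensor_power set"
  where "filt s = tensor.span {scale_tensor c q | c q. c \<in> v_ideal_power s}"

text \<open>
  The class of \<open>q \<in> filt s\<close> in \<open>filt s / filt (s + 1)\<close> as a coset, and the map
  \<open>filt s / filt (s + 1) \<rightarrow> filt (s + 1) / filt (s + 2)\<close> induced by multiplication by an
  element of the ideal.
\<close>

definition gr_class :: "nat \<Rightarrow> 'k tensor_power \<Rightarrow> 'k tensor_power set"
  where "gr_class s q = {q'. q' - q \<in> filt (Suc s)}"

definition gr_mult :: "nat \<Rightarrow> bp \<Rightarrow> 'k tensor_power set \<Rightarrow> 'k tensor_power set"
  where "gr_mult s c C = (\<Union>q\<in>C. gr_class (Suc s) (scale_tensor c q))"

section \<open>The basis of the associated graded and the polynomial action\<close>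

text \<open>
  A vector of the space over the field with two elements with basis all \<open>v^T z\<^sub>I\<close> is a finitely
  supported function on the pairs \<open>(T, I)\<close>, where \<open>T j\<close> is the exponent of \<open>v j\<close>.
  That the \<open>v^T z\<^sub>I\<close> with \<open>T\<close> of degree \<open>s\<close> form a basis of \<open>filt s / filt (s + 1)\<close> means that
  \<open>w \<mapsto> gr_class s (realize w)\<close> is an isomorphism from \<open>gr_space s\<close>.
\<close>

definition gr_space :: "nat \<Rightarrow> ((nat \<Rightarrow>\<^sub>0 nat) \<times> ('k::finite \<Rightarrow> nat) \<Rightarrow>\<^sub>0 bit) set"
  where "gr_space s = {w. \<forall>(T, I) \<in> Poly_Mapping.keys w.
    Poly_Mapping.keys T \<subseteq> {CARD('k)..} \<and>
    (\<Sum>j\<in>Poly_Mapping.keys T. Poly_Mapping.lookup T j) = s \<and> (\<forall>i. I i \<ge> 1)}"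

definition v_monomial :: "(nat \<Rightarrow>\<^sub>0 nat) \<Rightarrow> bp"
  where "v_monomial T = (\<Prod>j\<in>Poly_Mapping.keys T. v j ^ Poly_Mapping.lookup T j)"

definition realize ::
    "((nat \<Rightarrow>\<^sub>0 nat) \<times> ('k \<Rightarrow> nat) \<Rightarrow>\<^sub>0 bit) \<Rightarrow> 'k tensor_power"
  where "realize w = (\<Sum>(T, I)\<in>Poly_Mapping.keys w. scale_tensor (v_monomial T) (z_tensor I))"

type_synonym 'k poly2 = "('k \<Rightarrow>\<^sub>0 nat) \<Rightarrow>\<^sub>0 bit"

definition var :: "'k \<Rightarrow> 'k poly2"
  where "var j = Poly_Mapping.single (Poly_Mapping.single j 1) 1"

definition poly_act :: "'k poly2 \<Rightarrow> ('k \<Rightarrow> nat) \<Rightarrow> (('k \<Rightarrow> nat) \<Rightarrow>\<^sub>0 bit)"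
  where "poly_act p I =
    (\<Sum>E\<in>Poly_Mapping.keys p.
       if \<forall>j. Poly_Mapping.lookup E j < I j
       then Poly_Mapping.single (\<lambda>j. I j - Poly_Mapping.lookup E j) (Poly_Mapping.lookup p E)
       else 0)"

text \<open>
  The operator \<open>\<Sum>\<ell>\<ge>k. v \<ell> \<cdot> p \<ell>\<close>; the inner sum runs over those \<open>\<ell>\<close> that contribute to
  \<open>v^T z\<^sub>I\<close>, of which there are only finitely many in the case of interest
  (\<open>finite_p0_contributions\<close> below).
\<close>

definition v_poly_act ::
    "(nat \<Rightarrow> 'k::finite poly2) \<Rightarrow>
     ((nat \<Rightarrow>\<^sub>0 nat) \<times> ('k \<Rightarrow> nat) \<Rightarrow>\<^sub>0 bit) \<Rightarrow>
     ((nat \<Rightarrow>\<^sub>0 nat) \<times> ('k \<Rightarrow> nat) \<Rightarrow>\<^sub>0 bit)"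
  where "v_poly_act p w =
    (\<Sum>(T, I)\<in>Poly_Mapping.keys w.
       \<Sum>l | CARD('k) \<le> l \<and> poly_act (p l) I \<noteq> 0.
         \<Sum>J\<in>Poly_Mapping.keys (poly_act (p l) I).
           Poly_Mapping.single (Poly_Mapping.single l 1 + T, J) 1)"

section \<open>The polynomials\<close>

definition msym :: "nat list \<Rightarrow> 'k poly2"
  where "msym ts =
    \<Sum> {\<Prod>i<length ts. var (b i) ^ (ts ! i) | b. bij_betw b {..<length ts} (UNIV :: 'k set)}"

definition p0 :: "nat \<Rightarrow> 'k poly2"
  where "p0 l =
    (\<Sum>f | f \<in> {..<l} \<rightarrow>\<^sub>E UNIV \<and> f ` {..<l} = (UNIV :: 'k set).
       \<Prod>i<l. var (f i) ^ (2 ^ i))"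

lemma var_power: "var j ^ n = (Poly_Mapping.single (Poly_Mapping.single j n) 1 :: 'k poly2)"
  by (induction n) (simp_all add: var_def mult_single flip: single_add)

lemma prod_var_power:
  assumes "finite A"
  shows "(\<Prod>i\<in>A. var (f i) ^ g i) =
    (Poly_Mapping.single (\<Sum>i\<in>A. Poly_Mapping.single (f i) (g i)) 1 :: 'k poly2)"
  using assms by induction (simp_all add: var_power mult_single)

lemma finite_p0_contributions:
  fixes I :: "'k::finite \<Rightarrow> nat"
  shows "finite {l. CARD('k) \<le> l \<and> poly_act (p0 l) I \<noteq> 0}"
proof (rule finite_subset)
  show "{l. CARD('k) \<le> l \<and> poly_act (p0 l) I \<noteq> 0} \<subseteq> {..(\<Sum>j\<in>UNIV. I j)}"
  proof
    fix l assume "l \<in> {l. CARD('k) \<le> l \<and> poly_act (p0 l) I \<noteq> 0}"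
    then have l: "CARD('k) \<le> l" and nz: "poly_act (p0 l) I \<noteq> 0" by auto
    have "l > 0" using l zero_less_card_finite[where 'a='k] by linarith
    obtain E where E: "E \<in> Poly_Mapping.keys (p0 l :: 'k poly2)"
      and less: "\<forall>j. Poly_Mapping.lookup E j < I j"
    proof (rule ccontr)
      assume "\<not> thesis"
      then have "poly_act (p0 l) I = 0"
        unfolding poly_act_def using that by (intro sum.neutral) auto
      then show False using nz by simp
    qed
    let ?F = "{f. f \<in> {..<l} \<rightarrow>\<^sub>E UNIV \<and> f ` {..<l} = (UNIV :: 'k set)}"
    let ?E = "\<lambda>f. \<Sum>i<l. Poly_Mapping.single (f i) ((2::nat) ^ i)"
    have "Poly_Mapping.keys (p0 l :: 'k poly2)
        \<subseteq> (\<Union>f\<in>?F. Poly_Mapping.keys (\<Prod>i<l. var (f i) ^ (2 ^ i) :: 'k poly2))"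
      unfolding p0_def by (rule keys_sum)
    then obtain f where "E \<in> Poly_Mapping.keys (\<Prod>i<l. var (f i) ^ (2 ^ i) :: 'k poly2)"
      using E by blast
    then have Ef: "E = ?E f" by (simp add: prod_var_power)
    have "l \<le> 2 ^ (l - 1)"
      using less_exp[of "l - 1"] \<open>l > 0\<close> by linarith
    also have "\<dots> = Poly_Mapping.lookup (Poly_Mapping.single (f (l - 1)) ((2::nat) ^ (l - 1))) (f (l - 1))"
      by simp
    also have "\<dots> \<le> Poly_Mapping.lookup E (f (l - 1))"
      unfolding Ef lookup_sum using \<open>l > 0\<close>
      by (intro member_le_sum) auto
    also have "\<dots> \<le> I (f (l - 1))" using less by (simp add: less_imp_le)
    also have "\<dots> \<le> (\<Sum>j\<in>UNIV. I j)" by (intro member_le_sum) auto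
    finally show "l \<in> {..(\<Sum>j\<in>UNIV. I j)}" by simp
  qed
qed simp

definition decreasing_partitions :: "nat \<Rightarrow> nat \<Rightarrow> nat set list set"
  where "decreasing_partitions k l =
    {S. length S = k \<and> (\<forall>i<k. S ! i \<noteq> {}) \<and>
        (\<forall>i<k. \<forall>j<k. i \<noteq> j \<longrightarrow> S ! i \<inter> S ! j = {}) \<and>
        (\<Union>i<k. S ! i) = (\<lambda>i. 2 ^ i) ` {..<l} \<and>
        sorted_wrt (>) (map \<Sum> S)}"

end

theory Submission
  imports
    Defs
    "HOL-Combinatorics.List_Permutation"
    "HOL-Combinatorics.Transposition"
    "HOL-Library.Nat_Bijection"
begin

text \<open>
  Write \<open>v\<^sub>l\<close> for \<open>v l\<close>, \<open>x\<^sub>j\<close> for \<open>var j\<close>, \<open>p\<^sub>l\<close> for \<open>p0 l\<close> and \<open>k\<close> for the number of tensor factors.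
  Elements of the \<open>s\<close>-th power of the ideal carry \<open>filt 2\<close> into \<open>filt (s + 2)\<close>, so the assertion
  about \<open>v\<^sub>0\<close> reduces to the congruence of \<open>v\<^sub>0 z\<^sub>I\<close> and the sum of the \<open>v\<^sub>l (p\<^sub>l z\<^sub>I)\<close> over
  \<open>l \<ge> k\<close>, modulo \<open>filt 2\<close> (\<open>v0_z_tensor\<close>). Signs do not matter, because \<open>2 = v\<^sub>0\<close> lies in the
  ideal.

  The 2-series is congruent to \<open>\<Sum>l. v\<^sub>l x^(2^l)\<close> modulo the square of the ideal. Hence each
  tensor factor \<open>j\<close> gives a linear relation \<open>\<Sum>l. v\<^sub>l x\<^sub>j^(2^l) = 0\<close> between the operators \<open>v\<^sub>l\<close>
  modulo \<open>filt 2\<close> (\<open>v_z_relation\<close>). These are \<open>k\<close> equations, and Cramer's rule eliminates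
  \<open>v\<^sub>1, \<dots>, v\<^sub>k\<^sub>-\<^sub>1\<close>: with the Moore determinant \<open>D = det (x\<^sub>j^(2^i))\<close>, where \<open>0 \<le> i < k\<close>, and the
  cofactors \<open>C\<^sub>j\<close> of its row \<open>i = 0\<close>, one gets \<open>\<Sum>l. v\<^sub>l (\<Sum>j. C\<^sub>j x\<^sub>j^(2^l)) = 0\<close>. The inner sum is \<open>D\<close>
  for \<open>l = 0\<close>, vanishes for \<open>0 < l < k\<close>, and equals \<open>p\<^sub>l D\<close> for \<open>l \<ge> k\<close>. Finally \<open>D\<close> can be
  cancelled (\<open>shift_act_moore_injective\<close>): its monomials are the rearrangements of one exponent
  vector, so by the Cauchy-Schwarz inequality each of them is the strict leading term for the
  weight that it defines, and a function on the positive tuples that \<open>D\<close> annihilates vanishes by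
  descent. This is \<open>v0_relation\<close>.

  The identity \<open>\<Sum>j. C\<^sub>j x\<^sub>j^(2^l) = p\<^sub>l D\<close> (\<open>p0_times_moore_cofactor\<close>) also describes \<open>p\<^sub>l\<close> as a
  quotient of monomial symmetric polynomials. For a set \<open>S\<close> of variables let \<open>x\<^sub>S\<close> be their sum.
  Inclusion-exclusion over the image of a function, read modulo 2, gives
  \<open>p\<^sub>l = \<Sum>S. x\<^sub>S^(2^l - 1)\<close> for \<open>l > 0\<close>. Each nonzero \<open>x\<^sub>S\<close> divides \<open>D\<close>, and the polynomials
  \<open>c\<^sub>j = \<Sum>S\<ni>j. D / x\<^sub>S\<close> satisfy \<open>\<Sum>j. c\<^sub>j x\<^sub>j^(2^l) = \<Sum>S. D x\<^sub>S^(2^l - 1)\<close>. For \<open>l > 0\<close>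
  this is \<open>p\<^sub>l D\<close>, which vanishes for \<open>l < k\<close> because no function from fewer than \<open>k\<close> points is onto;
  for \<open>l = 0\<close> it is \<open>D\<close> because the number of nonempty \<open>S\<close> is odd. So the \<open>c\<^sub>j\<close> solve the same
  nonsingular linear system as the \<open>C\<^sub>j\<close>, and \<open>c\<^sub>j = C\<^sub>j\<close>.

  The description by partitions sorts the fibres of a surjection by the sums of their powers of 2
  (\<open>p0_decreasing_partitions\<close>).

  What remains is the 2-series itself. Its integrality is Hazewinkel's functional equation
  argument: the ring endomorphism \<open>\<sigma>\<close> with \<open>\<sigma> v\<^sub>i = v\<^sub>i^2\<close> for \<open>i > 0\<close>, extended to power series by \<open>x \<mapsto> x^2\<close>,
  lifts the squaring map modulo 2, and the logarithm satisfies
  \<open>log x = x + \<Sum>j\<ge>1. (v\<^sub>j / 2) \<sigma>^j (log x)\<close> (\<open>two_log_coeff_frobenius\<close>, \<open>two_series_integral\<close>). Its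
  residue modulo the square of the ideal is determined by the constant and linear coefficients of
  its coefficients, which the defining equation yields directly.
\<close>

unbundle fps_syntax

section \<open>Rationalization and the lift of Frobenius\<close>

lemma poly_mapping_sum_single: "p = (\<Sum>T\<in>Poly_Mapping.keys p. Poly_Mapping.single T (Poly_Mapping.lookup p T))"
  by (rule poly_mapping_eqI)
    (auto simp: lookup_sum lookup_single when_def in_keys_iff intro: sum.neutral)

lemma poly_mapping_add_induct [case_names zero single add]:
  assumes "P 0" "\<And>T c. P (Poly_Mapping.single T c)" "\<And>p q. P p \<Longrightarrow> P q \<Longrightarrow> P (p + q)"
  shows "P (p :: 'a \<Rightarrow>\<^sub>0 'b::comm_monoid_add)"
proof -
  have "P (\<Sum>T\<in>A. Poly_Mapping.single T (Poly_Mapping.lookup p T))" if "finite A" for A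
    using that by induction (auto intro: assms)
  then show ?thesis by (subst poly_mapping_sum_single) simp
qed

lemma lookup_rationalize [simp]:
  "Poly_Mapping.lookup (rationalize p) T = rat_of_zloc2 (Poly_Mapping.lookup p T)"
  by (auto simp: rationalize_def Poly_Mapping.map.rep_eq when_def zero_zloc2.rep_eq)

lemma rationalize_single [simp]: "rationalize (Poly_Mapping.single T c) = Poly_Mapping.single T (rat_of_zloc2 c)"
  by (auto intro!: poly_mapping_eqI simp: lookup_single when_def zero_zloc2.rep_eq)

lemma rationalize_add: "rationalize (p + q) = rationalize p + rationalize q"
  by (auto intro!: poly_mapping_eqI simp: lookup_add plus_zloc2.rep_eq)

lemma rationalize_diff: "rationalize (p - q) = rationalize p - rationalize q"
  by (auto intro!: poly_mapping_eqI simp: lookup_minus minus_zloc2.rep_eq)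

lemma rationalize_0 [simp]: "rationalize 0 = 0"
  by (auto intro!: poly_mapping_eqI simp: zero_zloc2.rep_eq)

lemma rationalize_1 [simp]: "rationalize 1 = 1"
  by (rule poly_mapping_eqI) (simp add: lookup_one when_def one_zloc2.rep_eq zero_zloc2.rep_eq)

lemma rationalize_mult: "rationalize (p * q) = rationalize p * rationalize q"
proof (induction p rule: poly_mapping_add_induct)
  case (single T c)
  show ?case
    by (induction q rule: poly_mapping_add_induct)
      (simp_all add: mult_single times_zloc2.rep_eq distrib_left rationalize_add)
qed (simp_all add: distrib_right rationalize_add)

lemma inj_rationalize: "inj rationalize"
proof (rule injI)
  fix p q assume "rationalize p = rationalize q"
  then have "rat_of_zloc2 (Poly_Mapping.lookup p T) = rat_of_zloc2 (Poly_Mapping.lookup q T)" for T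
    by (metis lookup_rationalize)
  then show "p = q" by (auto intro!: poly_mapping_eqI simp: rat_of_zloc2_inject)
qed

text \<open>
  The integral elements of the rationalization form a subring; working inside it keeps the
  logarithm and the 2-series in one ring.
\<close>

definition integral :: "bpq set" where "integral = range rationalize"

lemma integral_0 [simp]: "0 \<in> integral" unfolding integral_def by (metis rangeI rationalize_0)
lemma integral_1 [simp]: "1 \<in> integral" unfolding integral_def by (metis rangeI rationalize_1)
lemma integral_add: "p \<in> integral \<Longrightarrow> q \<in> integral \<Longrightarrow> p + q \<in> integral"
  unfolding integral_def by (auto simp flip: rationalize_add)
lemma integral_diff: "p \<in> integral \<Longrightarrow> q \<in> integral \<Longrightarrow> p - q \<in> integral"
  unfolding integral_def by (auto simp flip: rationalize_diff)
lemma integral_mult: "p \<in> integral \<Longrightarrow> q \<in> integral \<Longrightarrow> p * q \<in> integral"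
  unfolding integral_def by (auto simp flip: rationalize_mult)
lemma integral_sum: "(\<And>i. i \<in> A \<Longrightarrow> f i \<in> integral) \<Longrightarrow> sum f A \<in> integral"
  by (induction A rule: infinite_finite_induct) (auto intro: integral_add)
lemma integral_rationalize [simp]: "rationalize p \<in> integral" unfolding integral_def by simp
lemma integral_power: "p \<in> integral \<Longrightarrow> p ^ n \<in> integral"
  by (induction n) (auto intro: integral_mult)
lemma integral_2 [simp]: "2 \<in> integral"
  using integral_add[OF integral_1 integral_1] by simp

text \<open>
  The ring endomorphism that squares every \<open>v\<^sub>i\<close> with \<open>i \<ge> 1\<close> and fixes the scalars: exponents
  are doubled.
\<close>

definition frobenius :: "bpq \<Rightarrow> bpq"
  where "frobenius p = (\<Sum>T\<in>Poly_Mapping.keys p. Poly_Mapping.single (T + T) (Poly_Mapping.lookup p T))"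

text \<open>
  The sum may be taken over any larger finite set, so that two polynomials can be compared on a
  common index set.
\<close>

lemma frobenius_superset:
  "finite A \<Longrightarrow> Poly_Mapping.keys p \<subseteq> A \<Longrightarrow>
    frobenius p = (\<Sum>T\<in>A. Poly_Mapping.single (T + T) (Poly_Mapping.lookup p T))"
  unfolding frobenius_def by (rule sum.mono_neutral_left) (auto simp: in_keys_iff)

lemma frobenius_single [simp]: "frobenius (Poly_Mapping.single T c) = Poly_Mapping.single (T + T) c"
  by (simp add: frobenius_def)

lemma frobenius_0 [simp]: "frobenius 0 = 0" by (simp add: frobenius_def)
lemma frobenius_1 [simp]: "frobenius 1 = 1" by (simp add: frobenius_def lookup_one)

lemma frobenius_add: "frobenius (p + q) = frobenius p + frobenius q"
proof -
  let ?A = "Poly_Mapping.keys p \<union> Poly_Mapping.keys q"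
  have "finite ?A" "Poly_Mapping.keys p \<subseteq> ?A" "Poly_Mapping.keys q \<subseteq> ?A" "Poly_Mapping.keys (p + q) \<subseteq> ?A"
    using keys_add[of p q] by auto
  then show ?thesis
    by (simp only: frobenius_superset[of ?A] lookup_add single_add sum.distrib)
qed

lemma frobenius_mult: "frobenius (p * q) = frobenius p * frobenius q"
proof (induction p rule: poly_mapping_add_induct)
  case (single T c)
  show ?case
    by (induction q rule: poly_mapping_add_induct)
      (simp_all add: mult_single distrib_left frobenius_add add.assoc add.left_commute)
qed (simp_all add: distrib_right frobenius_add)

lemma frobenius_sum: "frobenius (sum f A) = (\<Sum>i\<in>A. frobenius (f i))"
  by (induction A rule: infinite_finite_induct) (auto simp: frobenius_add)

lemma frobenius_power: "frobenius (p ^ n) = frobenius p ^ n"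
  by (induction n) (auto simp: frobenius_mult)

text \<open>
  For \<open>c = a / b\<close> the numerator \<open>a (a - b)\<close> of \<open>c\<^sup>2 - c\<close> is even because \<open>b\<close> is odd. This is why
  the identity of the scalars lifts the squaring map modulo 2.
\<close>

lemma zloc2_square_minus_even: "\<exists>d. c * c - c = 2 * (d :: zloc2)"
proof -
  have "\<exists>d. (\<exists>a b. odd b \<and> d = of_int a / of_int b) \<and> r * r - r = (1 + 1) * d"
    if "\<exists>a b. odd b \<and> r = of_int a / of_int b" for r :: rat
  proof -
    from that obtain a b where b: "odd b" and r: "r = of_int a / of_int b" by blast
    have "even (a * (a - b))" using b by simp
    then obtain e where e: "a * (a - b) = 2 * e" by blast
    have "b \<noteq> 0" using b by auto
    then have "r * r - r = of_int (a * (a - b)) / of_int (b * b)"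
      by (simp add: r field_simps)
    also have "\<dots> = (1 + 1) * (of_int e / of_int (b * b))" unfolding e by simp
    finally have "r * r - r = (1 + 1) * (of_int e / of_int (b * b))" .
    moreover have "\<exists>a b'. odd b' \<and> rat_of_int e / of_int (b * b) = of_int a / of_int b'"
      using b by (intro exI[of _ e] exI[of _ "b * b"]) simp
    ultimately show ?thesis by (intro exI[of _ "rat_of_int e / of_int (b * b)"] conjI)
  qed
  then have "\<exists>d. c * c - c = (1 + 1) * (d :: zloc2)"
    by transfer blast
  then show ?thesis by simp
qed

text \<open>
  Both sides are additive modulo 2, since the cross term of a square is even. On a term \<open>c v^T\<close> the
  difference is \<open>(c\<^sup>2 - c) v^(2T)\<close>.
\<close>

lemma square_cong_frobenius:
  assumes "p \<in> integral"
  shows "\<exists>c \<in> integral. p ^ 2 - frobenius p = 2 * c"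
proof -
  obtain p' where "p = rationalize p'" using assms unfolding integral_def by blast
  moreover have "\<exists>c. rationalize p' ^ 2 - frobenius (rationalize p') = 2 * rationalize c"
  proof (induction p' rule: poly_mapping_add_induct)
    case zero
    show ?case by (intro exI[of _ 0]) simp
  next
    case (single T c)
    obtain d where d: "c * c - c = 2 * d" using zloc2_square_minus_even by blast
    have "2 * Poly_Mapping.single (T + T) d = Poly_Mapping.single (T + T) (c * c) - Poly_Mapping.single (T + T) c"
      unfolding single_diff[symmetric] d by (simp only: mult_2 single_add)
    then have "rationalize (Poly_Mapping.single T c) ^ 2 - frobenius (rationalize (Poly_Mapping.single T c)) =
      rationalize (2 * Poly_Mapping.single (T + T) d)"
      by (simp add: rationalize_diff power2_eq_square mult_single times_zloc2.rep_eq)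
    also have "\<dots> = 2 * rationalize (Poly_Mapping.single (T + T) d)"
      by (simp only: mult_2 rationalize_add)
    finally show ?case by blast
  next
    case (add p q)
    then obtain c d where
      "rationalize p ^ 2 - frobenius (rationalize p) = 2 * rationalize c"
      "rationalize q ^ 2 - frobenius (rationalize q) = 2 * rationalize d" by blast
    moreover have "rationalize (p + q) ^ 2 - frobenius (rationalize (p + q)) =
      (rationalize p ^ 2 - frobenius (rationalize p)) + (rationalize q ^ 2 - frobenius (rationalize q)) +
      2 * rationalize (p * q)"
      by (simp add: rationalize_add frobenius_add power2_sum rationalize_mult)
    ultimately have "rationalize (p + q) ^ 2 - frobenius (rationalize (p + q)) = 2 * rationalize (c + d + p * q)"
      by (simp add: rationalize_add distrib_left)
    then show ?case by blast
  qed
  ultimately show ?thesis by auto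
qed

lemma integral_frobenius:
  assumes "p \<in> integral" shows "frobenius p \<in> integral"
proof -
  obtain c where "c \<in> integral" "p ^ 2 - frobenius p = 2 * c"
    using square_cong_frobenius[OF assms] by blast
  then have "frobenius p = p ^ 2 - 2 * c" by (simp add: algebra_simps)
  then show ?thesis using assms \<open>c \<in> integral\<close>
    by (simp add: integral_diff integral_power integral_mult)
qed

section \<open>Power series with integral coefficients\<close>

definition integral_fps :: "bpq fps set" where "integral_fps = {G. \<forall>n. G $ n \<in> integral}"

lemma integral_fps_add: "G \<in> integral_fps \<Longrightarrow> H \<in> integral_fps \<Longrightarrow> G + H \<in> integral_fps"
  by (simp add: integral_fps_def integral_add)
lemma integral_fps_mult: "G \<in> integral_fps \<Longrightarrow> H \<in> integral_fps \<Longrightarrow> G * H \<in> integral_fps"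
  by (simp add: integral_fps_def fps_mult_nth integral_sum integral_mult)
lemma integral_fps_const: "c \<in> integral \<Longrightarrow> fps_const c \<in> integral_fps"
  by (simp add: integral_fps_def)
lemma integral_fps_0: "0 \<in> integral_fps" and integral_fps_1: "1 \<in> integral_fps"
  by (simp_all add: integral_fps_def)
lemma integral_fps_sum: "(\<And>i. i \<in> A \<Longrightarrow> f i \<in> integral_fps) \<Longrightarrow> sum f A \<in> integral_fps"
  by (induction A rule: infinite_finite_induct) (auto intro: integral_fps_add integral_fps_0)
lemma integral_fps_power: "G \<in> integral_fps \<Longrightarrow> G ^ n \<in> integral_fps"
  by (induction n) (auto intro: integral_fps_mult integral_fps_1)
lemma integral_fps_2: "2 \<in> integral_fps"
  using integral_fps_add[OF integral_fps_1 integral_fps_1] by simp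

text \<open>
  The extension of the Frobenius lift that sends the variable to its square.
\<close>

definition frobenius_fps :: "bpq fps \<Rightarrow> bpq fps"
  where "frobenius_fps G = Abs_fps (\<lambda>n. if even n then frobenius (G $ (n div 2)) else 0)"

lemma sum_even_atMost:
  fixes f :: "nat \<Rightarrow> 'a::comm_monoid_add"
  assumes "\<And>i. i \<le> 2 * m \<Longrightarrow> odd i \<Longrightarrow> f i = 0"
  shows "(\<Sum>i=0..2*m. f i) = (\<Sum>i=0..m. f (2 * i))"
proof -
  have "(\<Sum>i=0..m. f (2 * i)) = (\<Sum>i\<in>(*) 2 ` {0..m}. f i)"
    by (subst sum.reindex) (auto simp: inj_on_def)
  also have "\<dots> = (\<Sum>i=0..2*m. f i)"
    by (rule sum.mono_neutral_left) (auto intro!: assms elim: evenE)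
  finally show ?thesis by simp
qed

lemma frobenius_fps_mult: "frobenius_fps (G * H) = frobenius_fps G * frobenius_fps H"
proof (rule fps_ext)
  fix n
  show "frobenius_fps (G * H) $ n = (frobenius_fps G * frobenius_fps H) $ n"
  proof (cases "even n")
    case True
    then obtain m where n: "n = 2 * m" by blast
    show ?thesis unfolding n
      by (simp add: fps_mult_nth frobenius_fps_def frobenius_sum frobenius_mult sum_even_atMost
        flip: right_diff_distrib')
  next
    case False
    then have "(frobenius_fps G * frobenius_fps H) $ n = 0"
      unfolding fps_mult_nth by (intro sum.neutral) (auto simp: frobenius_fps_def)
    then show ?thesis using False by (simp add: frobenius_fps_def)
  qed
qed

lemma frobenius_fps_add: "frobenius_fps (G + H) = frobenius_fps G + frobenius_fps H"
  by (rule fps_ext) (simp add: frobenius_fps_def frobenius_add)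

lemma frobenius_fps_0 [simp]: "frobenius_fps 0 = 0" 
  by (rule fps_ext) (simp add: frobenius_fps_def)

lemma frobenius_fps_sum: "frobenius_fps (sum f A) = (\<Sum>i\<in>A. frobenius_fps (f i))"
  by (induction A rule: infinite_finite_induct) (auto simp: frobenius_fps_add)

lemma frobenius_fps_const [simp]: "frobenius_fps (fps_const c) = fps_const (frobenius c)"
  by (rule fps_ext) (auto simp: frobenius_fps_def)

lemma frobenius_fps_power: "frobenius_fps (G ^ n) = frobenius_fps G ^ n"
proof (induction n)
  case 0 show ?case using frobenius_fps_const[of 1] by simp
qed (auto simp: frobenius_fps_mult)

lemma integral_frobenius_fps: "G \<in> integral_fps \<Longrightarrow> frobenius_fps G \<in> integral_fps"
  by (simp add: integral_fps_def frobenius_fps_def integral_frobenius)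

lemma frobenius_fps_iter_mult: "(frobenius_fps ^^ j) (G * H) = (frobenius_fps ^^ j) G * (frobenius_fps ^^ j) H"
  and frobenius_fps_iter_sum: "(frobenius_fps ^^ j) (sum f A) = (\<Sum>i\<in>A. (frobenius_fps ^^ j) (f i))"
  and frobenius_fps_iter_const: "(frobenius_fps ^^ j) (fps_const c) = fps_const ((frobenius ^^ j) c)"
  and frobenius_fps_iter_power: "(frobenius_fps ^^ j) (G ^ n) = (frobenius_fps ^^ j) G ^ n"
  and integral_frobenius_fps_iter: "G \<in> integral_fps \<Longrightarrow> (frobenius_fps ^^ j) G \<in> integral_fps"
  and integral_frobenius_iter: "c \<in> integral \<Longrightarrow> (frobenius ^^ j) c \<in> integral"
  by (induction j)
    (simp_all add: frobenius_fps_mult frobenius_fps_sum frobenius_fps_power integral_frobenius_fps integral_frobenius)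

lemma frobenius_iter_mult: "(frobenius ^^ j) (p * q) = (frobenius ^^ j) p * (frobenius ^^ j) q"
  and frobenius_iter_sum: "(frobenius ^^ j) (sum f A) = (\<Sum>i\<in>A. (frobenius ^^ j) (f i))"
  and frobenius_iter_power: "(frobenius ^^ j) (p ^ n) = (frobenius ^^ j) p ^ n"
  and frobenius_iter_0: "(frobenius ^^ j) 0 = 0"
  and frobenius_iter_1: "(frobenius ^^ j) 1 = 1"
  and frobenius_iter_add: "(frobenius ^^ j) (p + q) = (frobenius ^^ j) p + (frobenius ^^ j) q"
  by (induction j) (simp_all add: frobenius_mult frobenius_sum frobenius_power frobenius_add)

lemma frobenius_fps_iter_nth:
  "(frobenius_fps ^^ j) G $ n = (if 2 ^ j dvd n then (frobenius ^^ j) (G $ (n div 2 ^ j)) else 0)"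
proof (induction j arbitrary: n)
  case (Suc j)
  have "2 ^ Suc j dvd n \<longleftrightarrow> even n \<and> 2 ^ j dvd n div 2"
    by (cases "even n") (auto elim!: evenE dest: dvd_mult_left)
  moreover have "n div 2 div 2 ^ j = n div 2 ^ Suc j" by (simp add: div_mult2_eq)
  ultimately show ?case
    using Suc by (auto simp: frobenius_fps_def)
qed simp

text \<open>
  The terms \<open>i\<close> and \<open>n - i\<close> agree, so only the middle term of the square of a power series
  survives modulo 2.
\<close>

lemma sum_atLeastAtMost_symmetric:
  fixes g :: "nat \<Rightarrow> 'a::comm_ring_1"
  shows "(\<Sum>i=0..n. g i * g (n - i)) =
    2 * (\<Sum>i | 2 * i < n. g i * g (n - i)) + (if even n then g (n div 2) ^ 2 else 0)"
proof -
  have fin: "finite {i. 2 * i < n}" by (rule finite_subset[of _ "{..n}"]) auto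
  have "{0..n} = {i. 2 * i < n} \<union> ({i. i \<le> n \<and> n < 2 * i} \<union> {i. 2 * i = n})" by auto
  then have "(\<Sum>i=0..n. g i * g (n - i)) = (\<Sum>i | 2 * i < n. g i * g (n - i)) +
     ((\<Sum>i | i \<le> n \<and> n < 2 * i. g i * g (n - i)) + (\<Sum>i | 2 * i = n. g i * g (n - i)))"
    using fin by (simp only:) (subst sum.union_disjoint; auto intro: finite_subset[of _ "{..n}"])+
  moreover have "(\<Sum>i | i \<le> n \<and> n < 2 * i. g i * g (n - i)) = (\<Sum>i | 2 * i < n. g i * g (n - i))"
    by (rule sum.reindex_bij_witness[of _ "\<lambda>i. n - i" "\<lambda>i. n - i"]) (auto simp: mult.commute)
  moreover have "{i. 2 * i = n} = (if even n then {n div 2} else {})" by auto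
  then have "(\<Sum>i | 2 * i = n. g i * g (n - i)) = (if even n then g (n div 2) ^ 2 else 0)"
    by (auto simp: power2_eq_square elim!: evenE)
  ultimately show ?thesis by simp
qed

lemma square_cong_frobenius_fps:
  assumes "G \<in> integral_fps"
  shows "\<exists>c \<in> integral_fps. G ^ 2 - frobenius_fps G = 2 * c"
proof -
  have G: "G $ n \<in> integral" for n using assms by (simp add: integral_fps_def)
  have "\<exists>c \<in> integral. (G ^ 2 - frobenius_fps G) $ n = 2 * c" for n
  proof -
    let ?s = "\<Sum>i | 2 * i < n. G $ i * G $ (n - i)"
    have s: "?s \<in> integral" by (auto intro!: integral_sum integral_mult G)
    have eq: "(G ^ 2) $ n = 2 * ?s + (if even n then (G $ (n div 2)) ^ 2 else 0)"
      unfolding power2_eq_square[of G] fps_mult_nth by (rule sum_atLeastAtMost_symmetric)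
    show ?thesis
    proof (cases "even n")
      case True
      obtain c where c: "c \<in> integral" "(G $ (n div 2)) ^ 2 - frobenius (G $ (n div 2)) = 2 * c"
        using square_cong_frobenius[OF G] by blast
      have "(G ^ 2 - frobenius_fps G) $ n = 2 * ?s + ((G $ (n div 2)) ^ 2 - frobenius (G $ (n div 2)))"
        using True by (simp only: fps_sub_nth eq frobenius_fps_def fps_nth_Abs_fps if_True add_diff_eq)
      also have "\<dots> = 2 * (?s + c)" by (simp only: c(2) distrib_left)
      finally show ?thesis using integral_add[OF s c(1)] by blast
    next
      case False
      have "(G ^ 2 - frobenius_fps G) $ n = 2 * ?s"
        using False by (simp only: fps_sub_nth eq frobenius_fps_def fps_nth_Abs_fps if_False add_0_right diff_0_right)
      then show ?thesis using s by blast
    qed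
  qed
  then have "\<forall>n. \<exists>c. c \<in> integral \<and> (G ^ 2 - frobenius_fps G) $ n = 2 * c" by blast
  then obtain c where c: "\<And>n. c n \<in> integral" "\<And>n. (G ^ 2 - frobenius_fps G) $ n = 2 * c n"
    unfolding choice_iff by blast
  show ?thesis
  proof
    show "Abs_fps c \<in> integral_fps" using c(1) by (simp add: integral_fps_def)
    show "G ^ 2 - frobenius_fps G = 2 * Abs_fps c"
      by (rule fps_ext) (simp only: c(2) mult_2 fps_add_nth fps_nth_Abs_fps)
  qed
qed

text \<open>
  Squaring improves a congruence modulo a positive power of 2 by one factor 2, because
  \<open>A\<^sup>2 - B\<^sup>2 = (A - B) (2 B + (A - B))\<close>.
\<close>

lemma square_cong:
  assumes "B \<in> integral_fps" "c \<in> integral_fps" "A - B = 2 ^ Suc r * c"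
  shows "\<exists>d \<in> integral_fps. A ^ 2 - B ^ 2 = 2 ^ Suc (Suc r) * d"
proof
  have A: "A = B + 2 ^ Suc r * c" using assms(3) by (simp add: algebra_simps)
  show "A ^ 2 - B ^ 2 = 2 ^ Suc (Suc r) * (c * (B + 2 ^ r * c))"
    unfolding A by (simp add: algebra_simps power2_eq_square)
  show "c * (B + 2 ^ r * c) \<in> integral_fps"
    by (intro integral_fps_mult integral_fps_add integral_fps_power integral_fps_2 assms)
qed

text \<open>
  Iterating the Frobenius congruence gives the case \<open>i = 0\<close>; each further squaring gains a factor
  2. The exponent \<open>Suc i\<close> is exactly what cancels the denominator of \<open>\<ell>\<^sub>i / 2\<close> below.
\<close>

lemma power_cong_frobenius_fps:
  assumes "G \<in> integral_fps"
  shows "\<exists>c \<in> integral_fps. G ^ 2 ^ (i + Suc j) - (frobenius_fps ^^ Suc j) G ^ 2 ^ i = 2 ^ Suc i * c"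
proof (induction i)
  case 0
  show ?case
  proof (induction j)
    case 0
    show ?case using square_cong_frobenius_fps[OF assms] by simp
  next
    case (Suc j)
    let ?H = "(frobenius_fps ^^ Suc j) G"
    have H: "?H \<in> integral_fps" by (intro integral_frobenius_fps_iter assms)
    obtain c where "c \<in> integral_fps" "G ^ 2 ^ Suc j - ?H = 2 ^ Suc 0 * c"
      using Suc by auto
    then obtain d where d: "d \<in> integral_fps" "(G ^ 2 ^ Suc j) ^ 2 - ?H ^ 2 = 2 ^ Suc (Suc 0) * d"
      using square_cong[OF H] by blast
    obtain e where e: "e \<in> integral_fps" "?H ^ 2 - frobenius_fps ?H = 2 * e"
      using square_cong_frobenius_fps[OF H] by blast
    have "G ^ 2 ^ Suc (Suc j) - frobenius_fps ?H =
      ((G ^ 2 ^ Suc j) ^ 2 - ?H ^ 2) + (?H ^ 2 - frobenius_fps ?H)"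
      by (simp flip: power_mult add: mult.commute)
    also have "\<dots> = 2 * (2 * d + e)" unfolding d e by (simp add: algebra_simps)
    finally show ?case using d(1) e(1)
      by (intro bexI[of _ "2 * d + e"]) (auto intro: integral_fps_add integral_fps_mult integral_fps_2)
  qed
next
  case (Suc i)
  then obtain c where c: "c \<in> integral_fps"
    "G ^ 2 ^ (i + Suc j) - (frobenius_fps ^^ Suc j) G ^ 2 ^ i = 2 ^ Suc i * c" by blast
  have H: "(frobenius_fps ^^ Suc j) G ^ 2 ^ i \<in> integral_fps"
    by (intro integral_fps_power integral_frobenius_fps_iter assms)
  have "(G ^ 2 ^ (i + Suc j)) ^ 2 = G ^ 2 ^ (Suc i + Suc j)"
    "(((frobenius_fps ^^ Suc j) G) ^ 2 ^ i) ^ 2 = ((frobenius_fps ^^ Suc j) G) ^ 2 ^ Suc i"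
    by (simp_all flip: power_mult add: mult.commute)
  then show ?case using square_cong[OF H c] by (simp only:)
qed

section \<open>The logarithm and the 2-series over the rationals\<close>

lemma bpq_half: "(2 :: bpq) * Poly_Mapping.single 0 (1 / 2) = 1"
  by (simp only: mult_2 flip: single_add) simp

lemma bpq_cancel_2:
  fixes p q :: bpq
  assumes "2 * p = 2 * q" shows "p = q"
  using assms by simp

lemma log_coeff_0: "log_coeff 0 = 1"
  by (simp add: log_coeff.simps)

lemma two_log_coeff:
  "n > 0 \<Longrightarrow> 2 * log_coeff n = (\<Sum>i<n. log_coeff i * rationalize (v (n - i)) ^ 2 ^ i)"
  by (subst log_coeff.simps) (simp flip: mult.assoc add: bpq_half)

text \<open>
  Each step of the recursion for \<open>\<ell>\<^sub>n\<close> introduces one factor \<open>1/2\<close>.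
\<close>

lemma integral_log_coeff: "2 ^ n * log_coeff n \<in> integral"
proof (induction n rule: less_induct)
  case (less n)
  show ?case
  proof (cases n)
    case 0
    then show ?thesis by (simp add: log_coeff_0)
  next
    case (Suc k)
    have "2 ^ n * log_coeff n = 2 ^ k * (2 * log_coeff n)" by (simp add: Suc)
    also have "\<dots> = (\<Sum>i<n. 2 ^ k * (log_coeff i * rationalize (v (n - i)) ^ 2 ^ i))"
      by (subst two_log_coeff) (use Suc in \<open>simp_all only: sum_distrib_left zero_less_Suc\<close>)
    also have "\<dots> = (\<Sum>i<n. 2 ^ (k - i) * (2 ^ i * log_coeff i) * rationalize (v (n - i)) ^ 2 ^ i)"
      by (rule sum.cong) (use Suc in \<open>auto simp: mult.assoc power_add[symmetric] simp flip: mult.assoc\<close>)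
    also have "\<dots> \<in> integral"
      by (intro integral_sum integral_mult integral_power less) auto
    finally show ?thesis .
  qed
qed

lemma frobenius_iter_v: "j > 0 \<Longrightarrow> (frobenius ^^ i) (rationalize (v j)) = rationalize (v j) ^ 2 ^ i"
  by (induction i)
   (simp_all add: frobenius_power v_def power_mult one_zloc2.rep_eq mult_single power2_eq_square)

lemma sum_triangle:
  fixes f :: "nat \<Rightarrow> nat \<Rightarrow> 'a::comm_monoid_add"
  shows "(\<Sum>n=1..M. \<Sum>j=1..n. f j (n - j)) = (\<Sum>j=1..M. \<Sum>i\<le>M-j. f j i)"
  unfolding sum.Sigma[OF finite_atLeastAtMost ballI[OF finite_atLeastAtMost]]
    sum.Sigma[OF finite_atLeastAtMost ballI[OF finite_atMost]]
  by (rule sum.reindex_bij_witness[of _ "\<lambda>(j, i). (i + j, j)" "\<lambda>(n, j). (j, n - j)"]) auto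

text \<open>
  The defining recursion splits off the last factor of the products of which \<open>\<ell>\<^sub>n\<close> is the sum;
  this one splits off the first factor. Expanding the right-hand side by the former and using the
  latter for smaller indices gives the same double sum. It is the coefficient form of the
  functional equation of the logarithm.
\<close>

lemma two_log_coeff_frobenius:
  assumes "n > 0"
  shows "2 * log_coeff n = (\<Sum>j=1..n. rationalize (v j) * (frobenius ^^ j) (log_coeff (n - j)))"
  using assms
proof (induction n rule: less_induct)
  case (less n)
  let ?V = "\<lambda>j. rationalize (v j)"
  obtain k where k: "n = Suc k" using less.prems gr0_conv_Suc by auto
  have F2: "(frobenius ^^ j) 2 = 2" for j
    using frobenius_iter_add[of j 1 1] by (simp only: frobenius_iter_1 one_add_one)
  have "2 * (2 * log_coeff n) = (\<Sum>m<n. 2 * log_coeff m * ?V (n - m) ^ 2 ^ m)"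
    using less.prems by (simp add: two_log_coeff sum_distrib_left mult.assoc)
  also have "{..<n} = insert 0 {1..k}" using k by auto
  also have "(\<Sum>m\<in>insert 0 {1..k}. 2 * log_coeff m * ?V (n - m) ^ 2 ^ m) =
     2 * ?V n + (\<Sum>m=1..k. (2 * log_coeff m) * ?V (n - m) ^ 2 ^ m)"
    by (simp add: log_coeff_0)
  also have "(\<Sum>m=1..k. (2 * log_coeff m) * ?V (n - m) ^ 2 ^ m) =
     (\<Sum>m=1..k. \<Sum>j=1..m. ?V j * (frobenius ^^ j) (log_coeff (m - j)) * ?V (n - ((m - j) + j)) ^ 2 ^ ((m - j) + j))"
  proof (rule sum.cong[OF refl])
    fix m assume "m \<in> {1..k}"
    then have "2 * log_coeff m = (\<Sum>j=1..m. ?V j * (frobenius ^^ j) (log_coeff (m - j)))"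
      using less.IH[of m] k by auto
    then show "(2 * log_coeff m) * ?V (n - m) ^ 2 ^ m =
      (\<Sum>j=1..m. ?V j * (frobenius ^^ j) (log_coeff (m - j)) * ?V (n - ((m - j) + j)) ^ 2 ^ ((m - j) + j))"
      by (simp add: sum_distrib_right)
  qed
  also have "\<dots> = (\<Sum>j=1..k. \<Sum>i\<le>k-j. ?V j * (frobenius ^^ j) (log_coeff i) * ?V (n - (i + j)) ^ 2 ^ (i + j))"
    by (rule sum_triangle)
  also have "\<dots> = (\<Sum>j=1..k. ?V j * (frobenius ^^ j) (2 * log_coeff (n - j)))"
  proof (rule sum.cong[OF refl])
    fix j assume j: "j \<in> {1..k}"
    then have *: "{..<n-j} = {..k-j}" using k by auto
    have "?V j * (frobenius ^^ j) (2 * log_coeff (n - j)) =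
      ?V j * (\<Sum>i\<le>k-j. (frobenius ^^ j) (log_coeff i) * ?V (n - j - i) ^ 2 ^ (i + j))"
      using j k by (subst two_log_coeff)
       (auto simp: frobenius_iter_sum frobenius_iter_mult frobenius_iter_power frobenius_iter_v *
         power_add mult.commute simp flip: power_mult intro!: sum.cong)
    also have "\<dots> = (\<Sum>i\<le>k-j. ?V j * (frobenius ^^ j) (log_coeff i) * ?V (n - (i + j)) ^ 2 ^ (i + j))"
      by (simp add: sum_distrib_left mult.assoc add.commute)
    finally show "(\<Sum>i\<le>k-j. ?V j * (frobenius ^^ j) (log_coeff i) * ?V (n - (i + j)) ^ 2 ^ (i + j)) =
      ?V j * (frobenius ^^ j) (2 * log_coeff (n - j))" by simp
  qed
  also have "2 * ?V n + \<dots> = (\<Sum>j\<in>insert n {1..k}. ?V j * (frobenius ^^ j) (2 * log_coeff (n - j)))"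
    by (subst sum.insert) (use k F2[of n] in \<open>simp_all add: log_coeff_0\<close>)
  also have "insert n {1..k} = {1..n}" using k by auto
  also have "(\<Sum>j=1..n. ?V j * (frobenius ^^ j) (2 * log_coeff (n - j))) =
     2 * (\<Sum>j=1..n. ?V j * (frobenius ^^ j) (log_coeff (n - j)))"
    by (simp only: frobenius_iter_mult F2 sum_distrib_left mult.left_commute)
  finally show ?case by (rule bpq_cancel_2)
qed

lemma bp_log_nth_power: "bp_log $ (2 ^ n) = log_coeff n"
  by (simp add: bp_log_def)

lemma bp_log_nth_nonpower: "(\<And>n. m \<noteq> 2 ^ n) \<Longrightarrow> bp_log $ m = 0"
  by (auto simp: bp_log_def intro!: sum.neutral)

text \<open>
  Only the exponents \<open>2^n\<close> occur in the logarithm, and a series without constant term has no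
  terms of degree less than \<open>2^n\<close> in its \<open>2^n\<close>-th power.
\<close>

lemma bp_log_compose_nth:
  assumes "G $ 0 = 0" "m < 2 ^ Suc M"
  shows "(bp_log oo G) $ m = (\<Sum>n\<le>M. log_coeff n * (G ^ 2 ^ n) $ m)"
proof -
  let ?S = "(\<lambda>n. 2 ^ n :: nat) ` {..M}"
  have "(\<Sum>n\<le>M. log_coeff n * (G ^ 2 ^ n) $ m) = (\<Sum>i\<in>?S. bp_log $ i * (G ^ i) $ m)"
    by (subst sum.reindex) (auto simp: inj_on_def bp_log_nth_power)
  also have "\<dots> = (\<Sum>i\<in>{0..m}. bp_log $ i * (G ^ i) $ m)"
  proof (rule sum.mono_neutral_cong)
    fix i assume i: "i \<in> {0..m} - ?S"
    have "i \<noteq> 2 ^ n" for n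
    proof
      assume "i = 2 ^ n"
      then have "(2::nat) ^ n < 2 ^ Suc M" using i assms(2) by auto
      then have "n \<le> M" by (simp only: power_strict_increasing_iff less_Suc_eq_le)
      then show False using i \<open>i = 2 ^ n\<close> by auto
    qed
    then show "bp_log $ i * (G ^ i) $ m = 0" by (simp add: bp_log_nth_nonpower)
  qed (auto simp: startsby_zero_power_prefix[rule_format] assms)
  finally show ?thesis by (simp add: fps_compose_nth)
qed

text \<open>
  In degree \<open>n\<close> a product of \<open>i + 1\<close> series without constant term involves from each factor only
  coefficients of degree at most \<open>n - i\<close>, since the other \<open>i\<close> factors have degree at least one.
\<close>

lemma fps_power_nth_cong:
  fixes F G :: "'a::comm_ring_1 fps"
  assumes "F $ 0 = 0" "G $ 0 = 0" "\<And>n. n < m \<Longrightarrow> F $ n = G $ n" "n < m + i"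
  shows "(F ^ Suc i) $ n = (G ^ Suc i) $ n"
  using assms(4)
proof (induction i arbitrary: n)
  case 0
  then show ?case using assms(3) by simp
next
  case (Suc i)
  have "(F * F ^ Suc i) $ n = (G * G ^ Suc i) $ n"
    unfolding fps_mult_nth
  proof (rule sum.cong[OF refl])
    fix a assume a: "a \<in> {0..n}"
    consider "a = 0" | "0 < a" "a < m" | "0 < a" "m \<le> a" by linarith
    then show "F $ a * (F ^ Suc i) $ (n - a) = G $ a * (G ^ Suc i) $ (n - a)"
    proof cases
      case 2
      then have "n - a < m + i" using Suc.prems by linarith
      then show ?thesis using Suc.IH 2 assms(3) by metis
    next
      case 3
      then have "n - a < Suc i" using Suc.prems by linarith
      then show ?thesis
        using startsby_zero_power_prefix[OF assms(1)] startsby_zero_power_prefix[OF assms(2)] by (simp del: power_Suc)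
    qed (use assms in simp)
  qed
  then show ?case by simp
qed

text \<open>
  The coefficient of degree \<open>m\<close> of \<open>F\<close> enters linearly with coefficient one; everything else is
  determined by lower degrees. Existence and uniqueness of the 2-series over the rationals follow.
\<close>

lemma bp_log_compose_recursion:
  assumes "F $ 0 = 0" "m > 0" 
  shows "(bp_log oo F) $ m = F $ m +
    (\<Sum>i=2..m. bp_log $ i * (Abs_fps (\<lambda>n. if n < m then F $ n else 0) ^ i) $ m)"
proof -
  have *: "(F ^ i) $ m = (Abs_fps (\<lambda>n. if n < m then F $ n else 0) ^ i) $ m" if "i \<ge> 2" for i
    using fps_power_nth_cong[of F "Abs_fps (\<lambda>n. if n < m then F $ n else 0)" m m "i - 1"] that assms by simp
  have "bp_log $ 0 = 0" by (simp add: bp_log_def)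
  moreover have "bp_log $ Suc 0 = 1" using bp_log_nth_power[of 0] by (simp add: log_coeff_0)
  moreover have "{0..m} = insert 0 (insert 1 {2..m})" using assms(2) by auto
  ultimately show ?thesis
    by (simp add: fps_compose_nth *)
qed

lemma bp_log_compose_unique:
  assumes "F $ 0 = 0" "G $ 0 = 0" "bp_log oo F = bp_log oo G"
  shows "F = G"
proof (rule fps_ext)
  fix m
  show "F $ m = G $ m"
  proof (induction m rule: less_induct)
    case (less m)
    show ?case
    proof (cases "m = 0")
      case False
      have "(\<lambda>n. if n < m then F $ n else 0) = (\<lambda>n. if n < m then G $ n else 0)" using less by auto
      then show ?thesis
        using bp_log_compose_recursion[OF assms(1), of m] bp_log_compose_recursion[OF assms(2), of m] assms(3) False
        by simp
    qed (simp add: assms)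
  qed
qed

text \<open>
  The solution of \<open>bp_log_compose_recursion\<close> for \<open>2 log x\<close>. Cutting the series off below \<open>m\<close> does not
  change the powers in question and makes the recursion terminate.
\<close>

function two_series_nth :: "nat \<Rightarrow> bpq" where
  "two_series_nth m = (if m = 0 then 0 else 2 * bp_log $ m -
     (\<Sum>i=2..m. bp_log $ i * (Abs_fps (\<lambda>n. if n < m then two_series_nth n else 0) ^ i) $ m))"
  by auto
termination by (relation "measure id") auto
declare two_series_nth.simps [simp del]

definition two_series :: "bpq fps" where "two_series = Abs_fps two_series_nth"

lemma two_series_0: "two_series $ 0 = 0"
  by (simp add: two_series_def two_series_nth.simps)

lemma bp_log_two_series: "bp_log oo two_series = fps_const 2 * bp_log"
proof (rule fps_ext)
  fix m
  show "(bp_log oo two_series) $ m = (fps_const 2 * bp_log) $ m"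
  proof (cases "m = 0")
    case True
    then show ?thesis by (simp add: fps_compose_nth bp_log_def)
  next
    case False
    then show ?thesis
      by (subst bp_log_compose_recursion[OF two_series_0])
        (simp_all add: two_series_def two_series_nth.simps[of m] cong: if_cong)
  qed
qed

text \<open>
  The functional equation of the logarithm in degree \<open>m\<close>: only the indices \<open>j\<close> with \<open>2^j\<close> dividing
  \<open>m\<close> contribute to the coefficient of \<open>x^m\<close>.
\<close>

lemma bp_log_frobenius:
  assumes "2 \<le> m" "m < 2 ^ Suc M"
  shows "(\<Sum>j=1..M. if 2 ^ j dvd m then rationalize (v j) * (frobenius ^^ j) (bp_log $ (m div 2 ^ j)) else 0)
    = 2 * bp_log $ m"
proof (cases "\<exists>n. m = 2 ^ n")
  case True
  then obtain n where n: "m = 2 ^ n" by blast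
  then have "n > 0" using assms(1) by (cases n) auto
  have "n < Suc M" using assms(2) unfolding n by (simp only: power_strict_increasing_iff)
  have "(\<Sum>j=1..M. if 2 ^ j dvd m then rationalize (v j) * (frobenius ^^ j) (bp_log $ (m div 2 ^ j)) else 0) =
    (\<Sum>j=1..n. rationalize (v j) * (frobenius ^^ j) (log_coeff (n - j)))"
  proof (rule sum.mono_neutral_cong_right)
    fix j assume "j \<in> {1..n}"
    then have "(2::nat) ^ n div 2 ^ j = 2 ^ (n - j)" by (simp add: power_diff)
    then show "(if 2 ^ j dvd m then rationalize (v j) * (frobenius ^^ j) (bp_log $ (m div 2 ^ j)) else 0) =
       rationalize (v j) * (frobenius ^^ j) (log_coeff (n - j))"
      using \<open>j \<in> {1..n}\<close> by (simp add: n bp_log_nth_power le_imp_power_dvd)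
  qed (use \<open>n < Suc M\<close> in \<open>auto simp: n dest: power_dvd_imp_le\<close>)
  also have "\<dots> = 2 * bp_log $ m"
    using two_log_coeff_frobenius[OF \<open>n > 0\<close>] by (simp add: n bp_log_nth_power)
  finally show ?thesis .
next
  case False
  have "bp_log $ (m div 2 ^ j) = 0" if "2 ^ j dvd m" for j
  proof (rule bp_log_nth_nonpower)
    fix n show "m div 2 ^ j \<noteq> 2 ^ n"
      using that False by (metis dvd_mult_div_cancel power_add)
  qed
  then show ?thesis using False
    by (auto simp: frobenius_iter_0 bp_log_nth_nonpower intro!: sum.neutral)
qed

section \<open>Integrality of the 2-series\<close>

lemma fps_const_sum: "fps_const (sum f A) = (\<Sum>i\<in>A. fps_const (f i))"
  by (induction A rule: infinite_finite_induct) (simp_all flip: fps_const_add)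

text \<open>
  Insert \<open>\<ell>\<^sub>n = \<Sum>j. (v\<^sub>j / 2) \<sigma>^j \<ell>\<^sub>n\<^sub>-\<^sub>j\<close> and replace \<open>G^(2^(i+j))\<close> by the \<open>2^i\<close>-th power of
  \<open>\<sigma>^j G\<close>. The error is divisible by \<open>2^(i+1)\<close>, which clears the denominator of
  \<open>(v\<^sub>j / 2) \<sigma>^j \<ell>\<^sub>i\<close>.
\<close>

lemma log_sum_cong_frobenius:
  assumes "G \<in> integral_fps"
  shows "(\<Sum>n=1..M. fps_const (log_coeff n) * G ^ 2 ^ n) -
    (\<Sum>j=1..M. fps_const (Poly_Mapping.single 0 (1/2) * rationalize (v j)) *
       (frobenius_fps ^^ j) (\<Sum>i\<le>M-j. fps_const (log_coeff i) * G ^ 2 ^ i)) \<in> integral_fps"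
proof -
  let ?h = "Poly_Mapping.single 0 (1/2) :: bpq"
  let ?c = "\<lambda>j i. ?h * rationalize (v j) * (frobenius ^^ j) (log_coeff i)"
  have log: "log_coeff n = (\<Sum>j=1..n. ?c j (n - j))" if "n \<ge> 1" for n
  proof (rule bpq_cancel_2)
    show "2 * log_coeff n = 2 * (\<Sum>j=1..n. ?c j (n - j))"
      using two_log_coeff_frobenius[of n] that
      by (simp add: sum_distrib_left bpq_half flip: mult.assoc)
  qed
  have "(\<Sum>n=1..M. fps_const (log_coeff n) * G ^ 2 ^ n) =
     (\<Sum>n=1..M. \<Sum>j=1..n. fps_const (?c j (n - j)) * G ^ 2 ^ ((n - j) + j))"
  proof (rule sum.cong[OF refl])
    fix n assume "n \<in> {1..M}"
    then have "fps_const (log_coeff n) * G ^ 2 ^ n = (\<Sum>j=1..n. fps_const (?c j (n - j))) * G ^ 2 ^ n"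
      by (subst log) (simp_all only: fps_const_sum atLeastAtMost_iff)
    then show "fps_const (log_coeff n) * G ^ 2 ^ n = (\<Sum>j=1..n. fps_const (?c j (n - j)) * G ^ 2 ^ ((n - j) + j))"
      by (simp add: sum_distrib_right)
  qed
  also have "\<dots> = (\<Sum>j=1..M. \<Sum>i\<le>M-j. fps_const (?c j i) * G ^ 2 ^ (i + j))"
    by (rule sum_triangle)
  finally have "(\<Sum>n=1..M. fps_const (log_coeff n) * G ^ 2 ^ n) -
    (\<Sum>j=1..M. fps_const (?h * rationalize (v j)) *
       (frobenius_fps ^^ j) (\<Sum>i\<le>M-j. fps_const (log_coeff i) * G ^ 2 ^ i)) =
    (\<Sum>j=1..M. \<Sum>i\<le>M-j. fps_const (?c j i) * (G ^ 2 ^ (i + j) - (frobenius_fps ^^ j) G ^ 2 ^ i))"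
    by (simp add: frobenius_fps_iter_sum frobenius_fps_iter_mult frobenius_fps_iter_const
      frobenius_fps_iter_power sum_distrib_left right_diff_distrib sum_subtractf mult.assoc
      flip: fps_const_mult)
  also have "\<dots> \<in> integral_fps"
  proof (intro integral_fps_sum)
    fix j i assume "j \<in> {1..M}"
    then obtain j' where j': "j = Suc j'" by (cases j) auto
    obtain c where c: "c \<in> integral_fps" "G ^ 2 ^ (i + j) - (frobenius_fps ^^ j) G ^ 2 ^ i = 2 ^ Suc i * c"
      using power_cong_frobenius_fps[OF assms, of i j'] unfolding j' by blast
    have two: "(2 :: bpq fps) ^ n = fps_const (2 ^ n)" for n
      by (simp only: fps_const_power[symmetric] numeral_fps_const)
    have F2: "(frobenius ^^ j) (2 ^ i) = 2 ^ i"
      using frobenius_iter_power[of j 2 i] frobenius_iter_add[of j 1 1] by (simp only: frobenius_iter_1 one_add_one)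
    have "?c j i * 2 ^ Suc i = (2 * ?h) * rationalize (v j) * ((frobenius ^^ j) (2 ^ i) * (frobenius ^^ j) (log_coeff i))"
      unfolding F2 by (simp add: ac_simps)
    also have "\<dots> = rationalize (v j) * (frobenius ^^ j) (2 ^ i * log_coeff i)"
      by (simp only: bpq_half frobenius_iter_mult mult_1)
    also have "\<dots> \<in> integral"
      by (intro integral_mult integral_rationalize integral_frobenius_iter integral_log_coeff)
    finally have "fps_const (?c j i * 2 ^ Suc i) * c \<in> integral_fps"
      by (intro integral_fps_mult integral_fps_const c)
    then show "fps_const (?c j i) * (G ^ 2 ^ (i + j) - (frobenius_fps ^^ j) G ^ 2 ^ i) \<in> integral_fps"
      unfolding c two by (simp add: mult.assoc flip: fps_const_mult)
  qed
  finally show ?thesis .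
qed

lemma two_series_expansion:
  "two_series $ m = 2 * bp_log $ m - (\<Sum>n=1..m. log_coeff n * (two_series ^ 2 ^ n) $ m)"
proof -
  have "m < 2 ^ Suc m" using less_exp[of "Suc m"] by simp
  from bp_log_compose_nth[OF two_series_0 this]
  have "2 * bp_log $ m = (\<Sum>n\<le>m. log_coeff n * (two_series ^ 2 ^ n) $ m)"
    by (simp add: bp_log_two_series)
  also have "{..m} = insert 0 {1..m}" by auto
  finally show ?thesis by (simp add: log_coeff_0)
qed

text \<open>
  Induction on the degree. In degree \<open>m\<close> the powers of the 2-series \<open>F\<close> involve only its truncation
  \<open>G\<close> below \<open>m\<close>, which is integral. By the previous congruence \<open>\<Sum>n\<ge>1. \<ell>\<^sub>n G^(2^n)\<close> agrees up to an
  integral error with \<open>\<Sum>j\<ge>1. (v\<^sub>j / 2) \<sigma>^j (log F)\<close>. As \<open>log F = 2 log x\<close>, the latter has the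
  coefficient \<open>2 bp_log $ m\<close> in degree \<open>m \<ge> 2\<close>, which cancels the only other nonintegral
  contribution to \<open>F $ m\<close>.
\<close>

lemma two_series_integral: "two_series $ m \<in> integral"
proof (induction m rule: less_induct)
  case (less m)
  note lin = two_series_expansion[of m]
  consider "m = 0" | "m = 1" | "m \<ge> 2" by linarith
  then show ?case
  proof cases
    case 1
    then show ?thesis by (simp add: two_series_0)
  next
    case 2
    then show ?thesis using lin bp_log_nth_power[of 0]
      by (simp add: log_coeff_0 startsby_zero_power_prefix[OF two_series_0])
  next
    case 3
    let ?h = "Poly_Mapping.single 0 (1/2) :: bpq"
    define G where "G = Abs_fps (\<lambda>n. if n < m then two_series $ n else 0)"
    have G: "G \<in> integral_fps" using less by (auto simp: G_def integral_fps_def)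
    have G0: "G $ 0 = 0" by (simp add: G_def two_series_0)
    have agree: "(two_series ^ Suc i) $ n = (G ^ Suc i) $ n" if "n < m + i" for i n
      by (rule fps_power_nth_cong[OF two_series_0 G0 _ that]) (simp add: G_def)
    have agree': "(two_series ^ i) $ n = (G ^ i) $ n" if "n < m + (i - 1)" for i n
      using agree[of n "i - 1"] that by (cases i) (simp_all del: power_Suc)
    \<comment> \<open>Below degree \<open>m\<close> the truncation satisfies the equation of the 2-series.\<close>
    have low: "(\<Sum>i\<le>M. log_coeff i * (G ^ 2 ^ i) $ n) = 2 * bp_log $ n" if "n < m" "n < 2 ^ Suc M" for n M
    proof -
      have "(\<Sum>i\<le>M. log_coeff i * (G ^ 2 ^ i) $ n) = (\<Sum>i\<le>M. log_coeff i * (two_series ^ 2 ^ i) $ n)"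
        by (intro sum.cong refl) (simp only: agree'[OF trans_less_add1[OF that(1)]])
      also have "\<dots> = (fps_const 2 * bp_log) $ n"
        using bp_log_compose_nth[OF two_series_0 that(2)] bp_log_two_series by simp
      finally show ?thesis by simp
    qed
    have mlt: "m < 2 ^ Suc m" using less_exp[of "Suc m"] by simp
    have "(\<Sum>j=1..m. fps_const (?h * rationalize (v j)) *
       (frobenius_fps ^^ j) (\<Sum>i\<le>m-j. fps_const (log_coeff i) * G ^ 2 ^ i)) $ m =
       (\<Sum>j=1..m. if 2 ^ j dvd m then rationalize (v j) * (frobenius ^^ j) (bp_log $ (m div 2 ^ j)) else 0)"
      unfolding fps_sum_nth
    proof (rule sum.cong[OF refl])
      fix j assume j: "j \<in> {1..m}"
      show "(fps_const (?h * rationalize (v j)) *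
         (frobenius_fps ^^ j) (\<Sum>i\<le>m-j. fps_const (log_coeff i) * G ^ 2 ^ i)) $ m =
         (if 2 ^ j dvd m then rationalize (v j) * (frobenius ^^ j) (bp_log $ (m div 2 ^ j)) else 0)"
      proof (cases "2 ^ j dvd m")
        case True
        then obtain r where r: "m = 2 ^ j * r" by blast
        have "(1::nat) < 2 ^ j" using j by (intro one_less_power) auto
        then have "r < m" using r 3 by (cases "r = 0") auto
        moreover have "r < 2 ^ Suc (m - j)"
        proof -
          have "2 ^ j * r < 2 ^ (j + Suc (m - j))" using mlt r j by simp
          then show ?thesis unfolding power_add by simp
        qed
        ultimately have "(\<Sum>i\<le>m-j. log_coeff i * (G ^ 2 ^ i) $ r) = 2 * bp_log $ r" by (rule low)
        moreover have "m div 2 ^ j = r" by (simp add: r)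
        moreover have "(frobenius ^^ j) 2 = 2"
          using frobenius_iter_add[of j 1 1] by (simp only: frobenius_iter_1 one_add_one)
        moreover have "?h * rationalize (v j) * (2 * p) = rationalize (v j) * p" for p
        proof -
          have "?h * rationalize (v j) * (2 * p) = (2 * ?h) * (rationalize (v j) * p)" by (simp only: ac_simps)
          then show ?thesis by (simp only: bpq_half mult_1)
        qed
        ultimately show ?thesis using True
          by (simp add: frobenius_fps_iter_nth fps_sum_nth frobenius_iter_mult)
      qed (simp add: frobenius_fps_iter_nth)
    qed
    also have "\<dots> = 2 * bp_log $ m" by (rule bp_log_frobenius[OF 3 mlt])
    finally have "(\<Sum>n=1..m. log_coeff n * (G ^ 2 ^ n) $ m) - 2 * bp_log $ m \<in> integral"
      using log_sum_cong_frobenius[OF G, of m] by (auto simp: integral_fps_def fps_sum_nth dest!: spec[of _ m])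
    moreover have "(\<Sum>n=1..m. log_coeff n * (two_series ^ 2 ^ n) $ m) = (\<Sum>n=1..m. log_coeff n * (G ^ 2 ^ n) $ m)"
    proof (rule sum.cong[OF refl])
      fix n assume "n \<in> {1..m}"
      then have "(2::nat) ^ 1 \<le> 2 ^ n" by (intro power_increasing) auto
      then show "log_coeff n * (two_series ^ 2 ^ n) $ m = log_coeff n * (G ^ 2 ^ n) $ m"
        by (subst agree') auto
    qed
    ultimately have "(\<Sum>n=1..m. log_coeff n * (two_series ^ 2 ^ n) $ m) - 2 * bp_log $ m \<in> integral"
      by (simp only:)
    from integral_diff[OF integral_0 this] show ?thesis unfolding lin by simp
  qed
qed

lemma rationalize_two_series_coeff: "rationalize (two_series_coeff j) = two_series $ Suc j"
proof -
  let ?P = "\<lambda>a. bp_log oo Abs_fps (\<lambda>n. if n = 0 then 0 else rationalize (a (n - 1))) = fps_const 2 * bp_log"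
  have "\<exists>c. two_series $ Suc j = rationalize c" for j
    using two_series_integral[of "Suc j"] unfolding integral_def by blast
  then have "\<forall>j. \<exists>c. two_series $ Suc j = rationalize c" ..
  then obtain a where a: "\<And>j. two_series $ Suc j = rationalize (a j)" unfolding choice_iff by blast
  have eq: "Abs_fps (\<lambda>n. if n = 0 then 0 else rationalize (a (n - 1))) = two_series"
  proof (rule fps_ext)
    fix n show "Abs_fps (\<lambda>n. if n = 0 then 0 else rationalize (a (n - 1))) $ n = two_series $ n"
      by (cases n) (simp_all add: two_series_0 a)
  qed
  have "(THE a. ?P a) = a"
  proof (rule the_equality)
    show "?P a" unfolding eq by (rule bp_log_two_series)
  next
    fix b assume "?P b"
    then have "Abs_fps (\<lambda>n. if n = 0 then 0 else rationalize (b (n - 1))) = two_series"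
      by - (rule bp_log_compose_unique, simp_all add: two_series_0 bp_log_two_series)
    then have "Abs_fps (\<lambda>n. if n = 0 then 0 else rationalize (b (n - 1))) $ Suc j = rationalize (a j)" for j
      by (simp only: a)
    then have "rationalize (b j) = rationalize (a j)" for j
      by (simp only: fps_nth_Abs_fps nat.simps if_False diff_Suc_1)
    then have "b j = a j" for j by (rule injD[OF inj_rationalize])
    then show "b = a" by (rule ext)
  qed
  then show ?thesis unfolding two_series_coeff_def a by (rule arg_cong)
qed

section \<open>The 2-series modulo the square of the ideal\<close>

lemma lookup_mult_const:
  "Poly_Mapping.lookup (p * q) 0 = Poly_Mapping.lookup p 0 * Poly_Mapping.lookup (q :: (nat \<Rightarrow>\<^sub>0 nat) \<Rightarrow>\<^sub>0 'b::comm_semiring_1) 0"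
proof (induction p rule: poly_mapping_add_induct)
  case (single T c)
  have "T + U = 0 \<longleftrightarrow> T = 0 \<and> U = 0" for U :: "nat \<Rightarrow>\<^sub>0 nat"
    by (auto simp: poly_mapping_eq_iff lookup_add fun_eq_iff)
  then show ?case
    by (induction q rule: poly_mapping_add_induct)
      (auto simp: mult_single lookup_single when_def distrib_left lookup_add)
qed (simp_all add: distrib_right lookup_add)

text \<open>
  A monomial of degree one factors only trivially. So the coefficient of a linear monomial is a
  derivation over the constant coefficient (\<open>lookup_mult_linear\<close>).
\<close>

lemma add_eq_single_1_iff:
  fixes T U :: "nat \<Rightarrow>\<^sub>0 nat"
  shows "T + U = Poly_Mapping.single j 1 \<longleftrightarrow>
    T = 0 \<and> U = Poly_Mapping.single j 1 \<or> T = Poly_Mapping.single j 1 \<and> U = 0"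
proof
  assume *: "T + U = Poly_Mapping.single j 1"
  have **: "Poly_Mapping.lookup T i + Poly_Mapping.lookup U i = (if i = j then 1 else 0)" for i
    using arg_cong[OF *, of "\<lambda>p. Poly_Mapping.lookup p i"] by (auto simp: lookup_add lookup_single when_def)
  consider "Poly_Mapping.lookup T j = 0" "Poly_Mapping.lookup U j = 1"
    | "Poly_Mapping.lookup T j = 1" "Poly_Mapping.lookup U j = 0"
    using **[of j] by (simp, arith)
  then show "T = 0 \<and> U = Poly_Mapping.single j 1 \<or> T = Poly_Mapping.single j 1 \<and> U = 0"
  proof cases
    case 1
    then show ?thesis using ** 
      by (intro disjI1 conjI poly_mapping_eqI) (force simp: lookup_single when_def split: if_splits)+
  next
    case 2
    then show ?thesis using **
      by (intro disjI2 conjI poly_mapping_eqI) (force simp: lookup_single when_def split: if_splits)+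
  qed
qed auto

lemma lookup_mult_linear:
  "Poly_Mapping.lookup (p * q) (Poly_Mapping.single j 1) =
    Poly_Mapping.lookup p 0 * Poly_Mapping.lookup q (Poly_Mapping.single j 1) +
    Poly_Mapping.lookup p (Poly_Mapping.single j 1) *
      Poly_Mapping.lookup (q :: (nat \<Rightarrow>\<^sub>0 nat) \<Rightarrow>\<^sub>0 'b::comm_semiring_1) 0"
proof (induction p rule: poly_mapping_add_induct)
  case (single T c)
  have "Poly_Mapping.single j (1::nat) \<noteq> 0" by (metis lookup_single_eq lookup_zero zero_neq_one)
  then show ?case
    by (induction q rule: poly_mapping_add_induct)
      (auto simp: mult_single lookup_single when_def distrib_left lookup_add
        add_eq_single_1_iff[simplified])
qed (simp_all add: distrib_right lookup_add add.assoc add.left_commute)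

lemma lookup_two_mult: "Poly_Mapping.lookup (2 * p) T = 2 * Poly_Mapping.lookup (p :: ('a::comm_monoid_add \<Rightarrow>\<^sub>0 'b::comm_ring_1)) T"
  by (simp only: mult_2 lookup_add)

lemma lookup_power_const:
  "Poly_Mapping.lookup (p ^ n) 0 = Poly_Mapping.lookup (p :: (nat \<Rightarrow>\<^sub>0 nat) \<Rightarrow>\<^sub>0 'b::comm_semiring_1) 0 ^ n"
  by (induction n) (simp_all add: lookup_mult_const lookup_one)

lemma single_1_neq_0: "Poly_Mapping.single j (1::nat) \<noteq> 0"
  by (auto simp: poly_mapping_eq_iff fun_eq_iff lookup_single when_def)

lemma single_1_eq_iff: "Poly_Mapping.single i (1::nat) = Poly_Mapping.single j 1 \<longleftrightarrow> i = j"
  by (auto simp: poly_mapping_eq_iff fun_eq_iff lookup_single when_def dest!: spec[of _ i] split: if_splits)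

lemma lookup_v_const: "j > 0 \<Longrightarrow> Poly_Mapping.lookup (v j) 0 = 0"
  by (simp add: v_def lookup_single when_def single_1_neq_0 del: One_nat_def)

lemma lookup_v_linear:
  "j > 0 \<Longrightarrow> Poly_Mapping.lookup (v j) (Poly_Mapping.single i 1) = (if j = Suc i then 1 else 0)"
  by (auto simp: v_def lookup_single when_def single_1_eq_iff simp del: One_nat_def)

lemma lookup_log_coeff_const: "Poly_Mapping.lookup (log_coeff n) 0 = (if n = 0 then 1 else 0)"
proof (cases "n = 0")
  case False
  have "2 * Poly_Mapping.lookup (log_coeff n) 0 = 0"
    unfolding lookup_two_mult[symmetric] two_log_coeff[OF False[unfolded neq0_conv]] lookup_sum
    by (intro sum.neutral ballI)
      (simp add: lookup_mult_const lookup_power_const lookup_v_const zero_zloc2.rep_eq)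
  then show ?thesis using False by simp
qed (simp add: log_coeff_0)

text \<open>
  Only the summand \<open>i = 0\<close>, that is \<open>v\<^sub>n\<close>, of \<open>2 \<ell>\<^sub>n\<close> has terms of degree less than two.
\<close>

lemma lookup_log_coeff_linear:
  "Poly_Mapping.lookup (log_coeff n) (Poly_Mapping.single j 1) = (if n = Suc j then 1 / 2 else 0)"
proof (cases "n = 0")
  case False
  have "2 * Poly_Mapping.lookup (log_coeff n) (Poly_Mapping.single j 1) =
    (\<Sum>i<n. Poly_Mapping.lookup (log_coeff i * rationalize (v (n - i)) ^ 2 ^ i) (Poly_Mapping.single j 1))"
    unfolding lookup_two_mult[symmetric] two_log_coeff[OF False[unfolded neq0_conv]] lookup_sum ..
  also have "\<dots> = (\<Sum>i\<in>{0}. Poly_Mapping.lookup (log_coeff i * rationalize (v (n - i)) ^ 2 ^ i) (Poly_Mapping.single j 1))"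
    by (rule sum.mono_neutral_right)
      (use False in \<open>simp_all add: lookup_mult_linear lookup_log_coeff_const lookup_power_const
        lookup_v_const zero_zloc2.rep_eq del: One_nat_def\<close>)
  also have "\<dots> = (if n = Suc j then 1 else 0)"
    using False lookup_v_linear[of n j] by (simp add: log_coeff_0 one_zloc2.rep_eq zero_zloc2.rep_eq)
  finally show ?thesis by auto
qed (simp add: log_coeff_0 lookup_one when_def single_1_neq_0 del: One_nat_def)

lemma lookup_bp_log_const: "Poly_Mapping.lookup (bp_log $ m) 0 = (if m = 1 then 1 else 0)"
proof (cases "\<exists>n. m = 2 ^ n")
  case True
  then obtain n where "m = 2 ^ n" by blast
  moreover have "(2::nat) ^ n = 1 \<longleftrightarrow> n = 0" by simp
  ultimately show ?thesis by (simp only: bp_log_nth_power lookup_log_coeff_const)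
next
  case False
  then have "m \<noteq> 1" by (metis power_0)
  then show ?thesis using False by (simp add: bp_log_nth_nonpower)
qed

lemma lookup_bp_log_linear:
  "Poly_Mapping.lookup (bp_log $ m) (Poly_Mapping.single j 1) = (if m = 2 ^ Suc j then 1 / 2 else 0)"
proof (cases "\<exists>n. m = 2 ^ n")
  case True
  then obtain n where "m = 2 ^ n" by blast
  then show ?thesis using lookup_log_coeff_linear[of n j]
    by (simp only: bp_log_nth_power power_inject_exp one_less_numeral_iff semiring_norm)
next
  case False
  then show ?thesis by (auto simp: bp_log_nth_nonpower simp del: power_Suc)
qed

lemma lookup_two_series_const: "Poly_Mapping.lookup (two_series $ m) 0 = (if m = 1 then 2 else 0)"
proof -
  have "(\<Sum>n=1..m. Poly_Mapping.lookup (log_coeff n * (two_series ^ 2 ^ n) $ m) 0) = 0"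
    by (intro sum.neutral) (auto simp: lookup_mult_const lookup_log_coeff_const)
  then show ?thesis
    by (subst two_series_expansion) (simp add: lookup_minus lookup_sum lookup_two_mult lookup_bp_log_const)
qed

text \<open>
  Modulo all \<open>v\<^sub>i\<close> with \<open>i \<ge> 1\<close> the logarithm is \<open>x\<close> and the 2-series is \<open>2 x\<close>.
\<close>

lemma lookup_two_series_power_const:
  "Poly_Mapping.lookup ((two_series ^ N) $ m) 0 = (if m = N then 2 ^ N else 0)"
proof (induction N arbitrary: m)
  case (Suc N)
  have "Poly_Mapping.lookup ((two_series ^ Suc N) $ m) 0 =
    (\<Sum>i=0..m. (if i = 1 then 2 else 0) * (if m - i = N then 2 ^ N else 0))"
    by (simp add: fps_mult_nth lookup_sum lookup_mult_const lookup_two_series_const Suc)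
  also have "\<dots> = (\<Sum>i\<in>{0..m} \<inter> {1}. 2 * (if m - i = N then 2 ^ N else 0))"
    by (rule sum.mono_neutral_cong_right) auto
  also have "{0..m} \<inter> {1} = (if m = 0 then {} else {1})" by auto
  also have "(\<Sum>i\<in>(if m = 0 then {} else {1}). 2 * (if m - i = N then 2 ^ N else 0)) = (if m = Suc N then 2 ^ Suc N else (0::rat))"
    by auto
  finally show ?case .
qed (simp add: lookup_one)

text \<open>
  From \<open>F = 2 log x - \<Sum>n\<ge>1. \<ell>\<^sub>n F^(2^n)\<close>: to first order \<open>\<ell>\<^sub>n\<close> is \<open>v\<^sub>n / 2\<close> and \<open>F\<close> is \<open>2 x\<close>. The
  index shift comes from the exponent vectors, where \<open>j\<close> stands for \<open>v\<^sub>j\<^sub>+\<^sub>1\<close>.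
\<close>

lemma lookup_two_series_linear:
  "Poly_Mapping.lookup (two_series $ m) (Poly_Mapping.single j 1) =
    (if m = 2 ^ Suc j then 1 - 2 ^ 2 ^ Suc j / 2 else 0)"
proof -
  have "(\<Sum>n=1..m. Poly_Mapping.lookup (log_coeff n * (two_series ^ 2 ^ n) $ m) (Poly_Mapping.single j 1)) =
    (\<Sum>n=1..m. (if n = Suc j then 1 / 2 else 0) * (if m = 2 ^ n then 2 ^ 2 ^ n else 0))"
    by (intro sum.cong refl) (simp add: lookup_mult_linear lookup_log_coeff_const lookup_log_coeff_linear
      lookup_two_series_power_const del: One_nat_def)
  also have "\<dots> = (\<Sum>n\<in>{1..m} \<inter> {Suc j}. 1 / 2 * (if m = 2 ^ n then 2 ^ 2 ^ n else 0))"
    by (rule sum.mono_neutral_cong_right) auto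
  also have "\<dots> = (if m = 2 ^ Suc j then 2 ^ 2 ^ Suc j / 2 else 0)"
  proof (cases "m = 2 ^ Suc j")
    case True
    then have "Suc j \<le> m" using less_exp[of "Suc j"] by simp
    then have "{1..m} \<inter> {Suc j} = {Suc j}" by auto
    then show ?thesis using True by simp
  next
    case False
    have "(\<Sum>n\<in>{1..m} \<inter> {Suc j}. 1 / 2 * (if m = 2 ^ n then 2 ^ 2 ^ n else 0)) = (0::rat)"
      by (rule sum.neutral) (use False in auto)
    then show ?thesis using False by auto
  qed
  finally show ?thesis
    by (subst two_series_expansion)
      (simp add: lookup_minus lookup_sum lookup_two_mult lookup_bp_log_linear del: One_nat_def power_Suc)
qed

lemma v_in_v_ideal: "v j \<in> v_ideal"
  unfolding v_ideal_def by (rule bp_ideal.span_base) simp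

lemma mult_in_v_ideal_power_2:
  assumes "c \<in> v_ideal" "d \<in> v_ideal" shows "c * d \<in> v_ideal_power 2"
proof -
  have "(\<Prod>i<2. if i = (0::nat) then c else d) = c * d" by (simp add: numeral_2_eq_2)
  then show ?thesis unfolding v_ideal_power_def using assms
    by (intro bp_ideal.span_base CollectI exI[of _ "\<lambda>i. if i = 0 then c else d"] conjI) simp_all
qed

text \<open>
  Monomials of degree at least two are multiples of products of two of the \<open>v\<^sub>i\<close>, and an even multiple of
  \<open>v\<^sub>i\<close> is a multiple of \<open>v\<^sub>0 v\<^sub>i\<close>.
\<close>

lemma v_ideal_power_2I:
  fixes p :: bp
  assumes "Poly_Mapping.lookup p 0 = 0"
    and "\<And>j. \<exists>d. Poly_Mapping.lookup p (Poly_Mapping.single j 1) = 2 * d"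
  shows "p \<in> v_ideal_power 2"
proof -
  have peel: "\<exists>i T'. T = Poly_Mapping.single i 1 + T'" if "T \<noteq> 0" for T :: "nat \<Rightarrow>\<^sub>0 nat"
  proof -
    obtain i where "Poly_Mapping.lookup T i \<noteq> 0"
      using \<open>T \<noteq> 0\<close> by (auto simp: poly_mapping_eq_iff fun_eq_iff)
    then have "T = Poly_Mapping.single i 1 + (T - Poly_Mapping.single i 1)"
      by (intro poly_mapping_eqI) (auto simp: lookup_add lookup_minus lookup_single when_def)
    then show ?thesis by blast
  qed
  have scaled: "c * (v i * v j) \<in> v_ideal_power 2" for c i j
    using bp_ideal.span_scale[OF mult_in_v_ideal_power_2[OF v_in_v_ideal v_in_v_ideal, unfolded v_ideal_power_def]]
    unfolding v_ideal_power_def .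
  have v_Suc: "v (Suc i) = Poly_Mapping.single (Poly_Mapping.single i 1) 1" for i by (simp add: v_def)
  have "Poly_Mapping.single T (Poly_Mapping.lookup p T) \<in> v_ideal_power 2" if T: "T \<in> Poly_Mapping.keys p" for T
  proof -
    let ?c = "Poly_Mapping.lookup p T"
    have "T \<noteq> 0" using T assms(1) by (auto simp: in_keys_iff)
    then obtain i T' where T': "T = Poly_Mapping.single i 1 + T'" using peel by blast
    show ?thesis
    proof (cases "T' = 0")
      case True
      then have T1: "T = Poly_Mapping.single i 1" using T' by simp
      obtain d where "?c = 2 * d" using assms(2) unfolding T1 by blast
      then have "Poly_Mapping.single T ?c = 2 * Poly_Mapping.single T d"
        by (simp only: mult_2 single_add)
      also have "Poly_Mapping.single T d = Poly_Mapping.single 0 d * v (Suc i)"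
        by (simp add: v_Suc T1 mult_single)
      also have "2 * (Poly_Mapping.single 0 d * v (Suc i)) = Poly_Mapping.single 0 d * (v 0 * v (Suc i))"
        by (simp only: v_def[of 0] if_True refl mult.left_commute)
      finally have "Poly_Mapping.single T ?c = Poly_Mapping.single 0 d * (v 0 * v (Suc i))" .
      then show ?thesis
        by (simp only: scaled)
    next
      case False
      then obtain i' T'' where "T' = Poly_Mapping.single i' 1 + T''" using peel by blast
      then have "Poly_Mapping.single T ?c = Poly_Mapping.single T'' ?c * (v (Suc i) * v (Suc i'))"
        unfolding T' by (simp add: v_Suc mult_single ac_simps)
      then show ?thesis
        by (simp only: scaled)
    qed
  qed
  then have "(\<Sum>T\<in>Poly_Mapping.keys p. Poly_Mapping.single T (Poly_Mapping.lookup p T)) \<in> v_ideal_power 2"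
    unfolding v_ideal_power_def by (intro bp_ideal.span_sum)
  then show ?thesis by (simp flip: poly_mapping_sum_single)
qed

lemma rat_of_zloc2_2: "rat_of_zloc2 2 = 2"
  by (simp only: one_add_one[symmetric] plus_zloc2.rep_eq one_zloc2.rep_eq)

lemma rat_of_zloc2_power: "rat_of_zloc2 (c ^ n) = rat_of_zloc2 c ^ n"
  by (induction n) (simp_all add: one_zloc2.rep_eq times_zloc2.rep_eq)

lemma lookup_two_series_coeff_const:
  "Poly_Mapping.lookup (two_series_coeff m) 0 = (if m = 0 then 2 else 0)"
proof -
  have "rat_of_zloc2 (Poly_Mapping.lookup (two_series_coeff m) 0) = rat_of_zloc2 (if m = 0 then 2 else 0)"
    unfolding lookup_rationalize[symmetric] rationalize_two_series_coeff
    by (simp add: lookup_two_series_const rat_of_zloc2_2 zero_zloc2.rep_eq)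
  then show ?thesis by (simp only: rat_of_zloc2_inject)
qed

lemma lookup_two_series_coeff_linear:
  "Poly_Mapping.lookup (two_series_coeff m) (Poly_Mapping.single j 1) =
    (if Suc m = 2 ^ Suc j then 1 - 2 * 2 ^ (2 ^ Suc j - 2) else 0)"
proof -
  have Suc_Suc_minus: "Suc (Suc (n - 2)) = n" if "2 \<le> n" for n :: nat using that by arith
  have "(2::nat) \<le> 2 ^ Suc j" by simp
  then have "(2::rat) ^ 2 ^ Suc j = 2 ^ Suc (Suc (2 ^ Suc j - 2))"
    by (simp only: Suc_Suc_minus)
  then have "(2::rat) ^ 2 ^ Suc j / 2 = 2 * 2 ^ (2 ^ Suc j - 2)"
    by (simp only: power_Suc)
  then have "rat_of_zloc2 (Poly_Mapping.lookup (two_series_coeff m) (Poly_Mapping.single j 1)) =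
    rat_of_zloc2 (if Suc m = 2 ^ Suc j then 1 - 2 * 2 ^ (2 ^ Suc j - 2) else 0)"
    unfolding lookup_rationalize[symmetric] rationalize_two_series_coeff lookup_two_series_linear
    by (simp add: minus_zloc2.rep_eq times_zloc2.rep_eq one_zloc2.rep_eq rat_of_zloc2_power rat_of_zloc2_2
      zero_zloc2.rep_eq del: power_Suc)
  then show ?thesis by (simp only: rat_of_zloc2_inject)
qed

text \<open>
  For \<open>i > 0\<close> the linear coefficient of \<open>v\<^sub>i\<close> is \<open>1 - 2^(2^i - 1)\<close>, which is odd.
\<close>

lemma two_series_coeff_cong_v: "two_series_coeff (2 ^ i - 1) - v i \<in> v_ideal_power 2"
proof (rule v_ideal_power_2I)
  have p2: "(2::nat) ^ i - 1 = 0 \<longleftrightarrow> i = 0" using one_less_power[of "2::nat" i] by (cases "i = 0") simp_all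
  show "Poly_Mapping.lookup (two_series_coeff (2 ^ i - 1) - v i) 0 = 0"
  proof (cases "i = 0")
    case True
    then show ?thesis by (simp add: lookup_minus lookup_two_series_coeff_const v_def lookup_numeral)
  next
    case False
    then show ?thesis using p2 by (simp add: lookup_minus lookup_two_series_coeff_const lookup_v_const)
  qed
  fix j
  have S: "Suc (2 ^ i - 1) = 2 ^ i" by simp
  show "\<exists>d. Poly_Mapping.lookup (two_series_coeff (2 ^ i - 1) - v i) (Poly_Mapping.single j 1) = 2 * d"
  proof (cases "i = Suc j")
    case True
    then have "Poly_Mapping.lookup (two_series_coeff (2 ^ i - 1) - v i) (Poly_Mapping.single j 1) =
      2 * (- (2 ^ (2 ^ Suc j - 2)))"
      by (simp add: lookup_minus lookup_two_series_coeff_linear lookup_v_linear S del: One_nat_def power_Suc)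
    then show ?thesis by blast
  next
    case False
    then have "Suc (2 ^ i - 1) \<noteq> 2 ^ Suc j" unfolding S by (simp only: power_inject_exp) simp
    moreover have "Poly_Mapping.lookup (v i) (Poly_Mapping.single j 1) = 0"
    proof (cases "i = 0")
      case True
      then show ?thesis by (simp add: v_def lookup_numeral when_def single_1_neq_0 del: One_nat_def)
    qed (use False in \<open>simp add: lookup_v_linear del: One_nat_def\<close>)
    ultimately have "Poly_Mapping.lookup (two_series_coeff (2 ^ i - 1) - v i) (Poly_Mapping.single j 1) = 2 * 0"
      by (simp add: lookup_minus lookup_two_series_coeff_linear del: One_nat_def power_Suc)
    then show ?thesis by blast
  qed
qed

lemma two_series_coeff_in_square:
  assumes "\<And>i. Suc m \<noteq> 2 ^ i"
  shows "two_series_coeff m \<in> v_ideal_power 2"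
proof (rule v_ideal_power_2I)
  show "Poly_Mapping.lookup (two_series_coeff m) 0 = 0"
    using assms[of 0] by (simp add: lookup_two_series_coeff_const)
  show "\<exists>d. Poly_Mapping.lookup (two_series_coeff m) (Poly_Mapping.single j 1) = 2 * d" for j
    using assms[of "Suc j"] by (intro exI[of _ 0]) (simp add: lookup_two_series_coeff_linear del: power_Suc One_nat_def)
qed

section \<open>Sums in characteristic two\<close>

text \<open>
  The terms cancel in the pairs \<open>x, g x\<close>.
\<close>

lemma sum_involution_char_2:
  fixes f :: "'b \<Rightarrow> 'a::ab_group_add"
  assumes "finite A" "\<And>x. x \<in> A \<Longrightarrow> g x \<in> A" "\<And>x. x \<in> A \<Longrightarrow> g (g x) = x" "\<And>x. x \<in> A \<Longrightarrow> g x \<noteq> x"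
    "\<And>x. x \<in> A \<Longrightarrow> f x + f (g x) = 0"
  shows "sum f A = 0"
  using assms
proof (induction "card A" arbitrary: A rule: less_induct)
  case (less A)
  show ?case
  proof (cases "A = {}")
    case False
    then obtain x where x: "x \<in> A" by blast
    let ?B = "A - {x, g x}"
    have "g y \<in> ?B" if "y \<in> ?B" for y
    proof -
      have "g (g y) = y" "g (g x) = x" "g y \<in> A" using that x less.prems(2,3) by auto
      then show ?thesis using that by auto
    qed
    moreover have "card ?B < card A" using x less.prems(1) by (intro psubset_card_mono) auto
    ultimately have "sum f ?B = 0" using less.prems by (intro less.hyps) auto
    moreover have "sum f A = sum f {x, g x} + sum f ?B"
      using x less.prems(1,2) by (subst sum.subset_diff[of "{x, g x}"]) (auto simp: add.commute)
    moreover have "sum f {x, g x} = f x + f (g x)"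
      using less.prems(4)[OF x] by (subst sum.insert) auto
    ultimately show ?thesis using less.prems(5)[OF x] by simp
  qed simp
qed

lemma bit_add_self: "(c::bit) + c = 0" by (cases c) simp_all

lemma poly2_add_self: "(p :: 'k poly2) + p = 0"
  by (rule poly_mapping_eqI) (simp only: lookup_add bit_add_self lookup_zero)

lemma poly2_add_eq_0_iff: "(p :: 'k poly2) + q = 0 \<longleftrightarrow> p = q"
  using add_right_cancel[of p q q] by (simp only: poly2_add_self)

lemma poly2_square_add: "((p :: 'k poly2) + q) ^ 2 = p ^ 2 + q ^ 2"
  by (simp add: power2_sum mult_2 poly2_add_self)

lemma poly2_frobenius_add: "((p :: 'k poly2) + q) ^ 2 ^ i = p ^ 2 ^ i + q ^ 2 ^ i"
proof (induction i)
  case (Suc i)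
  have *: "r ^ 2 ^ Suc i = (r ^ 2 ^ i) ^ 2" for r :: "'k poly2" by (simp flip: power_mult add: mult.commute)
  show ?case unfolding * Suc by (rule poly2_square_add)
qed simp

lemma poly2_frobenius_sum: "finite A \<Longrightarrow> (sum f A :: 'k poly2) ^ 2 ^ i = (\<Sum>a\<in>A. f a ^ 2 ^ i)"
  by (induction A rule: finite_induct) (simp_all add: poly2_frobenius_add power_0_left)

section \<open>Polynomials acting on functions of integer tuples\<close>

text \<open>
  The monomial with exponent \<open>E\<close> shifts the argument of a function by \<open>E\<close>. On functions with
  \<open>h + h = 0\<close> this makes the polynomials over the field with two elements act. The arguments are
  integers so that shifts are never truncated; the vanishing of \<open>z\<^sub>J\<close> for tuples \<open>J\<close> that are not
  positive becomes a hypothesis on \<open>h\<close>.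
\<close>

definition shift_act :: "'k poly2 \<Rightarrow> (('k \<Rightarrow> int) \<Rightarrow> 'u::ab_group_add) \<Rightarrow> ('k \<Rightarrow> int) \<Rightarrow> 'u"
  where "shift_act P h J = (\<Sum>E\<in>Poly_Mapping.keys P. h (\<lambda>j. J j - int (Poly_Mapping.lookup E j)))"

lemma shift_act_0 [simp]: "shift_act 0 h J = 0" by (simp add: shift_act_def)

lemma shift_act_single [simp]:
  "shift_act (Poly_Mapping.single E 1) h J = h (\<lambda>j. J j - int (Poly_Mapping.lookup E j))"
  by (simp add: shift_act_def)

lemma shift_act_add:
  fixes h :: "('k \<Rightarrow> int) \<Rightarrow> 'u::ab_group_add"
  assumes "\<And>J. h J + h J = 0"
  shows "shift_act (P + Q) h J = shift_act P h J + shift_act Q h J"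
proof -
  let ?h = "\<lambda>E. h (\<lambda>j. J j - int (Poly_Mapping.lookup E j))"
  let ?A = "Poly_Mapping.keys P \<union> Poly_Mapping.keys Q"
  have *: "shift_act R h J = (\<Sum>E\<in>?A. if Poly_Mapping.lookup R E = 1 then ?h E else 0)"
    if "Poly_Mapping.keys R \<subseteq> ?A" for R
    unfolding shift_act_def by (rule sum.mono_neutral_cong_left) (use that in \<open>auto simp: in_keys_iff\<close>)
  have "(if Poly_Mapping.lookup (P + Q) E = 1 then ?h E else 0) =
    (if Poly_Mapping.lookup P E = 1 then ?h E else 0) + (if Poly_Mapping.lookup Q E = 1 then ?h E else 0)" for E
    by (cases "Poly_Mapping.lookup P E"; cases "Poly_Mapping.lookup Q E")
      (simp_all add: lookup_add assms)
  then show ?thesis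
    using keys_add[of P Q] by (simp only: *[of P] *[of Q] *[of "P + Q"] Un_upper1 Un_upper2 sum.distrib)
qed

lemma shift_act_sum:
  fixes h :: "('k \<Rightarrow> int) \<Rightarrow> 'u::ab_group_add"
  assumes "\<And>J. h J + h J = 0"
  shows "shift_act (sum f A) h J = (\<Sum>a\<in>A. shift_act (f a) h J)"
  by (induction A rule: infinite_finite_induct) (simp_all add: shift_act_add[OF assms])

lemma shift_act_double: "(\<And>J. h J + h J = 0) \<Longrightarrow> shift_act P h J + shift_act P h J = 0"
  unfolding shift_act_def by (simp flip: sum.distrib)

lemma shift_act_mult:
  fixes h :: "('k \<Rightarrow> int) \<Rightarrow> 'u::ab_group_add"
  assumes "\<And>J. h J + h J = 0"
  shows "shift_act (P * Q) h J = shift_act P (shift_act Q h) J"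
proof (induction P rule: poly_mapping_add_induct)
  case (single T c)
  show ?case
  proof (cases "c = 0")
    case False
    then have c: "c = 1" by simp
    show ?thesis unfolding c
    proof (induction Q rule: poly_mapping_add_induct)
      case (single U d)
      show ?case by (cases "d = 0") (simp_all add: mult_single lookup_add algebra_simps)
    qed (simp_all add: distrib_left shift_act_add[OF assms])
  qed simp
qed (simp_all add: distrib_right shift_act_add[OF assms] shift_act_add[OF shift_act_double[OF assms]])

lemma shift_act_fun_sum: "shift_act P (\<lambda>J. \<Sum>a\<in>A. h a J) J = (\<Sum>a\<in>A. shift_act P (h a) J)"
  unfolding shift_act_def by (rule sum.swap)

lemma shift_act_fun_add: "shift_act P (\<lambda>J. h J + g J) J = shift_act P h J + shift_act P g J"
  unfolding shift_act_def by (rule sum.distrib)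

lemma shift_act_eq_0: "(\<And>J'. (\<And>j. J' j \<le> J j) \<Longrightarrow> h J' = 0) \<Longrightarrow> shift_act P h J = 0"
  unfolding shift_act_def by (rule sum.neutral) auto

section \<open>The Moore determinant\<close>

text \<open>
  The enumerations of the variables. They are made extensional, that is, fixed outside
  \<open>{..<CARD('k)}\<close>, so that there are finitely many and each bijection is counted once.
\<close>

definition enums :: "(nat \<Rightarrow> 'k::finite) set"
  where "enums = {b \<in> {..<CARD('k)} \<rightarrow>\<^sub>E UNIV. bij_betw b {..<CARD('k)} UNIV}"

lemma finite_enums [simp]: "finite (enums :: (nat \<Rightarrow> 'k::finite) set)"
  unfolding enums_def by (rule finite_subset[of _ "{..<CARD('k)} \<rightarrow>\<^sub>E UNIV"]) (auto intro: finite_PiE)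

lemma enums_nonempty: "enums \<noteq> ({} :: (nat \<Rightarrow> 'k::finite) set)"
proof -
  obtain b where b: "bij_betw b {0..<CARD('k)} (UNIV :: 'k set)"
    using ex_bij_betw_nat_finite[of "UNIV :: 'k set"] by auto
  then have "restrict b {..<CARD('k)} \<in> enums"
    by (auto simp: enums_def atLeast0LessThan bij_betw_restrict_eq)
  then show ?thesis by blast
qed

lemma enums_bij: "b \<in> enums \<Longrightarrow> bij_betw b {..<CARD('k)} (UNIV :: 'k::finite set)"
  by (simp add: enums_def)

lemma enums_inj: "b \<in> (enums :: (nat \<Rightarrow> 'k::finite) set) \<Longrightarrow> i < CARD('k) \<Longrightarrow> i' < CARD('k) \<Longrightarrow> b i = b i' \<longleftrightarrow> i = i'"
  using enums_bij[of b] by (auto simp: bij_betw_def inj_on_def)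

lemma enums_surj: "b \<in> (enums :: (nat \<Rightarrow> 'k::finite) set) \<Longrightarrow> \<exists>i<CARD('k). b i = m"
proof -
  assume "b \<in> enums"
  then have "m \<in> b ` {..<CARD('k)}" using enums_bij[of b] by (simp add: bij_betw_def)
  then show ?thesis by auto
qed

lemma enums_eqI:
  "b \<in> (enums :: (nat \<Rightarrow> 'k::finite) set) \<Longrightarrow> b' \<in> enums \<Longrightarrow> (\<And>i. i < CARD('k) \<Longrightarrow> b i = b' i) \<Longrightarrow> b = b'"
  by (rule PiE_ext[of b "{..<CARD('k)}" "\<lambda>_. UNIV" b']) (simp_all add: enums_def)

definition enum_exponent :: "(nat \<Rightarrow> nat) \<Rightarrow> (nat \<Rightarrow> 'k::finite) \<Rightarrow> ('k \<Rightarrow>\<^sub>0 nat)"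
  where "enum_exponent t b = (\<Sum>i<CARD('k). Poly_Mapping.single (b i) (t i))"

lemma lookup_enum_exponent:
  assumes "b \<in> (enums :: (nat \<Rightarrow> 'k::finite) set)" "i < CARD('k)"
  shows "Poly_Mapping.lookup (enum_exponent t b) (b i) = t i"
proof -
  have "Poly_Mapping.lookup (enum_exponent t b) (b i) = (\<Sum>i'<CARD('k). if i' = i then t i else 0)"
    unfolding enum_exponent_def lookup_sum
    by (rule sum.cong) (simp_all add: lookup_single when_def enums_inj[OF assms(1)] assms(2))
  then show ?thesis using assms(2) by simp
qed

text \<open>
  If the exponents in \<open>t\<close> are distinct, the monomial tells which variable carries which exponent.
\<close>

lemma enum_exponent_inj:
  fixes b b' :: "nat \<Rightarrow> 'k::finite"
  assumes "b \<in> enums" "b' \<in> enums" "inj_on t {..<CARD('k)}" "enum_exponent t b = enum_exponent t b'"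
  shows "b = b'"
proof (rule enums_eqI[OF assms(1,2)])
  fix i assume i: "i < CARD('k)"
  obtain i' where i': "i' < CARD('k)" "b' i' = b i" using enums_surj[OF assms(2)] by blast
  have "t i = Poly_Mapping.lookup (enum_exponent t b') (b' i')"
    unfolding assms(4)[symmetric] i'(2) by (rule lookup_enum_exponent[OF assms(1) i, symmetric])
  also have "\<dots> = t i'" by (rule lookup_enum_exponent[OF assms(2) i'(1)])
  finally have "i = i'" by (rule inj_onD[OF assms(3)]) (use i i' in simp_all)
  then show "b i = b' i" using i' by simp
qed

lemma sum_UNIV_enum: "b \<in> enums \<Longrightarrow> (\<Sum>j\<in>UNIV. g j) = (\<Sum>i<CARD('k). g (b i))" for g :: "'k::finite \<Rightarrow> 'a::comm_monoid_add"
  by (simp add: sum.reindex_bij_betw[OF enums_bij, of b g])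

text \<open>
  The exponent vector of a monomial of the Moore determinant, used at the same time as a linear
  weight on tuples.
\<close>

definition moore_weight :: "(nat \<Rightarrow> 'k::finite) \<Rightarrow> 'k \<Rightarrow> int"
  where "moore_weight b j = int (Poly_Mapping.lookup (enum_exponent (\<lambda>i. 2 ^ i) b) j)"

lemma moore_weight_pos: "moore_weight b j \<ge> 0" by (simp add: moore_weight_def)

lemma moore_weight_apply: "b \<in> (enums :: (nat \<Rightarrow> 'k::finite) set) \<Longrightarrow> i < CARD('k) \<Longrightarrow> moore_weight b (b i) = 2 ^ i"
  by (simp add: moore_weight_def lookup_enum_exponent)

lemma moore_weight_total: "b \<in> (enums :: (nat \<Rightarrow> 'k::finite) set) \<Longrightarrow> (\<Sum>j\<in>UNIV. moore_weight b j) = (\<Sum>i<CARD('k). 2 ^ i)"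
  by (simp add: sum_UNIV_enum moore_weight_apply)

text \<open>
  The Cauchy-Schwarz inequality is strict here: the two vectors are rearrangements of each other, so
  they have the same norm, and they differ.
\<close>

lemma moore_weight_inner_less:
  fixes b c :: "nat \<Rightarrow> 'k::finite"
  assumes "b \<in> enums" "c \<in> enums" "b \<noteq> c"
  shows "(\<Sum>j\<in>UNIV. moore_weight b j * moore_weight c j) < (\<Sum>j\<in>UNIV. moore_weight b j * moore_weight b j)"
proof -
  have sq: "(\<Sum>j\<in>UNIV. moore_weight b j * moore_weight b j) = (\<Sum>i<CARD('k). 2 ^ i * 2 ^ i)"
    if "b \<in> enums" for b :: "nat \<Rightarrow> 'k"
    using that by (simp add: sum_UNIV_enum[OF that] moore_weight_apply)
  have "inj_on (\<lambda>i. 2 ^ i :: nat) {..<CARD('k)}" by (simp add: inj_on_def)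
  then have "enum_exponent (\<lambda>i. 2 ^ i) b \<noteq> enum_exponent (\<lambda>i. 2 ^ i) c"
    using enum_exponent_inj assms by blast
  then obtain j where j: "moore_weight b j \<noteq> moore_weight c j"
    by (auto simp: moore_weight_def poly_mapping_eq_iff fun_eq_iff)
  have "0 < (\<Sum>j\<in>UNIV. (moore_weight b j - moore_weight c j) ^ 2)"
    by (rule sum_pos2[of _ j]) (use j in auto)
  also have "\<dots> = (\<Sum>j\<in>UNIV. moore_weight b j * moore_weight b j) + (\<Sum>j\<in>UNIV. moore_weight c j * moore_weight c j)
      - 2 * (\<Sum>j\<in>UNIV. moore_weight b j * moore_weight c j)"
    by (simp add: power2_eq_square algebra_simps sum.distrib sum_subtractf sum_distrib_left)
  finally show ?thesis using sq[OF assms(1)] sq[OF assms(2)] by linarith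
qed

text \<open>
  The determinant of the matrix of all \<open>x\<^sub>j^(2^i)\<close>; signs disappear in characteristic two, so it is
  a permanent.
\<close>

definition moore :: "'k::finite poly2"
  where "moore = (\<Sum>b\<in>enums. Poly_Mapping.single (enum_exponent (\<lambda>i. 2 ^ i) b) 1)"

lemma shift_act_moore:
  fixes h :: "('k::finite \<Rightarrow> int) \<Rightarrow> 'u::ab_group_add"
  assumes "\<And>J. h J + h J = 0"
  shows "shift_act moore h J = (\<Sum>b\<in>enums. h (\<lambda>j. J j - moore_weight b j))"
  by (simp add: moore_def shift_act_sum[OF assms] moore_weight_def)

text \<open>
  Evaluate \<open>D h = 0\<close> at \<open>J + E\<close> for the exponent \<open>E\<close> of one monomial of \<open>D\<close>. This expresses \<open>h J\<close> by
  values of \<open>h\<close> at the tuples \<open>J + E - E'\<close>, which have the same total \<open>n\<close> but a larger weight with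
  respect to \<open>E\<close>. Among tuples with all entries at least \<open>c\<close> and total \<open>n\<close> the weight is bounded, so
  the descent ends outside the support of \<open>h\<close>.
\<close>

lemma shift_act_moore_injective:
  fixes h :: "('k::finite \<Rightarrow> int) \<Rightarrow> 'u::ab_group_add"
  assumes char2: "\<And>J. h J + h J = 0"
    and bounded: "\<And>J j. J j < c \<Longrightarrow> h J = 0"
    and zero: "\<And>J. (\<Sum>j\<in>UNIV. J j) = n + (\<Sum>i<CARD('k). 2 ^ i) \<Longrightarrow> shift_act moore h J = 0"
    and J: "(\<Sum>j\<in>UNIV. J j) = n"
  shows "h J = 0"
proof -
  obtain b :: "nat \<Rightarrow> 'k" where b: "b \<in> enums" using enums_nonempty by blast
  let ?\<phi> = "\<lambda>J. \<Sum>j\<in>UNIV. moore_weight b j * J j"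
  \<comment> \<open>With total \<open>n\<close> and entries at least \<open>c\<close>, no entry exceeds \<open>B\<close>.\<close>
  define B where "B = \<bar>n\<bar> + (\<Sum>j\<in>(UNIV::'k set). \<bar>c\<bar>)"
  define M where "M = (\<Sum>j\<in>UNIV. moore_weight b j * B)"
  have le: "?\<phi> J \<le> M" if "\<forall>j. c \<le> J j" "(\<Sum>j\<in>UNIV. J j) = n" for J
    unfolding M_def
  proof (intro sum_mono mult_left_mono moore_weight_pos)
    fix j
    have "n = J j + (\<Sum>j\<in>UNIV - {j}. J j)" using that(2) sum.remove[of UNIV j J] by simp
    moreover have "(\<Sum>i\<in>UNIV - {j}. - \<bar>c\<bar>) \<le> (\<Sum>j\<in>UNIV - {j}. J j)"
    proof (rule sum_mono)
      fix i show "- \<bar>c\<bar> \<le> J i" using that(1)[rule_format, of i] by linarith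
    qed
    moreover have "(\<Sum>i\<in>UNIV - {j}. \<bar>c\<bar>) \<le> (\<Sum>i\<in>(UNIV :: 'k set). \<bar>c\<bar>)" by (rule sum_mono2) auto
    ultimately show "J j \<le> B" unfolding B_def sum_negf by linarith
  qed
  show ?thesis using J
  proof (induction "nat (M - ?\<phi> J)" arbitrary: J rule: less_induct)
    case (less J)
    show ?case
    proof (cases "\<forall>j. c \<le> J j")
      case False
      then show ?thesis using bounded by (meson not_le)
    next
      case True
      have *: "h (\<lambda>j. J j + moore_weight b j - moore_weight d j) = 0" if d: "d \<in> enums - {b}" for d
      proof (cases "\<forall>j. c \<le> J j + moore_weight b j - moore_weight d j")
        case False
        then show ?thesis using bounded by (meson not_le)
      next
        case T: True
        have tot: "(\<Sum>j\<in>UNIV. J j + moore_weight b j - moore_weight d j) = n"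
          using less.prems moore_weight_total[OF b] moore_weight_total[of d] d
          by (simp add: sum.distrib sum_subtractf)
        have "?\<phi> (\<lambda>j. J j + moore_weight b j - moore_weight d j) =
          ?\<phi> J + (\<Sum>j\<in>UNIV. moore_weight b j * moore_weight b j) - (\<Sum>j\<in>UNIV. moore_weight b j * moore_weight d j)"
          by (simp add: algebra_simps sum.distrib sum_subtractf)
        moreover have "(\<Sum>j\<in>UNIV. moore_weight b j * moore_weight d j) < (\<Sum>j\<in>UNIV. moore_weight b j * moore_weight b j)"
          using moore_weight_inner_less[OF b, of d] d by auto
        ultimately have "?\<phi> J < ?\<phi> (\<lambda>j. J j + moore_weight b j - moore_weight d j)" by linarith
        with le[OF T tot] have "nat (M - ?\<phi> (\<lambda>j. J j + moore_weight b j - moore_weight d j)) < nat (M - ?\<phi> J)"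
          by linarith
        then show ?thesis using tot by (intro less.hyps)
      qed
      have "(\<Sum>j\<in>UNIV. J j + moore_weight b j) = n + (\<Sum>i<CARD('k). 2 ^ i)"
        by (simp add: sum.distrib less.prems moore_weight_total[OF b])
      from zero[OF this] have "0 = (\<Sum>d\<in>enums. h (\<lambda>j. J j + moore_weight b j - moore_weight d j))"
        by (simp add: shift_act_moore[OF char2])
      also have "\<dots> = h (\<lambda>j. J j + moore_weight b j - moore_weight b j) +
          (\<Sum>d\<in>enums - {b}. h (\<lambda>j. J j + moore_weight b j - moore_weight d j))"
        using b by (intro sum.remove) auto
      also have "\<dots> = h J" by (simp add: *)
      finally show ?thesis by simp
    qed
  qed
qed

text \<open>
  A polynomial is recovered from its action on the indicator function of the origin, and the
  resulting function is supported on nonnegative tuples.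
\<close>

lemma moore_cancel:
  fixes P :: "'k::finite poly2"
  assumes "moore * P = 0" shows "P = 0"
proof (rule poly_mapping_eqI)
  fix E
  let ?\<delta> = "\<lambda>J. if \<forall>j. J j = (0::int) then 1 else (0::bit)"
  have \<delta>: "?\<delta> J + ?\<delta> J = 0" for J :: "'k \<Rightarrow> int" by (rule bit_add_self)
  have eq: "shift_act P ?\<delta> (\<lambda>j. int (Poly_Mapping.lookup E j)) = Poly_Mapping.lookup P E"
  proof -
    have "shift_act P ?\<delta> (\<lambda>j. int (Poly_Mapping.lookup E j)) =
      (\<Sum>F\<in>Poly_Mapping.keys P. if F = E then 1 else 0)"
      unfolding shift_act_def by (rule sum.cong) (auto simp: poly_mapping_eq_iff fun_eq_iff)
    then show ?thesis by (auto simp: in_keys_iff)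
  qed
  have "shift_act P ?\<delta> (\<lambda>j. int (Poly_Mapping.lookup E j)) = 0"
  proof (rule shift_act_moore_injective[where c = 0 and n = "\<Sum>j\<in>UNIV. int (Poly_Mapping.lookup E j)"])
    fix J :: "'k \<Rightarrow> int" and j assume "J j < 0"
    show "shift_act P ?\<delta> J = 0"
    proof (rule shift_act_eq_0)
      fix J' :: "'k \<Rightarrow> int" assume "\<And>j. J' j \<le> J j"
      then have "J' j \<noteq> 0" using \<open>J j < 0\<close> by (metis not_le)
      then have "\<not> (\<forall>j. J' j = 0)" by blast
      then show "?\<delta> J' = 0" by (rule if_not_P)
    qed
  next
    fix J :: "'k \<Rightarrow> int"
    show "shift_act moore (shift_act P ?\<delta>) J = 0"
      by (simp add: shift_act_mult[OF \<delta>, symmetric] assms)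
  qed (auto simp: bit_add_self)
  then show "Poly_Mapping.lookup P E = Poly_Mapping.lookup 0 E" by (simp add: eq)
qed

lemma moore_neq_0: "moore \<noteq> (0 :: 'k::finite poly2)"
  using moore_cancel[of "1 :: 'k poly2"] by auto

section \<open>Permanents and cofactors\<close>

definition permanent :: "(nat \<Rightarrow> 'k::finite \<Rightarrow> 'a poly2) \<Rightarrow> 'a poly2"
  where "permanent y = (\<Sum>b\<in>enums. \<Prod>i<CARD('k). y i (b i))"

definition cofactor :: "(nat \<Rightarrow> 'k::finite \<Rightarrow> 'a poly2) \<Rightarrow> nat \<Rightarrow> 'k \<Rightarrow> 'a poly2"
  where "cofactor y i m = (\<Sum>b | b \<in> enums \<and> b i = m. \<Prod>i'\<in>{..<CARD('k)} - {i}. y i' (b i'))"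

lemma permanent_expand_row:
  fixes y :: "nat \<Rightarrow> 'k::finite \<Rightarrow> 'a poly2"
  assumes "i < CARD('k)"
  shows "permanent y = (\<Sum>m\<in>UNIV. y i m * cofactor y i m)"
proof -
  have "permanent y = (\<Sum>b\<in>enums. y i (b i) * (\<Prod>i'\<in>{..<CARD('k)} - {i}. y i' (b i')))"
    unfolding permanent_def by (rule sum.cong) (use assms in \<open>simp_all add: prod.remove[of _ i]\<close>)
  also have "\<dots> = (\<Sum>m\<in>UNIV. \<Sum>b | b \<in> enums \<and> b i = m. y i (b i) * (\<Prod>i'\<in>{..<CARD('k)} - {i}. y i' (b i')))"
    by (rule sum.group[symmetric]) auto
  also have "\<dots> = (\<Sum>m\<in>UNIV. y i m * cofactor y i m)"
    unfolding cofactor_def sum_distrib_left by (intro sum.cong) auto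
  finally show ?thesis .
qed

lemma permanent_expand_column:
  fixes y :: "nat \<Rightarrow> 'k::finite \<Rightarrow> 'a poly2"
  shows "permanent y = (\<Sum>i<CARD('k). y i m * cofactor y i m)"
proof -
  have ex: "\<exists>!i. i < CARD('k) \<and> b i = m" if b: "b \<in> enums" for b :: "nat \<Rightarrow> 'k"
  proof -
    obtain i where i: "i < CARD('k)" "b i = m" using enums_surj[OF b] by blast
    have "j = i" if "j < CARD('k)" "b j = m" for j
      using enums_inj[OF b that(1) i(1)] i(2) that(2) by simp
    then show ?thesis using i by blast
  qed
  define r where "r b = (THE i. i < CARD('k) \<and> b i = m)" for b
  have r: "r b < CARD('k)" "b (r b) = m" if "b \<in> enums" for b
    using theI'[OF ex[OF that]] unfolding r_def by auto
  have r_eq: "r b = i \<longleftrightarrow> b i = m" if "b \<in> enums" "i < CARD('k)" for b i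
    using enums_inj[OF that(1) r(1)[OF that(1)] that(2)] r(2)[OF that(1)] by auto
  have "permanent y = (\<Sum>b\<in>enums. y (r b) m * (\<Prod>i'\<in>{..<CARD('k)} - {r b}. y i' (b i')))"
    unfolding permanent_def
  proof (intro sum.cong refl)
    fix b :: "nat \<Rightarrow> 'k" assume "b \<in> enums"
    then show "(\<Prod>i<CARD('k). y i (b i)) = y (r b) m * (\<Prod>i'\<in>{..<CARD('k)} - {r b}. y i' (b i'))"
      using prod.remove[of "{..<CARD('k)}" "r b" "\<lambda>i. y i (b i)"] r by simp
  qed
  also have "\<dots> = (\<Sum>i<CARD('k). \<Sum>b | b \<in> enums \<and> r b = i. y (r b) m * (\<Prod>i'\<in>{..<CARD('k)} - {r b}. y i' (b i')))"
    by (rule sum.group[symmetric]) (use r in auto)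
  also have "\<dots> = (\<Sum>i<CARD('k). y i m * cofactor y i m)"
    unfolding cofactor_def sum_distrib_left
  proof (rule sum.cong[OF refl])
    fix i assume "i \<in> {..<CARD('k)}"
    then have "{b \<in> enums. r b = i} = {b \<in> enums. b i = m}" using r_eq by auto
    then show "(\<Sum>b | b \<in> enums \<and> r b = i. y (r b) m * (\<Prod>i'\<in>{..<CARD('k)} - {r b}. y i' (b i'))) =
      (\<Sum>b | b \<in> enums \<and> b i = m. y i m * (\<Prod>i'\<in>{..<CARD('k)} - {i}. y i' (b i')))"
      by (intro sum.cong) auto
  qed
  finally show ?thesis .
qed

text \<open>
  Exchanging the two rows is an involution without fixed points on the terms.
\<close>

lemma permanent_equal_rows:
  fixes y :: "nat \<Rightarrow> 'k::finite \<Rightarrow> 'a poly2"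
  assumes "i < CARD('k)" "i' < CARD('k)" "i \<noteq> i'" "y i = y i'"
  shows "permanent y = 0"
  unfolding permanent_def
proof (rule sum_involution_char_2[where g = "\<lambda>b. b \<circ> Transposition.transpose i i'"])
  fix b :: "nat \<Rightarrow> 'k" assume b: "b \<in> enums"
  have bij: "bij_betw (Transposition.transpose i i') {..<CARD('k)} {..<CARD('k)}"
    using assms by (intro bij_betw_byWitness[where f' = "Transposition.transpose i i'"])
      (auto simp: Transposition.transpose_def)
  then show "b \<circ> Transposition.transpose i i' \<in> enums"
    using b bij_betw_trans[OF bij, of b UNIV] assms(1,2)
    by (auto simp: enums_def PiE_def extensional_def Transposition.transpose_def)
  show "b \<circ> Transposition.transpose i i' \<circ> Transposition.transpose i i' = b"
    by (simp add: comp_assoc)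
  show "b \<circ> Transposition.transpose i i' \<noteq> b"
  proof
    assume "b \<circ> Transposition.transpose i i' = b"
    then have "(b \<circ> Transposition.transpose i i') i = b i" by (rule fun_cong)
    then show False using enums_inj[OF b assms(2,1)] assms(3) by simp
  qed
  have "y (Transposition.transpose i i' j) = y j" for j
    using assms(4) by (auto simp: Transposition.transpose_def)
  then have "(\<Prod>j<CARD('k). y j (b j)) = (\<Prod>j<CARD('k). y j ((b \<circ> Transposition.transpose i i') j))"
    using prod.reindex_bij_betw[OF bij, of "\<lambda>j. y j ((b \<circ> Transposition.transpose i i') j)"] by simp
  then show "(\<Prod>j<CARD('k). y j (b j)) + (\<Prod>j<CARD('k). y j ((b \<circ> Transposition.transpose i i') j)) = 0"
    by (simp only: poly2_add_self)
qed simp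

lemma permanent_equal_columns:
  fixes y :: "nat \<Rightarrow> 'k::finite \<Rightarrow> 'a poly2"
  assumes "m \<noteq> m'" "\<And>i. y i m = y i m'"
  shows "permanent y = 0"
  unfolding permanent_def
proof (rule sum_involution_char_2[where g = "\<lambda>b. restrict (Transposition.transpose m m' \<circ> b) {..<CARD('k)}"])
  let ?g = "\<lambda>b :: nat \<Rightarrow> 'k. restrict (Transposition.transpose m m' \<circ> b) {..<CARD('k)}"
  fix b :: "nat \<Rightarrow> 'k" assume b: "b \<in> enums"
  have "bij_betw (Transposition.transpose m m') UNIV UNIV" by simp
  then have "bij_betw (Transposition.transpose m m' \<circ> b) {..<CARD('k)} UNIV"
    by (rule bij_betw_trans[OF enums_bij[OF b]])
  then show g: "?g b \<in> enums"
    by (simp add: enums_def bij_betw_restrict_eq)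
  show "?g (?g b) = b"
    by (rule enums_eqI) (use b g in \<open>auto simp: enums_def bij_betw_restrict_eq comp_assoc[symmetric]
      intro: bij_betw_trans\<close>)
  show "?g b \<noteq> b"
  proof
    assume *: "?g b = b"
    obtain i where i: "i < CARD('k)" "b i = m" using enums_surj[OF b] by blast
    then show False using fun_cong[OF *, of i] assms(1) by simp
  qed
  have "y j (Transposition.transpose m m' n) = y j n" for j n
    using assms(2) by (auto simp: Transposition.transpose_def)
  then have "(\<Prod>j<CARD('k). y j (b j)) = (\<Prod>j<CARD('k). y j (?g b j))" by simp
  then show "(\<Prod>j<CARD('k). y j (b j)) + (\<Prod>j<CARD('k). y j (?g b j)) = 0"
    by (simp only: poly2_add_self)
qed simp

lemma cofactor_row_cong: "(\<And>i'. i' \<noteq> i \<Longrightarrow> y i' = w i') \<Longrightarrow> cofactor y i m = cofactor w i m"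
  unfolding cofactor_def by (intro sum.cong prod.cong) auto

lemma cofactor_column_cong:
  fixes y w :: "nat \<Rightarrow> 'k::finite \<Rightarrow> 'a poly2"
  assumes "i < CARD('k)" "\<And>i' m'. m' \<noteq> m \<Longrightarrow> y i' m' = w i' m'"
  shows "cofactor y i m = cofactor w i m"
  unfolding cofactor_def
proof (intro sum.cong prod.cong refl)
  fix b i' assume "b \<in> {b \<in> enums. b i = m}" "i' \<in> {..<CARD('k)} - {i}"
  then have "b i' \<noteq> m" using enums_inj[of b i' i] assms(1) by auto
  then show "y i' (b i') = w i' (b i')" by (rule assms(2))
qed

lemma permanent_replace_row:
  fixes y :: "nat \<Rightarrow> 'k::finite \<Rightarrow> 'a poly2"
  assumes "i < CARD('k)"
  shows "(\<Sum>m\<in>UNIV. w m * cofactor y i m) = permanent (y(i := w))"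
  unfolding permanent_expand_row[OF assms]
  by (intro sum.cong refl arg_cong2[of _ _ _ _ "(*)"] cofactor_row_cong) simp_all

text \<open>
  Expansion of the permanent along column \<open>m\<close>, after that column has been replaced by column \<open>m'\<close>.
\<close>

lemma column_orthogonality:
  fixes y :: "nat \<Rightarrow> 'k::finite \<Rightarrow> 'a poly2"
  shows "(\<Sum>i<CARD('k). y i m' * cofactor y i m) = (if m' = m then permanent y else 0)"
proof (cases "m' = m")
  case True
  then show ?thesis by (simp add: permanent_expand_column[of y m])
next
  case False
  let ?z = "\<lambda>i n. if n = m then y i m' else y i n"
  have "(\<Sum>i<CARD('k). y i m' * cofactor y i m) = (\<Sum>i<CARD('k). ?z i m * cofactor ?z i m)"
  proof (intro sum.cong refl)
    fix i assume "i \<in> {..<CARD('k)}"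
    then have "cofactor y i m = cofactor ?z i m" by (intro cofactor_column_cong) auto
    then show "y i m' * cofactor y i m = ?z i m * cofactor ?z i m" by simp
  qed
  also have "\<dots> = permanent ?z" by (rule permanent_expand_column[symmetric])
  also have "\<dots> = 0" by (rule permanent_equal_columns[OF False]) simp
  finally show ?thesis using False by simp
qed

section \<open>Division by the Moore determinant\<close>

abbreviation moore_matrix :: "nat \<Rightarrow> 'k \<Rightarrow> 'k poly2"
  where "moore_matrix \<equiv> \<lambda>i m. var m ^ 2 ^ i"

lemma permanent_moore_matrix: "permanent moore_matrix = (moore :: 'k::finite poly2)"
  unfolding permanent_def moore_def
  by (intro sum.cong refl) (simp add: prod_var_power enum_exponent_def)

definition linear_form :: "'k set \<Rightarrow> 'k poly2" where "linear_form S = (\<Sum>m\<in>S. var m)"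

lemma linear_form_power:
  "linear_form (S :: 'k::finite set) ^ 2 ^ i = (\<Sum>m\<in>S. var m ^ 2 ^ i)"
  unfolding linear_form_def by (rule poly2_frobenius_sum) simp

text \<open>
  The product is the power \<open>x\<^sub>S^(2^l - 1)\<close> written without subtraction.
\<close>

lemma linear_form_times_prod: "linear_form S * (\<Prod>i<l. linear_form S ^ 2 ^ i) = linear_form S ^ 2 ^ l"
proof (induction l)
  case (Suc l)
  have "linear_form S * (\<Prod>i<Suc l. linear_form S ^ 2 ^ i) = linear_form S ^ 2 ^ l * linear_form S ^ 2 ^ l"
    using Suc by (simp flip: mult.assoc)
  then show ?case by (simp flip: power_add mult_2)
qed simp

text \<open>
  A proper subset of a set with \<open>k\<close> elements has an even number of supersets: toggle an element
  outside of it.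
\<close>

lemma sum_supersets_char_2:
  fixes c :: "'a poly2"
  shows "(\<Sum>S | R \<subseteq> S. c) = (if R = (UNIV :: 'k::finite set) then c else 0)"
proof (cases "R = UNIV")
  case False
  then obtain a where a: "a \<notin> R" by blast
  have "(\<Sum>S | R \<subseteq> S. c) = 0"
    by (rule sum_involution_char_2[where g = "\<lambda>S. if a \<in> S then S - {a} else insert a S"])
      (use a in \<open>auto simp: poly2_add_self\<close>)
  then show ?thesis using False by simp
next
  case True
  then have "(\<Sum>S | R \<subseteq> S. c) = (\<Sum>S\<in>{UNIV :: 'k set}. c)" by (intro sum.cong) auto
  then show ?thesis using True by simp
qed

text \<open>
  Expanding the product of the \<open>x\<^sub>S^(2^i)\<close> gives the sum over all functions with values in \<open>S\<close>. A
  function is counted once for every \<open>S\<close> that contains its image, which is an odd number of times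
  only if it is onto.
\<close>

lemma p0_sum_linear_forms: "(p0 l :: 'k::finite poly2) = (\<Sum>S\<in>UNIV. \<Prod>i<l. linear_form S ^ 2 ^ i)"
proof -
  let ?x = "\<lambda>f :: nat \<Rightarrow> 'k. \<Prod>i<l. var (f i) ^ 2 ^ i"
  let ?F = "{..<l} \<rightarrow>\<^sub>E (UNIV :: 'k set)"
  have fin: "finite ?F" by (simp add: finite_PiE)
  have "(\<Sum>S\<in>UNIV. \<Prod>i<l. linear_form S ^ 2 ^ i) = (\<Sum>S\<in>UNIV. \<Sum>f\<in>{..<l} \<rightarrow>\<^sub>E S. ?x f)"
    unfolding linear_form_power by (intro sum.cong refl prod_sum_PiE) auto
  also have "\<dots> = (\<Sum>S\<in>UNIV. \<Sum>f\<in>?F. if f ` {..<l} \<subseteq> S then ?x f else 0)"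
    by (intro sum.cong refl sum.mono_neutral_cong_left) (use fin in \<open>auto simp: PiE_def Pi_def\<close>)
  also have "\<dots> = (\<Sum>f\<in>?F. \<Sum>S\<in>UNIV. if f ` {..<l} \<subseteq> S then ?x f else 0)"
    by (rule sum.swap)
  also have "\<dots> = (\<Sum>f\<in>?F. if f ` {..<l} = UNIV then ?x f else 0)"
    by (intro sum.cong refl) (simp add: sum.If_cases sum_supersets_char_2 del: sum_constant)
  also have "\<dots> = p0 l"
    unfolding p0_def using fin by (intro sum.mono_neutral_cong_right) auto
  finally show ?thesis by simp
qed

lemma p0_small:
  assumes "l < CARD('k)" shows "p0 l = (0 :: 'k::finite poly2)"
proof -
  have "f ` {..<l} \<noteq> (UNIV :: 'k set)" for f
    using card_image_le[of "{..<l}" f] assms by auto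
  then show ?thesis by (simp add: p0_def)
qed

text \<open>
  In the proof \<open>Q S\<close> is \<open>D / x\<^sub>S\<close>: replacing the column of some \<open>m \<in> S\<close> by the sum of the columns in \<open>S\<close>
  does not change \<open>D\<close> and turns the entries of that column into powers of \<open>x\<^sub>S\<close>. The sums \<open>c m\<close> of the \<open>Q S\<close> over
  all \<open>S\<close> containing \<open>m\<close> satisfy the linear system that characterizes the cofactors of row 0;
  multiplication with the adjugate matrix shows that \<open>D\<close> annihilates the difference.
\<close>

lemma p0_times_moore_cofactor:
  assumes "l > 0"
  shows "p0 l * moore = (\<Sum>m\<in>UNIV. var m ^ 2 ^ l * cofactor moore_matrix 0 (m :: 'k::finite))"
proof -
  let ?C = "cofactor (moore_matrix :: nat \<Rightarrow> 'k \<Rightarrow> 'k poly2)"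
  let ?L = "linear_form :: 'k set \<Rightarrow> _"
  have k: "0 < CARD('k)" by simp
  define pick where "pick S = (SOME m. m \<in> S)" for S :: "'k set"
  have pick: "pick S \<in> S" if "S \<noteq> {}" for S using that unfolding pick_def by (simp add: some_in_eq)
  \<comment> \<open>The quotient of the Moore determinant by the linear form of \<open>S\<close>.\<close>
  define Q where "Q S = (\<Sum>i<CARD('k). (\<Prod>r<i. ?L S ^ 2 ^ r) * ?C i (pick S))" for S
  have Q: "?L S * Q S = moore" if "S \<noteq> {}" for S
  proof -
    have "?L S * Q S = (\<Sum>i<CARD('k). ?L S ^ 2 ^ i * ?C i (pick S))"
      unfolding Q_def sum_distrib_left mult.assoc[symmetric] linear_form_times_prod ..
    also have "\<dots> = (\<Sum>i<CARD('k). \<Sum>m\<in>S. var m ^ 2 ^ i * ?C i (pick S))"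
      by (simp add: linear_form_power sum_distrib_right)
    also have "\<dots> = (\<Sum>m\<in>S. \<Sum>i<CARD('k). var m ^ 2 ^ i * ?C i (pick S))" by (rule sum.swap)
    also have "\<dots> = (\<Sum>m\<in>S. if m = pick S then moore else 0)"
      by (simp only: column_orthogonality[where y = moore_matrix] permanent_moore_matrix)
    also have "\<dots> = moore" using pick[OF that] by simp
    finally show ?thesis .
  qed
  define c where "c m = (\<Sum>S | m \<in> S. Q S)" for m
  have c: "(\<Sum>m\<in>UNIV. var m ^ 2 ^ l * c m) = (\<Sum>S\<in>UNIV - {{}}. \<Prod>i<l. ?L S ^ 2 ^ i) * moore" for l
  proof -
    have "(\<Sum>m\<in>UNIV. var m ^ 2 ^ l * c m) = (\<Sum>m\<in>UNIV. \<Sum>S\<in>UNIV. if m \<in> S then var m ^ 2 ^ l * Q S else 0)"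
      unfolding c_def by (simp add: sum_distrib_left sum.If_cases)
    also have "\<dots> = (\<Sum>S\<in>UNIV. \<Sum>m\<in>UNIV. if m \<in> S then var m ^ 2 ^ l * Q S else 0)" by (rule sum.swap)
    also have "\<dots> = (\<Sum>S\<in>UNIV. ?L S ^ 2 ^ l * Q S)"
      by (simp add: linear_form_power sum_distrib_right sum.If_cases)
    also have "\<dots> = (\<Sum>S\<in>UNIV - {{}}. ?L S ^ 2 ^ l * Q S)"
      by (rule sum.mono_neutral_right) (auto simp: linear_form_def power_0_left)
    also have "\<dots> = (\<Sum>S\<in>UNIV - {{}}. (\<Prod>i<l. ?L S ^ 2 ^ i) * moore)"
    proof (intro sum.cong refl)
      fix S :: "'k set" assume "S \<in> UNIV - {{}}"
      then have "?L S * Q S = moore" using Q by simp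
      moreover have "?L S ^ 2 ^ l * Q S = (\<Prod>i<l. ?L S ^ 2 ^ i) * (?L S * Q S)"
        unfolding linear_form_times_prod[of S l, symmetric] by (simp only: ac_simps)
      ultimately show "?L S ^ 2 ^ l * Q S = (\<Prod>i<l. ?L S ^ 2 ^ i) * moore" by (simp only:)
    qed
    finally show ?thesis by (simp only: sum_distrib_right)
  qed
  have c_pos: "(\<Sum>m\<in>UNIV. var m ^ 2 ^ l * c m) = p0 l * moore" if "l > 0" for l
  proof -
    have "(\<Sum>S\<in>UNIV - {{}}. \<Prod>i<l. ?L S ^ 2 ^ i) = (\<Sum>S\<in>UNIV. \<Prod>i<l. ?L S ^ 2 ^ i)"
      by (rule sum.mono_neutral_left) (use that in \<open>auto simp: linear_form_def power_0_left\<close>)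
    then show ?thesis by (simp only: c p0_sum_linear_forms)
  qed
  have c_0: "(\<Sum>m\<in>UNIV. var m ^ 2 ^ 0 * c m) = moore"
  proof -
    have "(\<Sum>S\<in>(UNIV :: 'k set set). 1 :: 'k poly2) = 0"
      using sum_supersets_char_2[where R = "{} :: 'k set" and c = "1 :: 'k poly2"]
      by (simp only: empty_subsetI simp_thms UNIV_def[symmetric] empty_not_UNIV if_False)
    moreover have "(\<Sum>S\<in>(UNIV :: 'k set set). 1 :: 'k poly2) = 1 + (\<Sum>S\<in>UNIV - {{} :: 'k set}. 1)"
      by (rule sum.remove) auto
    ultimately have "1 + (\<Sum>S\<in>UNIV - {{} :: 'k set}. 1 :: 'k poly2) = 0" by (simp only:)
    then have "(\<Sum>S\<in>UNIV - {{} :: 'k set}. 1 :: 'k poly2) = 1" by (rule iffD1[OF poly2_add_eq_0_iff, THEN sym])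
    then show ?thesis unfolding c by simp
  qed
  have C: "(\<Sum>m\<in>UNIV. var m ^ 2 ^ l * ?C 0 m) = (if l = 0 then moore else 0)" if "l < CARD('k)" for l
  proof (cases "l = 0")
    case True
    then show ?thesis using permanent_expand_row[OF k, of "moore_matrix :: nat \<Rightarrow> 'k \<Rightarrow> _"] by (simp add: permanent_moore_matrix)
  next
    case False
    then have "permanent ((moore_matrix :: nat \<Rightarrow> 'k \<Rightarrow> _)(0 := moore_matrix l)) = 0"
      using that by (intro permanent_equal_rows[of 0 l]) auto
    then show ?thesis using False by (simp only: permanent_replace_row[OF k] if_False)
  qed
  \<comment> \<open>The difference of two solutions of one linear system, whose determinant can be cancelled.\<close>
  define u where "u m = c m + ?C 0 m" for m
  have u: "(\<Sum>m\<in>UNIV. var m ^ 2 ^ l * u m) = 0" if "l < CARD('k)" for l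
  proof -
    have "(\<Sum>m\<in>UNIV. var m ^ 2 ^ l * c m) = (if l = 0 then moore else 0)"
      using c_0 c_pos[of l] p0_small[OF that] by simp
    then show ?thesis unfolding u_def distrib_left sum.distrib by (simp only: C[OF that] poly2_add_self)
  qed
  have u0: "u m = 0" for m
  proof (rule moore_cancel)
    have "moore * u m = (\<Sum>m'\<in>UNIV. if m' = m then moore * u m' else 0)" by simp
    also have "\<dots> = (\<Sum>m'\<in>UNIV. \<Sum>i<CARD('k). (var m' ^ 2 ^ i * ?C i m) * u m')"
      by (rule sum.cong) (simp_all only: sum_distrib_right[symmetric] column_orthogonality[where y = moore_matrix] permanent_moore_matrix, simp_all)
    also have "\<dots> = (\<Sum>i<CARD('k). \<Sum>m'\<in>UNIV. (var m' ^ 2 ^ i * ?C i m) * u m')" by (rule sum.swap)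
    also have "\<dots> = (\<Sum>i<CARD('k). ?C i m * (\<Sum>m'\<in>UNIV. var m' ^ 2 ^ i * u m'))"
      by (simp add: sum_distrib_left mult_ac)
    also have "\<dots> = 0" by (simp add: u)
    finally show "moore * u m = 0" .
  qed
  have "c m = ?C 0 m" for m using u0[of m] unfolding u_def by (rule iffD1[OF poly2_add_eq_0_iff])
  then show ?thesis using c_pos[OF assms] by simp
qed

lemma sum_powers_cofactor:
  "(\<Sum>m\<in>UNIV. var m ^ 2 ^ l * cofactor moore_matrix 0 (m :: 'k::finite)) =
    (if l = 0 then moore else if l < CARD('k) then 0 else p0 l * moore)"
proof (cases "l = 0")
  case True
  have "0 < CARD('k)" by simp
  from permanent_expand_row[OF this, of "moore_matrix :: nat \<Rightarrow> 'k \<Rightarrow> _"] show ?thesis using True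
    by (simp add: permanent_moore_matrix)
next
  case False
  then show ?thesis using p0_times_moore_cofactor[of l, where 'k = 'k] p0_small[of l, where 'k = 'k] by auto
qed

section \<open>Elimination of the intermediate generators\<close>

text \<open>
  Cramer's rule for functions \<open>h l\<close> that play the role of \<open>v\<^sub>l z\<^sub>J\<close>. Combining the relations of the
  different variables with the cofactors of row 0 gives \<open>D h\<^sub>0 + \<Sum>l\<ge>k. D p\<^sub>l h\<^sub>l = 0\<close>, and \<open>D\<close> is
  cancelled. The sums over \<open>l\<close> are cut off at \<open>N\<close>, which must dominate the totals that occur after
  the shift by a monomial of \<open>D\<close>.
\<close>

lemma v0_relation:
  fixes h :: "nat \<Rightarrow> ('k::finite \<Rightarrow> int) \<Rightarrow> 'u::ab_group_add"
  assumes char2: "\<And>l J. h l J + h l J = 0"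
    and vanish: "\<And>l J j. J j \<le> 0 \<Longrightarrow> h l J = 0"
    and rel: "\<And>J m N. (\<Sum>j\<in>UNIV. J j) \<le> int N \<Longrightarrow> (\<Sum>l\<le>N. shift_act (var m ^ 2 ^ l) (h l) J) = 0"
    and N: "(\<Sum>j\<in>UNIV. J j) + (\<Sum>i<CARD('k). 2 ^ i) \<le> int N"
  shows "h 0 J + (\<Sum>l=CARD('k)..N. shift_act (p0 l) (h l) J) = 0"
proof -
  let ?k = "CARD('k)"
  define n where "n = (\<Sum>j\<in>UNIV. J j)"
  let ?g = "\<lambda>J. h 0 J + (\<Sum>l=?k..N. shift_act (p0 l) (h l) J)"
  have g2: "shift_act (p0 l) (h l) J + shift_act (p0 l) (h l) J = 0" for l J
    by (rule shift_act_double) (rule char2)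
  have "?g J = 0"
  proof (rule shift_act_moore_injective[where c = 1 and n = n])
    fix J show "?g J + ?g J = 0"
    proof -
      have "?g J + ?g J = (h 0 J + h 0 J) + (\<Sum>l=?k..N. shift_act (p0 l) (h l) J + shift_act (p0 l) (h l) J)"
        unfolding sum.distrib by (simp only: add.assoc add.left_commute)
      then show ?thesis by (simp only: char2 g2 sum.neutral_const add_0_left)
    qed
  next
    fix J :: "'k \<Rightarrow> int" and j assume j: "J j < 1"
    have "h l J' = 0" if "\<And>j. J' j \<le> J j" for J' l using vanish[of J' j l] that[of j] j by linarith
    then have "shift_act (p0 l) (h l) J = 0" for l by (rule shift_act_eq_0)
    then show "?g J = 0" using vanish[of J j 0] j by simp
  next
    fix J :: "'k \<Rightarrow> int" assume J: "(\<Sum>j\<in>UNIV. J j) = n + (\<Sum>i<?k. 2 ^ i)"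
    have k: "0 < ?k" by simp
    let ?P = "\<lambda>l. \<Sum>m\<in>UNIV. var m ^ 2 ^ l * cofactor moore_matrix 0 (m :: 'k)"
    have "shift_act moore ?g J = shift_act moore (h 0) J + (\<Sum>l=?k..N. shift_act (moore * p0 l) (h l) J)"
      by (simp add: shift_act_fun_add shift_act_fun_sum shift_act_mult[OF char2])
    also have "\<dots> = shift_act (?P 0) (h 0) J + (\<Sum>l=?k..N. shift_act (?P l) (h l) J)"
    proof -
      have "?P 0 = moore" by (subst sum_powers_cofactor) simp
      moreover have "?P l = moore * p0 l" if "l \<in> {?k..N}" for l
        unfolding sum_powers_cofactor using that k by (simp add: mult.commute del: zero_less_card_finite)
      ultimately show ?thesis by (simp only: cong: sum.cong)
    qed
    also have "\<dots> = (\<Sum>l\<in>insert 0 {?k..N}. shift_act (?P l) (h l) J)"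
      using k by (subst sum.insert) auto
    also have "\<dots> = (\<Sum>l\<le>N. shift_act (?P l) (h l) J)"
      by (rule sum.mono_neutral_left) (auto simp: sum_powers_cofactor)
    also have "\<dots> = (\<Sum>l\<le>N. \<Sum>m\<in>UNIV. shift_act (cofactor moore_matrix 0 m) (shift_act (var m ^ 2 ^ l) (h l)) J)"
      by (simp add: shift_act_sum[OF char2] shift_act_mult[OF char2, symmetric] mult.commute)
    also have "\<dots> = (\<Sum>m\<in>UNIV. \<Sum>l\<le>N. shift_act (cofactor moore_matrix 0 m) (shift_act (var m ^ 2 ^ l) (h l)) J)"
      by (rule sum.swap)
    also have "\<dots> = (\<Sum>m\<in>UNIV. shift_act (cofactor moore_matrix 0 m) (\<lambda>J. \<Sum>l\<le>N. shift_act (var m ^ 2 ^ l) (h l) J) J)"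
      by (simp only: shift_act_fun_sum)
    also have "\<dots> = 0"
    proof (intro sum.neutral ballI)
      fix m :: 'k
      show "shift_act (cofactor moore_matrix 0 m) (\<lambda>J. \<Sum>l\<le>N. shift_act (var m ^ 2 ^ l) (h l) J) J = 0"
      proof (rule shift_act_eq_0)
        fix J' assume "\<And>j. J' j \<le> J j"
        then have "(\<Sum>j\<in>UNIV. J' j) \<le> (\<Sum>j\<in>UNIV. J j)" by (intro sum_mono)
        then have "(\<Sum>j\<in>UNIV. J' j) \<le> int N" using N J unfolding n_def by linarith
        then show "(\<Sum>l\<le>N. shift_act (var m ^ 2 ^ l) (h l) J') = 0" by (rule rel)
      qed
    qed
    finally show "shift_act moore ?g J = 0" .
  qed (simp add: n_def)
  then show ?thesis .
qed

section \<open>Quotients of monomial symmetric polynomials\<close>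

lemma msym_mset_cong:
  assumes "mset ts = mset us"
  shows "(msym ts :: 'k poly2) = msym us"
proof -
  have sub: "{\<Prod>i<length ts. var (b i) ^ (ts ! i) | b. bij_betw b {..<length ts} (UNIV :: 'k set)} \<subseteq>
    {\<Prod>i<length us. var (b i) ^ (us ! i) | b. bij_betw b {..<length us} (UNIV :: 'k set)}"
    if eq: "mset ts = mset us" for ts us
  proof safe
    fix b assume b: "bij_betw b {..<length ts} (UNIV :: 'k set)"
    have len: "length ts = length us" using eq by (rule mset_eq_length)
    obtain f where f: "bij_betw f {..<length us} {..<length ts}" "\<forall>i<length us. us ! i = ts ! f i"
      using permutation_Ex_bij[of us ts] eq by auto
    have "(\<Prod>i<length us. var ((b \<circ> f) i) ^ (us ! i)) = (\<Prod>i<length us. var (b (f i)) ^ (ts ! f i))"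
      using f(2) by (intro prod.cong) auto
    also have "\<dots> = (\<Prod>i<length ts. var (b i) ^ (ts ! i))"
      by (rule prod.reindex_bij_betw[OF f(1)])
    finally have "(\<Prod>i<length ts. var (b i) ^ (ts ! i)) = (\<Prod>i<length us. var ((b \<circ> f) i) ^ (us ! i))" ..
    then show "\<exists>b'. (\<Prod>i<length ts. var (b i) ^ (ts ! i)) = (\<Prod>i<length us. var (b' i) ^ (us ! i)) \<and>
       bij_betw b' {..<length us} (UNIV :: 'k set)"
      by (intro exI[of _ "b \<circ> f"] conjI bij_betw_trans[OF f(1) b])
  qed
  show ?thesis unfolding msym_def
    by (rule arg_cong[of _ _ "\<lambda>A. \<Sum>A"], rule subset_antisym[OF sub[OF assms] sub[OF assms[symmetric]]])
qed

text \<open>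
  The summands are pairwise distinct, so the set of monomials can be indexed by enumerations.
\<close>

lemma msym_distinct:
  assumes "length ts = CARD('k)" "distinct ts"
  shows "(msym ts :: 'k::finite poly2) = (\<Sum>b\<in>enums. Poly_Mapping.single (enum_exponent (\<lambda>i. ts ! i) b) 1)"
proof -
  let ?m = "\<lambda>b :: nat \<Rightarrow> 'k. Poly_Mapping.single (enum_exponent (\<lambda>i. ts ! i) b) (1::bit)"
  have m: "(\<Prod>i<length ts. var (b i) ^ (ts ! i)) = ?m b" for b :: "nat \<Rightarrow> 'k"
    by (simp add: prod_var_power enum_exponent_def assms)
  have "{?m b | b. bij_betw b {..<length ts} UNIV} = ?m ` enums"
  proof safe
    fix b assume "bij_betw b {..<length ts} (UNIV :: 'k set)"
    then have "restrict b {..<CARD('k)} \<in> enums"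
      by (auto simp: enums_def bij_betw_restrict_eq assms)
    moreover have "?m b = ?m (restrict b {..<CARD('k)})" by (simp add: enum_exponent_def)
    ultimately show "?m b \<in> ?m ` enums" by blast
  next
    fix b :: "nat \<Rightarrow> 'k" assume "b \<in> enums"
    then show "\<exists>b'. ?m b = ?m b' \<and> bij_betw b' {..<length ts} UNIV"
      using enums_bij by (auto simp: assms)
  qed
  moreover have "inj_on ?m enums"
  proof (rule inj_onI)
    fix b c :: "nat \<Rightarrow> 'k" assume bc: "b \<in> enums" "c \<in> enums" "?m b = ?m c"
    have "inj_on (\<lambda>i. ts ! i) {..<CARD('k)}"
      using assms by (auto simp: inj_on_def nth_eq_iff_index_eq)
    moreover have "enum_exponent (\<lambda>i. ts ! i) b = enum_exponent (\<lambda>i. ts ! i) c"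
    proof (rule ccontr)
      assume "enum_exponent (\<lambda>i. ts ! i) b \<noteq> enum_exponent (\<lambda>i. ts ! i) c"
      then have "Poly_Mapping.lookup (?m c) (enum_exponent (\<lambda>i. ts ! i) b) = 0" by (auto simp: lookup_single when_def)
      then show False using bc(3)[symmetric] by simp
    qed
    ultimately show "b = c" using enum_exponent_inj bc by blast
  qed
  ultimately show ?thesis unfolding msym_def m by (simp only: sum.reindex o_def)
qed

lemma msym_powers_moore: "msym (map (\<lambda>i. 2 ^ i) [0..<CARD('k)]) = (moore :: 'k::finite poly2)"
proof -
  have "enum_exponent (\<lambda>i. map (\<lambda>i. 2 ^ i) [0..<CARD('k)] ! i) b = enum_exponent (\<lambda>i. 2 ^ i) b" for b :: "nat \<Rightarrow> 'k"
    unfolding enum_exponent_def by (intro sum.cong) auto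
  then show ?thesis
    by (subst msym_distinct) (auto simp: moore_def distinct_map inj_on_def)
qed

lemma p0_times_moore:
  assumes "l \<ge> CARD('k)"
  shows "p0 l * moore = (msym (map (\<lambda>i. 2 ^ i) ([1..<CARD('k)] @ [l])) :: 'k::finite poly2)"
proof -
  let ?k = "CARD('k)"
  have k: "0 < ?k" by simp
  let ?ts = "map (\<lambda>i. 2 ^ i :: nat) (l # [1..<?k])"
  have "msym (map (\<lambda>i. 2 ^ i) ([1..<?k] @ [l])) = (msym ?ts :: 'k poly2)"
    by (rule msym_mset_cong) simp
  also have "\<dots> = (\<Sum>b\<in>enums. Poly_Mapping.single (enum_exponent (\<lambda>i. ?ts ! i) b) 1)"
    by (rule msym_distinct) (use assms k in \<open>auto simp: distinct_map inj_on_def\<close>)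
  also have "\<dots> = permanent ((moore_matrix :: nat \<Rightarrow> 'k \<Rightarrow> _)(0 := moore_matrix l))"
    unfolding permanent_def
  proof (intro sum.cong refl)
    fix b :: "nat \<Rightarrow> 'k"
    have "(\<Prod>i<?k. (moore_matrix(0 := moore_matrix l)) i (b i)) = (\<Prod>i<?k. var (b i) ^ (?ts ! i))"
      by (intro prod.cong refl) (auto simp: nth_Cons' simp del: upt_Suc)
    then show "Poly_Mapping.single (enum_exponent (\<lambda>i. ?ts ! i) b) 1 = (\<Prod>i<?k. (moore_matrix(0 := moore_matrix l)) i (b i))"
      by (simp only: prod_var_power finite_lessThan enum_exponent_def)
  qed
  also have "\<dots> = p0 l * moore"
    unfolding permanent_replace_row[OF k, symmetric]
    using sum_powers_cofactor[of l, where 'k = 'k] assms k by (simp del: zero_less_card_finite)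
  finally show ?thesis by simp
qed

section \<open>Surjections and decreasing partitions\<close>

definition fibre_powers :: "nat \<Rightarrow> (nat \<Rightarrow> 'k) \<Rightarrow> 'k \<Rightarrow> nat set"
  where "fibre_powers l f j = (\<lambda>n. 2 ^ n) ` {n. n < l \<and> f n = j}"

definition surjections :: "nat \<Rightarrow> (nat \<Rightarrow> 'k) set"
  where "surjections l = {f \<in> {..<l} \<rightarrow>\<^sub>E UNIV. f ` {..<l} = UNIV}"

text \<open>
  Assembles a list of blocks and an enumeration of the variables to the function that sends the
  exponent \<open>n\<close> to the variable whose block contains \<open>2^n\<close>.
\<close>

definition glue :: "nat \<Rightarrow> nat set list \<times> (nat \<Rightarrow> 'k::finite) \<Rightarrow> nat \<Rightarrow> 'k"
  where "glue l = (\<lambda>(S, b) n. if n < l then b (THE i. i < CARD('k) \<and> 2 ^ n \<in> S ! i) else undefined)"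

lemma sum_fibre_powers: "\<Sum>(fibre_powers l f j) = (\<Sum>n | n < l \<and> f n = j. 2 ^ n)"
  unfolding fibre_powers_def by (subst sum.reindex) (auto simp: inj_on_def)

text \<open>
  Binary expansions are unique, and the fibres of a surjection are disjoint and nonempty.
\<close>

lemma fibre_sum_inj:
  assumes "f \<in> surjections l" "\<Sum>(fibre_powers l f j) = \<Sum>(fibre_powers l f j')"
  shows "j = j'"
proof -
  have "finite {n. n < l \<and> f n = i}" for i by simp
  moreover have "set_encode {n. n < l \<and> f n = j} = set_encode {n. n < l \<and> f n = j'}"
    using assms(2) by (simp add: sum_fibre_powers set_encode_def)
  ultimately have eq: "{n. n < l \<and> f n = j} = {n. n < l \<and> f n = j'}"
    by (simp add: set_encode_eq)
  have "j \<in> f ` {..<l}" using assms(1) by (simp add: surjections_def)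
  then obtain n where "n < l" "f n = j" by auto
  then show ?thesis using eq by auto
qed

lemma decreasing_partitions_block:
  assumes S: "S \<in> decreasing_partitions k l" and n: "n < l"
  shows "\<exists>!i. i < k \<and> 2 ^ n \<in> S ! i"
proof -
  have "(2::nat) ^ n \<in> (\<Union>i<k. S ! i)" using S n by (auto simp: decreasing_partitions_def)
  then obtain i where i: "i < k" "2 ^ n \<in> S ! i" by auto
  have "j = i" if "j < k" "2 ^ n \<in> S ! j" for j
  proof (rule ccontr)
    assume "j \<noteq> i"
    then have "S ! j \<inter> S ! i = {}" using S that(1) i(1) unfolding decreasing_partitions_def by blast
    then show False using i(2) that(2) by blast
  qed
  then show ?thesis using i by blast
qed

lemma glue_eq_iff:
  fixes b :: "nat \<Rightarrow> 'k::finite"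
  assumes S: "S \<in> decreasing_partitions CARD('k) l" and b: "b \<in> enums" and n: "n < l" and i: "i < CARD('k)"
  shows "glue l (S, b) n = b i \<longleftrightarrow> 2 ^ n \<in> S ! i"
proof -
  note ex = decreasing_partitions_block[OF S n]
  define r where "r = (THE i. i < CARD('k) \<and> 2 ^ n \<in> S ! i)"
  have r: "r < CARD('k)" "2 ^ n \<in> S ! r" using theI'[OF ex] unfolding r_def by auto
  have "glue l (S, b) n = b r" by (simp add: glue_def n r_def)
  then have "glue l (S, b) n = b i \<longleftrightarrow> r = i" using enums_inj[OF b r(1) i] by simp
  also have "\<dots> \<longleftrightarrow> 2 ^ n \<in> S ! i" using ex r i by blast
  finally show ?thesis .
qed

lemma fibre_powers_glue:
  fixes b :: "nat \<Rightarrow> 'k::finite"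
  assumes S: "S \<in> decreasing_partitions CARD('k) l" and b: "b \<in> enums" and i: "i < CARD('k)"
  shows "fibre_powers l (glue l (S, b)) (b i) = S ! i"
proof -
  have "S ! i \<subseteq> (\<lambda>n. 2 ^ n) ` {..<l}"
    using S i unfolding decreasing_partitions_def by blast
  then show ?thesis using glue_eq_iff[OF S b _ i] by (fastforce simp: fibre_powers_def)
qed

lemma glue_surjection:
  fixes b :: "nat \<Rightarrow> 'k::finite"
  assumes S: "S \<in> decreasing_partitions CARD('k) l" and b: "b \<in> enums"
  shows "glue l (S, b) \<in> surjections l"
proof -
  have "m \<in> glue l (S, b) ` {..<l}" for m
  proof -
    obtain i where i: "i < CARD('k)" "b i = m" using enums_surj[OF b] by blast
    have "S ! i \<noteq> {}" using S i(1) by (simp add: decreasing_partitions_def)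
    then have "fibre_powers l (glue l (S, b)) m \<noteq> {}" using fibre_powers_glue[OF S b i(1)] i(2) by simp
    then show ?thesis by (auto simp: fibre_powers_def)
  qed
  then have "glue l (S, b) ` {..<l} = UNIV" by blast
  moreover have "glue l (S, b) \<in> {..<l} \<rightarrow>\<^sub>E UNIV" by (simp add: glue_def PiE_def extensional_def)
  ultimately show ?thesis by (simp add: surjections_def)
qed

lemma sorted_wrt_greater_unique:
  fixes xs ys :: "'a::linorder list"
  assumes "sorted_wrt (>) xs" "sorted_wrt (>) ys" "set xs = set ys"
  shows "xs = ys"
  using strict_sorted_equal[of "rev xs" "rev ys"] assms by (simp add: sorted_wrt_rev)

text \<open>
  The blocks are the fibres, and a list with decreasing sums is determined by the set of the sums;
  this fixes the order of the variables as well.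
\<close>

lemma glue_inj: "inj_on (glue l) (decreasing_partitions CARD('k::finite) l \<times> (enums :: (nat \<Rightarrow> 'k) set))"
proof (rule inj_onI, clarify)
  fix S S' and b b' :: "nat \<Rightarrow> 'k"
  assume S: "S \<in> decreasing_partitions CARD('k) l" and S': "S' \<in> decreasing_partitions CARD('k) l"
    and b: "b \<in> enums" and b': "b' \<in> enums" and eq: "glue l (S, b) = glue l (S', b')"
  define f where "f = glue l (S, b)"
  have f: "f \<in> surjections l" unfolding f_def by (rule glue_surjection[OF S b])
  have Si: "S ! i = fibre_powers l f (b i)" "S' ! i = fibre_powers l f (b' i)" if "i < CARD('k)" for i
    using fibre_powers_glue[OF S b that] fibre_powers_glue[OF S' b' that] by (simp_all add: f_def eq)
  have len: "length S = CARD('k)" "length S' = CARD('k)" using S S' by (simp_all add: decreasing_partitions_def)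
  have img: "c ` {..<CARD('k)} = UNIV" if "c \<in> enums" for c :: "nat \<Rightarrow> 'k"
    using enums_bij[OF that] by (simp add: bij_betw_def)
  have "map \<Sum> S = map (\<lambda>i. \<Sum>(fibre_powers l f (b i))) [0..<CARD('k)]"
    by (rule nth_equalityI) (simp_all add: len Si)
  then have "set (map \<Sum> S) = (\<lambda>i. \<Sum>(fibre_powers l f (b i))) ` {..<CARD('k)}"
    by (simp only: set_map set_upt atLeast0LessThan)
  also have "\<dots> = (\<lambda>j. \<Sum>(fibre_powers l f j)) ` b ` {..<CARD('k)}" by (simp only: image_image)
  also have "\<dots> = range (\<lambda>j. \<Sum>(fibre_powers l f j))" by (simp only: img[OF b])
  finally have 1: "set (map \<Sum> S) = range (\<lambda>j. \<Sum>(fibre_powers l f j))" .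
  have "map \<Sum> S' = map (\<lambda>i. \<Sum>(fibre_powers l f (b' i))) [0..<CARD('k)]"
    by (rule nth_equalityI) (simp_all add: len Si)
  then have "set (map \<Sum> S') = (\<lambda>i. \<Sum>(fibre_powers l f (b' i))) ` {..<CARD('k)}"
    by (simp only: set_map set_upt atLeast0LessThan)
  also have "\<dots> = (\<lambda>j. \<Sum>(fibre_powers l f j)) ` b' ` {..<CARD('k)}" by (simp only: image_image)
  also have "\<dots> = range (\<lambda>j. \<Sum>(fibre_powers l f j))" by (simp only: img[OF b'])
  finally have 2: "set (map \<Sum> S') = range (\<lambda>j. \<Sum>(fibre_powers l f j))" .
  have maps: "map \<Sum> S = map \<Sum> S'"
    using S S' 1 2 by (intro sorted_wrt_greater_unique) (simp_all add: decreasing_partitions_def)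
  have bb: "b i = b' i" if i: "i < CARD('k)" for i
  proof (rule fibre_sum_inj[OF f])
    have "map \<Sum> S ! i = map \<Sum> S' ! i" by (simp only: maps)
    then show "\<Sum>(fibre_powers l f (b i)) = \<Sum>(fibre_powers l f (b' i))" using i len Si[OF i] by simp
  qed
  then have "b = b'" by (rule enums_eqI[OF b b'])
  moreover have "S = S'" by (rule nth_equalityI) (use len Si bb in simp_all)
  ultimately show "S = S' \<and> b = b'" by simp
qed

text \<open>
  Enumerate the variables by decreasing sum of the fibre.
\<close>

lemma glue_onto:
  assumes f: "(f :: nat \<Rightarrow> 'k::finite) \<in> surjections l"
  shows "f \<in> glue l ` (decreasing_partitions CARD('k) l \<times> enums)"
proof -
  let ?N = "\<lambda>j. \<Sum>(fibre_powers l f j)"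
  have inj: "inj ?N" using fibre_sum_inj[OF f] by (rule injI)
  \<comment> \<open>The sums of the fibres in decreasing order.\<close>
  define xs where "xs = rev (sorted_list_of_set (range ?N))"
  have len: "length xs = CARD('k)" using card_image[OF inj] by (simp add: xs_def)
  have set: "set xs = range ?N" by (simp add: xs_def)
  have srt: "sorted_wrt (>) xs" by (simp add: xs_def sorted_wrt_rev)
  define b where "b = restrict (\<lambda>i. inv ?N (xs ! i)) {..<CARD('k)}"
  have N: "?N (b i) = xs ! i" if "i < CARD('k)" for i
  proof -
    have "xs ! i \<in> range ?N" using that len set nth_mem by metis
    then have "?N (inv ?N (xs ! i)) = xs ! i" by (rule f_inv_into_f)
    then show ?thesis using that by (simp only: b_def restrict_apply lessThan_iff if_True)
  qed
  have "distinct xs" by (simp add: xs_def)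
  have "inj_on b {..<CARD('k)}"
  proof (rule inj_onI)
    fix i j assume ij: "i \<in> {..<CARD('k)}" "j \<in> {..<CARD('k)}" "b i = b j"
    then have "xs ! i = xs ! j" using N[of i] N[of j] by simp
    then show "i = j" using ij \<open>distinct xs\<close> len by (simp add: nth_eq_iff_index_eq)
  qed
  moreover from this have "b ` {..<CARD('k)} = UNIV"
    by (intro card_subset_eq) (simp_all add: card_image)
  ultimately have b: "b \<in> enums" by (simp add: enums_def bij_betw_def b_def)
  define S where "S = map (\<lambda>i. fibre_powers l f (b i)) [0..<CARD('k)]"
  have Si: "S ! i = fibre_powers l f (b i)" if "i < CARD('k)" for i using that by (simp add: S_def)
  have lS: "length S = CARD('k)" by (simp add: S_def)
  have mem: "2 ^ n \<in> fibre_powers l f j \<longleftrightarrow> f n = j" if "n < l" for n j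
    using that by (auto simp: fibre_powers_def)
  have "S \<in> decreasing_partitions CARD('k) l"
    unfolding decreasing_partitions_def mem_Collect_eq
  proof (intro conjI allI impI)
    show "S ! i \<noteq> {}" if "i < CARD('k)" for i
    proof -
      have "b i \<in> f ` {..<l}" using f by (simp add: surjections_def)
      then obtain n where "n < l" "f n = b i" by auto
      then show ?thesis using mem Si[OF that] by blast
    qed
    show "S ! i \<inter> S ! j = {}" if "i < CARD('k)" "j < CARD('k)" "i \<noteq> j" for i j
    proof -
      have "b i \<noteq> b j" using enums_inj[OF b that(1,2)] that(3) by simp
      then show ?thesis unfolding Si[OF that(1)] Si[OF that(2)] by (auto simp: fibre_powers_def)
    qed
    have "(\<Union>i<CARD('k). S ! i) = (\<Union>j\<in>b ` {..<CARD('k)}. fibre_powers l f j)" by (simp add: Si)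
    also have "b ` {..<CARD('k)} = UNIV" using enums_bij[OF b] by (simp add: bij_betw_def)
    also have "(\<Union>j\<in>UNIV. fibre_powers l f j) = (\<lambda>n. 2 ^ n) ` {..<l}" by (auto simp: fibre_powers_def)
    finally show "(\<Union>i<CARD('k). S ! i) = (\<lambda>n. 2 ^ n) ` {..<l}" .
    have "map \<Sum> S = xs" by (rule nth_equalityI) (simp_all add: lS len Si N)
    then show "sorted_wrt (>) (map \<Sum> S)" using srt by simp
  qed (rule lS)
  moreover have "f = glue l (S, b)"
  proof
    fix n
    show "f n = glue l (S, b) n"
    proof (cases "n < l")
      case True
      obtain i where i: "i < CARD('k)" "b i = f n" using enums_surj[OF b] by blast
      have "2 ^ n \<in> S ! i" using mem[OF True] Si[OF i(1)] i(2) by simp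
      then show ?thesis using glue_eq_iff[OF calculation b True i(1)] i(2) by simp
    next
      case False
      then show ?thesis using f by (auto simp: glue_def surjections_def PiE_def extensional_def)
    qed
  qed
  ultimately show ?thesis using b by blast
qed

lemma p0_decreasing_partitions:
  "(p0 l :: 'k::finite poly2) = (\<Sum>S\<in>decreasing_partitions CARD('k) l. msym (map \<Sum> S))"
proof -
  let ?E = "\<lambda>f :: nat \<Rightarrow> 'k. \<Sum>i<l. Poly_Mapping.single (f i) (2 ^ i)"
  have bij: "bij_betw (glue l) (decreasing_partitions CARD('k) l \<times> enums) (surjections l :: (nat \<Rightarrow> 'k) set)"
    unfolding bij_betw_def using glue_inj glue_onto glue_surjection by blast
  have "(p0 l :: 'k poly2) = (\<Sum>f\<in>surjections l. Poly_Mapping.single (?E f) 1)"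
    unfolding p0_def surjections_def by (simp add: prod_var_power)
  also have "\<dots> = (\<Sum>x\<in>decreasing_partitions CARD('k) l \<times> enums. Poly_Mapping.single (?E (glue l x)) 1)"
    by (rule sum.reindex_bij_betw[OF bij, symmetric])
  also have "\<dots> = (\<Sum>S\<in>decreasing_partitions CARD('k) l. \<Sum>b\<in>enums. Poly_Mapping.single (?E (glue l (S, b))) 1)"
    by (simp add: sum.cartesian_product)
  also have "\<dots> = (\<Sum>S\<in>decreasing_partitions CARD('k) l. msym (map \<Sum> S))"
  proof (intro sum.cong[OF refl])
    fix S assume S: "S \<in> decreasing_partitions CARD('k) l"
    have len: "length S = CARD('k)" using S by (simp add: decreasing_partitions_def)
    have "sorted_wrt (>) (map \<Sum> S)" using S by (simp add: decreasing_partitions_def)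
    then have "sorted_wrt (<) (rev (map \<Sum> S))" by (simp only: sorted_wrt_rev)
    then have d: "distinct (map \<Sum> S)" unfolding strict_sorted_iff distinct_rev by (rule conjunct2)
    have "?E (glue l (S, b)) = enum_exponent (\<lambda>i. map \<Sum> S ! i) b" if b: "b \<in> enums" for b :: "nat \<Rightarrow> 'k"
    proof (rule poly_mapping_eqI)
      fix j
      obtain i where i: "i < CARD('k)" "b i = j" using enums_surj[OF b] by blast
      have "Poly_Mapping.lookup (?E (glue l (S, b))) j = (\<Sum>n | n < l \<and> glue l (S, b) n = j. 2 ^ n)"
        unfolding lookup_sum by (intro sum.mono_neutral_cong_right) (auto simp: lookup_single when_def)
      also have "\<dots> = map \<Sum> S ! i"
        using sum_fibre_powers[of l "glue l (S, b)" j] fibre_powers_glue[OF S b i(1)] i len by simp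
      also have "\<dots> = Poly_Mapping.lookup (enum_exponent (\<lambda>i. map \<Sum> S ! i) b) j"
        using lookup_enum_exponent[OF b i(1), of "\<lambda>i. map \<Sum> S ! i"] i(2) by simp
      finally show "Poly_Mapping.lookup (?E (glue l (S, b))) j =
        Poly_Mapping.lookup (enum_exponent (\<lambda>i. map \<Sum> S ! i) b) j" .
    qed
    then show "(\<Sum>b\<in>enums. Poly_Mapping.single (?E (glue l (S, b))) 1) = (msym (map \<Sum> S) :: 'k poly2)"
      using d len by (simp add: msym_distinct)
  qed
  finally show ?thesis .
qed

section \<open>Generators and relations of the tensor power\<close>

lemma pure_tensor_add: "pure_tensor (t(j := x + y)) = pure_tensor (t(j := x)) + pure_tensor (t(j := y))"
  unfolding pure_tensor_def plus_tensor_power.abs_eq tensor_power.abs_eq_iff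
  by (rule free.span_base) (auto simp: multilinear_relations_def diff_diff_eq)

lemma pure_tensor_scale: "pure_tensor (t(j := scale_bpz2 c x)) = scale_tensor c (pure_tensor (t(j := x)))"
proof -
  have "scale_free c (Poly_Mapping.single (t(j := x)) 1) = Poly_Mapping.single (t(j := x)) c"
    by (rule poly_mapping_eqI) (simp add: lookup_single when_def)
  then show ?thesis
    unfolding pure_tensor_def scale_tensor.abs_eq tensor_power.abs_eq_iff multilinear_relations_def
    by (intro free.span_base UnI2) auto
qed

lemma pure_tensor_0: "pure_tensor (t(j := 0)) = 0"
  using pure_tensor_scale[of t j 0 0] by simp

lemma pure_tensor_sum: "pure_tensor (t(j := \<Sum>a\<in>A. f a)) = (\<Sum>a\<in>A. pure_tensor (t(j := f a)))"
  by (induction A rule: infinite_finite_induct) (simp_all only: sum.infinite sum.empty sum.insert pure_tensor_0 pure_tensor_add not_False_eq_True)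

lemma abs_bpz2_sum: "abs_bpz2 (\<Sum>a\<in>A. f a) = (\<Sum>a\<in>A. abs_bpz2 (f a))"
  by (induction A rule: infinite_finite_induct)
    (simp_all add: zero_bpz2.abs_eq plus_bpz2.abs_eq[symmetric])

lemma scale_bpz2_z: "scale_bpz2 c (z i) = abs_bpz2 (Poly_Mapping.single i c)"
proof -
  have "scale_free c (Poly_Mapping.single i 1) = Poly_Mapping.single i c"
    by (rule poly_mapping_eqI) (simp add: lookup_single when_def)
  then show ?thesis by (simp add: z.abs_eq scale_bpz2.abs_eq)
qed

lemma z_0: "z 0 = 0"
  unfolding z.abs_eq zero_bpz2_def bpz2.abs_eq_iff
  by (rule free.span_base) (simp add: bpz2_relations_def)

lemma bpz2_relation:
  assumes "i \<ge> 1"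
  shows "(\<Sum>j\<le>i. scale_bpz2 (two_series_coeff j) (z (i - j))) = 0"
  unfolding scale_bpz2_z abs_bpz2_sum[symmetric] zero_bpz2_def bpz2.abs_eq_iff
  using assms by (intro free.span_base) (auto simp: bpz2_relations_def)

lemma z_tensor_upd: "z_tensor (I(m := n)) = pure_tensor ((\<lambda>j. z (I j))(m := z n))"
  unfolding z_tensor_def by (rule arg_cong[of _ _ pure_tensor]) auto

lemma z_tensor_0:
  assumes "I m = 0"
  shows "z_tensor I = 0"
proof -
  have "z_tensor (I(m := 0)) = 0" unfolding z_tensor_upd z_0 by (rule pure_tensor_0)
  then show ?thesis using assms by (simp only: fun_upd_idem)
qed

text \<open>
  The relation of \<open>z\<^sub>i\<close> in the factor \<open>m\<close>; the other factors are those of \<open>z\<^sub>I\<close>.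
\<close>

lemma z_tensor_relation:
  assumes "i \<ge> 1"
  shows "(\<Sum>j\<le>i. scale_tensor (two_series_coeff j) (z_tensor (I(m := i - j)))) = 0"
  unfolding z_tensor_upd pure_tensor_scale[symmetric] pure_tensor_sum[symmetric] bpz2_relation[OF assms]
  by (rule pure_tensor_0)

section \<open>Powers of the ideal and the filtration\<close>

lemma v_ideal_power_mult:
  assumes "c \<in> v_ideal_power s" "d \<in> v_ideal_power t"
  shows "c * d \<in> v_ideal_power (s + t)"
proof -
  let ?G = "\<lambda>s. {\<Prod>i<s. c i | c. \<forall>i<s. c i \<in> v_ideal}"
  have gen: "x * y \<in> v_ideal_power (s + t)" if "x \<in> ?G s" "y \<in> ?G t" for x y
  proof -
    obtain e where x: "x = (\<Prod>i<s. e i)" and e: "\<forall>i<s. e i \<in> v_ideal" using \<open>x \<in> ?G s\<close> by blast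
    obtain f where y: "y = (\<Prod>i<t. f i)" and f: "\<forall>i<t. f i \<in> v_ideal" using \<open>y \<in> ?G t\<close> by blast
    let ?g = "\<lambda>i. if i < s then e i else f (i - s)"
    have "(\<Prod>i<s + t. ?g i) = (\<Prod>i<s. ?g i) * (\<Prod>i=s..<s + t. ?g i)"
      by (rule prod.atLeastLessThan_concat[of 0 s "s + t" ?g, symmetric, unfolded atLeast0LessThan]) auto
    also have "(\<Prod>i=s..<s + t. ?g i) = y"
      unfolding y by (rule prod.reindex_bij_witness[of _ "\<lambda>i. i + s" "\<lambda>i. i - s"]) auto
    also have "(\<Prod>i<s. ?g i) = x" unfolding x by (rule prod.cong) auto
    finally have "x * y = (\<Prod>i<s + t. ?g i)" ..
    moreover have "\<forall>i<s + t. ?g i \<in> v_ideal" using e f by auto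
    ultimately show ?thesis unfolding v_ideal_power_def
      by (intro bp_ideal.span_base CollectI exI[of _ ?g] conjI)
  qed
  have add: "x + y \<in> v_ideal_power r" if "x \<in> v_ideal_power r" "y \<in> v_ideal_power r" for x y r
    using that unfolding v_ideal_power_def by (rule bp_ideal.span_add)
  have scale: "a * x \<in> v_ideal_power r" if "x \<in> v_ideal_power r" for a x r
    using that unfolding v_ideal_power_def by (rule bp_ideal.span_scale)
  have zero: "0 \<in> v_ideal_power r" for r
    unfolding v_ideal_power_def by (rule bp_ideal.span_zero)
  have right: "x * d \<in> v_ideal_power (s + t)" if x: "x \<in> ?G s" for x
    using assms(2) unfolding v_ideal_power_def[of t]
  proof (induction rule: bp_ideal.span_induct_alt)
    case base
    show ?case by (simp only: mult_zero_left mult_zero_right zero)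
  next
    case (step a y e)
    have "x * (a * y + e) = a * (x * y) + x * e" by (simp only: distrib_left mult.left_commute)
    then show ?case using add[OF scale[OF gen[OF x step(1)]] step(2)] by (simp only:)
  qed
  show ?thesis
    using assms(1) unfolding v_ideal_power_def[of s]
  proof (induction rule: bp_ideal.span_induct_alt)
    case base
    show ?case by (simp only: mult_zero_left mult_zero_right zero)
  next
    case (step a x e)
    have "(a * x + e) * d = a * (x * d) + e * d" by (simp only: distrib_right mult.assoc)
    then show ?case using add[OF scale[OF right[OF step(1)]] step(2)] by (simp only:)
  qed
qed

lemma one_in_v_ideal_power_0: "1 \<in> v_ideal_power 0"
  unfolding v_ideal_power_def by (rule bp_ideal.span_base) auto

lemma v_in_v_ideal_power_1: "v j \<in> v_ideal_power 1"
  unfolding v_ideal_power_def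
  by (intro bp_ideal.span_base CollectI exI[of _ "\<lambda>_. v j"]) (simp add: v_in_v_ideal)

lemma v_power_in_v_ideal_power: "v j ^ n \<in> v_ideal_power n"
proof (induction n)
  case (Suc n)
  then show ?case using v_ideal_power_mult[OF v_in_v_ideal_power_1 Suc] by simp
qed (simp add: one_in_v_ideal_power_0)

lemma v_monomial_superset:
  "finite A \<Longrightarrow> Poly_Mapping.keys T \<subseteq> A \<Longrightarrow> v_monomial T = (\<Prod>j\<in>A. v j ^ Poly_Mapping.lookup T j)"
  unfolding v_monomial_def by (rule prod.mono_neutral_left) (auto simp: in_keys_iff)

lemma v_monomial_add: "v_monomial (T + U) = v_monomial T * v_monomial U"
proof -
  let ?A = "Poly_Mapping.keys T \<union> Poly_Mapping.keys U"
  have "finite ?A" "Poly_Mapping.keys T \<subseteq> ?A" "Poly_Mapping.keys U \<subseteq> ?A" "Poly_Mapping.keys (T + U) \<subseteq> ?A"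
    using keys_add[of T U] by auto
  then show ?thesis
    by (simp only: v_monomial_superset[of ?A] lookup_add power_add prod.distrib)
qed

lemma v_monomial_single: "v_monomial (Poly_Mapping.single l 1) = v l"
  by (simp add: v_monomial_def)

lemma v_monomial_in_v_ideal_power:
  "v_monomial T \<in> v_ideal_power (\<Sum>j\<in>Poly_Mapping.keys T. Poly_Mapping.lookup T j)"
proof -
  have "(\<Prod>j\<in>A. v j ^ e j) \<in> v_ideal_power (\<Sum>j\<in>A. e j)" if "finite A" for A and e :: "nat \<Rightarrow> nat"
    using that by induction (simp_all add: one_in_v_ideal_power_0 v_ideal_power_mult v_power_in_v_ideal_power)
  then show ?thesis unfolding v_monomial_def by simp
qed

lemma filt_0: "0 \<in> filt s" and filt_add: "p \<in> filt s \<Longrightarrow> q \<in> filt s \<Longrightarrow> p + q \<in> filt s"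
  and filt_diff: "p \<in> filt s \<Longrightarrow> q \<in> filt s \<Longrightarrow> p - q \<in> filt s"
  and filt_neg: "p \<in> filt s \<Longrightarrow> - p \<in> filt s"
  and filt_sum: "(\<And>a. a \<in> A \<Longrightarrow> f a \<in> filt s) \<Longrightarrow> sum f A \<in> filt s"
  unfolding filt_def
  by (auto intro: tensor.span_zero tensor.span_add tensor.span_diff tensor.span_neg tensor.span_sum)

lemma scale_in_filt: "c \<in> v_ideal_power s \<Longrightarrow> scale_tensor c q \<in> filt s"
  unfolding filt_def by (rule tensor.span_base) blast

lemma scale_filt:
  assumes "c \<in> v_ideal_power s" "q \<in> filt t"
  shows "scale_tensor c q \<in> filt (s + t)"
  using assms(2) unfolding filt_def[of t]
proof (induction rule: tensor.span_induct_alt)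
  case base
  show ?case by (simp add: filt_0)
next
  case (step a x y)
  obtain d p where x: "x = scale_tensor d p" and d: "d \<in> v_ideal_power t" using step(1) by blast
  have "scale_tensor c (scale_tensor a x + y) = scale_tensor (c * d) (scale_tensor a p) + scale_tensor c y"
    by (simp only: x tensor.scale_right_distrib tensor.scale_scale mult.assoc mult.commute[of a d])
  then show ?case
    using filt_add[OF scale_in_filt[OF v_ideal_power_mult[OF assms(1) d]] step(2)] by (simp only:)
qed

lemma double_eq_scale_v_0: "q + q = scale_tensor (v 0) q"
proof -
  have "v 0 = 1 + 1" by (simp add: v_def)
  then show ?thesis by (simp only: tensor.scale_left_distrib tensor.scale_one)
qed

section \<open>The relations modulo the second step of the filtration\<close>

text \<open>
  Modulo \<open>filt 2\<close> congruences become equations, as is required by \<open>v0_relation\<close>, which is about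
  functions with values in an abelian group.
\<close>

quotient_type (overloaded) 'k mod_filt2 = "'k tensor_power" / "\<lambda>x y. x - y \<in> filt 2"
proof (rule equivpI)
  show "reflp (\<lambda>x y :: 'k tensor_power. x - y \<in> filt 2)" by (simp add: reflp_def filt_0)
  show "symp (\<lambda>x y :: 'k tensor_power. x - y \<in> filt 2)"
    by (rule sympI) (metis filt_neg minus_diff_eq)
  show "transp (\<lambda>x y :: 'k tensor_power. x - y \<in> filt 2)"
    by (rule transpI) (metis filt_add diff_add_cancel add_diff_eq)
qed

instantiation mod_filt2 :: (type) ab_group_add
begin

lift_definition zero_mod_filt2 :: "'a mod_filt2" is 0 .

lift_definition plus_mod_filt2 :: "'a mod_filt2 \<Rightarrow> 'a mod_filt2 \<Rightarrow> 'a mod_filt2" is plus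
  by (simp only: add_diff_add filt_add)

lift_definition uminus_mod_filt2 :: "'a mod_filt2 \<Rightarrow> 'a mod_filt2" is uminus
  by (simp only: minus_diff_minus filt_neg)

lift_definition minus_mod_filt2 :: "'a mod_filt2 \<Rightarrow> 'a mod_filt2 \<Rightarrow> 'a mod_filt2" is minus
  by (simp only: diff_diff_swap filt_diff)

instance
  by standard (transfer; simp add: filt_0 algebra_simps)+

end

lemma abs_mod_filt2_eq_0: "abs_mod_filt2 q = 0 \<longleftrightarrow> q \<in> filt 2"
  by (simp add: zero_mod_filt2_def mod_filt2.abs_eq_iff)

lemma abs_mod_filt2_add: "abs_mod_filt2 (p + q) = abs_mod_filt2 p + abs_mod_filt2 q"
  by (simp add: plus_mod_filt2.abs_eq)

lemma abs_mod_filt2_sum: "abs_mod_filt2 (sum f A) = (\<Sum>a\<in>A. abs_mod_filt2 (f a))"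
  by (induction A rule: infinite_finite_induct) (simp_all add: abs_mod_filt2_add abs_mod_filt2_eq_0 filt_0)

text \<open>
  The class of \<open>v\<^sub>l z\<^sub>J\<close>, where \<open>z\<^sub>J = 0\<close> unless all entries are positive.
\<close>

definition v_z :: "nat \<Rightarrow> ('k \<Rightarrow> int) \<Rightarrow> 'k mod_filt2"
  where "v_z l J = (if \<forall>j. 1 \<le> J j then abs_mod_filt2 (scale_tensor (v l) (z_tensor (\<lambda>j. nat (J j)))) else 0)"

lemma v_z_double: "v_z l J + v_z l J = 0"
proof -
  have "scale_tensor (v 0) (scale_tensor (v l) q) \<in> filt 2" for q :: "'a tensor_power"
    unfolding tensor.scale_scale
    by (rule scale_in_filt, rule mult_in_v_ideal_power_2) (rule v_in_v_ideal)+
  then show ?thesis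
    by (auto simp: v_z_def abs_mod_filt2_eq_0 double_eq_scale_v_0 simp flip: abs_mod_filt2_add)
qed

lemma v_z_vanish: "J j \<le> 0 \<Longrightarrow> v_z l J = 0"
  by (auto simp: v_z_def dest: spec[of _ j])

lemma two_series_coeff_act:
  "abs_mod_filt2 (scale_tensor (two_series_coeff (2 ^ l - 1)) q) = abs_mod_filt2 (scale_tensor (v l) q)"
  "(\<And>l. Suc n \<noteq> 2 ^ l) \<Longrightarrow> abs_mod_filt2 (scale_tensor (two_series_coeff n) q) = 0"
proof -
  show "abs_mod_filt2 (scale_tensor (two_series_coeff (2 ^ l - 1)) q) = abs_mod_filt2 (scale_tensor (v l) q)"
    unfolding mod_filt2.abs_eq_iff tensor.scale_left_diff_distrib[symmetric]
    by (rule scale_in_filt[OF two_series_coeff_cong_v])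
  show "abs_mod_filt2 (scale_tensor (two_series_coeff n) q) = 0" if "\<And>l. Suc n \<noteq> 2 ^ l"
    unfolding abs_mod_filt2_eq_0 by (rule scale_in_filt[OF two_series_coeff_in_square[OF that]])
qed

text \<open>
  Modulo \<open>filt 2\<close> the relation of \<open>z\<^sub>i\<close> in the factor \<open>m\<close>, for \<open>i = J m - 1\<close>, retains only the
  coefficients of index \<open>2^l - 1\<close>, which act as \<open>v\<^sub>l\<close> and lower \<open>J m\<close> by \<open>2^l\<close> altogether. If
  \<open>J m = 1\<close> there is no relation, but then all terms vanish.
\<close>

lemma v_z_relation:
  fixes J :: "'k::finite \<Rightarrow> int"
  assumes N: "(\<Sum>j\<in>UNIV. J j) \<le> int N"
  shows "(\<Sum>l\<le>N. shift_act (var m ^ 2 ^ l) (v_z l) J) = 0"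
proof -
  have shift: "shift_act (var m ^ 2 ^ l) (v_z l) J = v_z l (J(m := J m - 2 ^ l))" for l
  proof -
    have "(\<lambda>j. J j - int (Poly_Mapping.lookup (Poly_Mapping.single m (2 ^ l)) j)) = J(m := J m - 2 ^ l)"
      by (auto simp: lookup_single when_def)
    then show ?thesis by (simp only: var_power shift_act_single)
  qed
  show ?thesis
  proof (cases "\<forall>j. 1 \<le> J j")
    case False
    then obtain j where "\<not> 1 \<le> J j" by blast
    then have j: "J j \<le> 0" by linarith
    have "v_z l (J(m := J m - 2 ^ l)) = 0" for l
    proof (rule v_z_vanish)
      have "(0::int) \<le> 2 ^ l" by simp
      from order_trans[OF j this] show "(J(m := J m - 2 ^ l)) j \<le> 0" using j by (cases "j = m") simp_all
    qed
    then show ?thesis by (simp add: shift)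
  next
    case True
    define I where "I j = nat (J j)" for j
    have J: "J j = int (I j)" "1 \<le> I j" for j using True[rule_format, of j] by (simp_all add: I_def)
    have "J m \<le> (\<Sum>j\<in>UNIV. J j)" by (rule member_le_sum) (simp_all add: J)
    then have Im: "I m \<le> N" using N J(1)[of m] by linarith
    have vz: "v_z l (J(m := J m - 2 ^ l)) =
      (if 2 ^ l \<le> I m then abs_mod_filt2 (scale_tensor (v l) (z_tensor (I(m := I m - 2 ^ l)))) else 0)" for l
    proof (cases "2 ^ l < I m")
      case True
      have two: "int (2 ^ l) = 2 ^ l" by simp
      have "2 ^ l < J m"
        using True unfolding J(1)[of m] two[symmetric] by (simp only: of_nat_less_iff)
      moreover have "1 \<le> J j" for j using J[of j] by linarith
      ultimately have "\<forall>j. 1 \<le> (J(m := J m - 2 ^ l)) j" by simp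
      moreover have "(\<lambda>j. nat ((J(m := J m - 2 ^ l)) j)) = I(m := I m - 2 ^ l)"
      proof
        fix j
        have "nat (int (I m) - int (2 ^ l)) = I m - 2 ^ l" by linarith
        then show "nat ((J(m := J m - 2 ^ l)) j) = (I(m := I m - 2 ^ l)) j"
          unfolding two by (simp add: J(1))
      qed
      moreover have "2 ^ l \<le> I m" using True by simp
      ultimately show ?thesis by (simp only: v_z_def if_True simp_thms)
    next
      case False
      then have "int (I m) \<le> int (2 ^ l)" by (simp only: of_nat_le_iff not_less)
      then have "v_z l (J(m := J m - 2 ^ l)) = 0" by (intro v_z_vanish[of _ m]) (simp add: J)
      moreover have "z_tensor (I(m := I m - 2 ^ l)) = 0" by (rule z_tensor_0[of _ m]) (use False in simp)
      ultimately show ?thesis by (simp add: abs_mod_filt2_eq_0 filt_0)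
    qed
    let ?i = "I m - 1"
    let ?F = "\<lambda>n. abs_mod_filt2 (scale_tensor (two_series_coeff n) (z_tensor (I(m := ?i - n))))"
    let ?P = "\<lambda>l. 2 ^ l - 1 :: nat"
    have inj: "inj_on ?P A" for A
    proof (rule inj_onI)
      fix x y assume "?P x = ?P y"
      then have "(2::nat) ^ x = 2 ^ y" by (metis Suc_pred' zero_less_numeral zero_less_power)
      then show "x = y" by simp
    qed
    have "(\<Sum>l\<le>N. v_z l (J(m := J m - 2 ^ l))) = (\<Sum>l | l \<le> N \<and> 2 ^ l \<le> I m. ?F (?P l))"
    proof (rule sum.mono_neutral_cong_right)
      fix l assume l: "l \<in> {l. l \<le> N \<and> 2 ^ l \<le> I m}"
      have "(1::nat) \<le> 2 ^ l" by simp
      then have "?i - ?P l = I m - 2 ^ l" using l by simp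
      then show "v_z l (J(m := J m - 2 ^ l)) = ?F (?P l)" using l by (simp add: vz two_series_coeff_act(1) del: One_nat_def)
    qed (auto simp: vz)
    also have "\<dots> = (\<Sum>n\<in>?P ` {l. l \<le> N \<and> 2 ^ l \<le> I m}. ?F n)"
      by (simp only: sum.reindex[OF inj] o_def)
    also have "\<dots> = (\<Sum>n\<le>?i. ?F n)"
    proof (rule sum.mono_neutral_left)
      show "\<forall>n\<in>{..?i} - ?P ` {l. l \<le> N \<and> 2 ^ l \<le> I m}. ?F n = 0"
      proof
        fix n assume n: "n \<in> {..?i} - ?P ` {l. l \<le> N \<and> 2 ^ l \<le> I m}"
        have "Suc n \<noteq> 2 ^ l" for l
        proof
          assume l: "Suc n = 2 ^ l"
          then have "n = ?P l" by simp
          moreover have "2 ^ l \<le> I m" using n J(2)[of m] unfolding l[symmetric] by auto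
          moreover have "l \<le> N" using less_exp[of l] \<open>2 ^ l \<le> I m\<close> Im by linarith
          ultimately show False using n by blast
        qed
        then show "?F n = 0" by (rule two_series_coeff_act)
      qed
    qed auto
    also have "\<dots> = 0"
    proof (cases "?i = 0")
      case True
      then have "(\<Sum>n\<le>?i. ?F n) = ?F 0" by simp
      also have "\<dots> = 0" using z_tensor_0[of "I(m := ?i - 0)" m] True by (simp add: abs_mod_filt2_eq_0 filt_0)
      finally show ?thesis .
    next
      case False
      then have "?i \<ge> 1" by linarith
      from z_tensor_relation[OF this, of I m] show ?thesis
        by (simp only: abs_mod_filt2_sum[symmetric] abs_mod_filt2_eq_0 filt_0)
    qed
    finally show ?thesis by (simp only: shift)
  qed
qed

section \<open>Multiplication by the prime on the generators\<close>

lemma keys_sum_single: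
  assumes "finite A" "inj_on g A"
  shows "Poly_Mapping.keys (\<Sum>x\<in>A. Poly_Mapping.single (g x) (1::bit)) = g ` A"
proof -
  have "Poly_Mapping.lookup (\<Sum>x\<in>A. Poly_Mapping.single (g x) (1::bit)) y = (if y \<in> g ` A then 1 else 0)" for y
  proof (cases "y \<in> g ` A")
    case True
    then obtain x0 where x0: "x0 \<in> A" "y = g x0" by blast
    have "Poly_Mapping.lookup (\<Sum>x\<in>A. Poly_Mapping.single (g x) (1::bit)) y = (\<Sum>x\<in>{x0}. 1)"
      unfolding lookup_sum
      by (rule sum.mono_neutral_cong_right) (use assms x0 in \<open>auto simp: lookup_single when_def dest: inj_onD\<close>)
    then show ?thesis using True by simp
  next
    case False
    then show ?thesis unfolding lookup_sum by (auto simp: lookup_single when_def intro!: sum.neutral)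
  qed
  then show ?thesis by (auto simp: in_keys_iff split: if_splits)
qed

lemma sum_keys_poly_act:
  fixes I :: "'k \<Rightarrow> nat"
  shows "(\<Sum>J\<in>Poly_Mapping.keys (poly_act p I). G J) =
    (\<Sum>E | E \<in> Poly_Mapping.keys p \<and> (\<forall>j. Poly_Mapping.lookup E j < I j). G (\<lambda>j. I j - Poly_Mapping.lookup E j))"
proof -
  let ?A = "{E \<in> Poly_Mapping.keys p. \<forall>j. Poly_Mapping.lookup E j < I j}"
  let ?g = "\<lambda>E j. I j - Poly_Mapping.lookup E j"
  have one: "Poly_Mapping.lookup p E = 1" if "E \<in> Poly_Mapping.keys p" for E
    using that by (simp add: in_keys_iff)
  have "poly_act p I = (\<Sum>E\<in>?A. Poly_Mapping.single (?g E) 1)"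
    unfolding poly_act_def by (rule sum.mono_neutral_cong_right) (auto simp: one)
  moreover have inj: "inj_on ?g ?A"
  proof (rule inj_onI)
    fix E F assume EF: "E \<in> ?A" "F \<in> ?A" "?g E = ?g F"
    show "E = F"
    proof (rule poly_mapping_eqI)
      fix j
      have "Poly_Mapping.lookup E j < I j" "Poly_Mapping.lookup F j < I j" using EF by auto
      then show "Poly_Mapping.lookup E j = Poly_Mapping.lookup F j" using fun_cong[OF EF(3), of j] by linarith
    qed
  qed
  ultimately have "Poly_Mapping.keys (poly_act p I) = ?g ` ?A" by (simp add: keys_sum_single)
  then show ?thesis by (simp add: sum.reindex[OF inj])
qed

text \<open>
  Links the action on functions of integer tuples with \<open>poly_act\<close>: different monomials send \<open>z\<^sub>I\<close> to
  different classes, so nothing cancels in \<open>poly_act\<close>.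
\<close>

lemma shift_act_v_z:
  fixes I :: "'k::finite \<Rightarrow> nat"
  shows "shift_act p (v_z l) (\<lambda>j. int (I j)) =
    abs_mod_filt2 (\<Sum>J\<in>Poly_Mapping.keys (poly_act p I). scale_tensor (v l) (z_tensor J))"
  unfolding sum_keys_poly_act abs_mod_filt2_sum shift_act_def
proof (rule sum.mono_neutral_cong_right)
  have nat_diff: "nat (int a - int b) = a - b" for a b by linarith
  have iff: "1 \<le> int a - int b \<longleftrightarrow> b < a" for a b :: nat by linarith
  show "\<forall>E\<in>Poly_Mapping.keys p - {E \<in> Poly_Mapping.keys p. \<forall>j. Poly_Mapping.lookup E j < I j}.
      v_z l (\<lambda>j. int (I j) - int (Poly_Mapping.lookup E j)) = 0"
    by (auto simp: v_z_def iff)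
  show "v_z l (\<lambda>j. int (I j) - int (Poly_Mapping.lookup E j)) =
      abs_mod_filt2 (scale_tensor (v l) (z_tensor (\<lambda>j. I j - Poly_Mapping.lookup E j)))"
    if "E \<in> {E \<in> Poly_Mapping.keys p. \<forall>j. Poly_Mapping.lookup E j < I j}" for E
    using that by (simp add: v_z_def iff nat_diff)
qed auto

text \<open>
  \<open>v0_relation\<close> for the classes \<open>v\<^sub>l z\<^sub>J\<close>. The sign changes because \<open>2 v\<^sub>l z\<^sub>J = v\<^sub>0 v\<^sub>l z\<^sub>J\<close> lies in
  \<open>filt 2\<close>.
\<close>

lemma v0_z_tensor:
  fixes I :: "'k::finite \<Rightarrow> nat"
  assumes "\<And>j. I j \<ge> 1"
  shows "scale_tensor (v 0) (z_tensor I) -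
    (\<Sum>l | CARD('k) \<le> l \<and> poly_act (p0 l) I \<noteq> 0.
      \<Sum>J\<in>Poly_Mapping.keys (poly_act (p0 l) I). scale_tensor (v l) (z_tensor J)) \<in> filt 2"
proof -
  let ?L = "{l. CARD('k) \<le> l \<and> poly_act (p0 l) I \<noteq> 0}"
  let ?S = "\<lambda>l. \<Sum>J\<in>Poly_Mapping.keys (poly_act (p0 l) I). scale_tensor (v l) (z_tensor J)"
  obtain M where M: "\<forall>l\<in>?L. l \<le> M"
    using finite_p0_contributions[of I] finite_nat_set_iff_bounded_le by blast
  \<comment> \<open>Large enough for \<open>v0_relation\<close>, and no contribution is cut off.\<close>
  define N where "N = M + nat ((\<Sum>j\<in>UNIV. int (I j)) + (\<Sum>i<CARD('k). 2 ^ i))"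
  have "v_z 0 (\<lambda>j. int (I j)) + (\<Sum>l=CARD('k)..N. shift_act (p0 l) (v_z l) (\<lambda>j. int (I j))) = 0"
    by (rule v0_relation) (simp_all add: v_z_double v_z_vanish v_z_relation N_def)
  moreover have "v_z 0 (\<lambda>j. int (I j)) = abs_mod_filt2 (scale_tensor (v 0) (z_tensor I))"
    using assms by (simp add: v_z_def)
  ultimately have "abs_mod_filt2 (scale_tensor (v 0) (z_tensor I) + (\<Sum>l=CARD('k)..N. ?S l)) = 0"
    by (simp only: shift_act_v_z abs_mod_filt2_add abs_mod_filt2_sum)
  moreover have "(\<Sum>l=CARD('k)..N. ?S l) = (\<Sum>l\<in>?L. ?S l)"
    by (rule sum.mono_neutral_right) (use M in \<open>auto simp: N_def intro: order_trans[OF _ le_add1]\<close>)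
  ultimately have *: "scale_tensor (v 0) (z_tensor I) + (\<Sum>l\<in>?L. ?S l) \<in> filt 2"
    by (simp only: abs_mod_filt2_eq_0)
  have "?S l + ?S l \<in> filt 2" for l
    unfolding sum.distrib[symmetric]
  proof (rule filt_sum)
    fix J
    show "scale_tensor (v l) (z_tensor J) + scale_tensor (v l) (z_tensor J) \<in> filt 2"
      unfolding double_eq_scale_v_0 tensor.scale_scale
      by (rule scale_in_filt, rule mult_in_v_ideal_power_2) (rule v_in_v_ideal)+
  qed
  then have "(\<Sum>l\<in>?L. ?S l + ?S l) \<in> filt 2" by (rule filt_sum)
  from filt_diff[OF * this] show ?thesis by (simp add: sum.distrib algebra_simps)
qed

section \<open>Multiplication by the prime on the associated graded\<close>

text \<open>
  The range in which \<open>realize\<close> is additive modulo \<open>filt (r + 1)\<close>.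
\<close>

definition homogeneous :: "nat \<Rightarrow> ((nat \<Rightarrow>\<^sub>0 nat) \<times> ('k \<Rightarrow> nat) \<Rightarrow>\<^sub>0 bit) \<Rightarrow> bool"
  where "homogeneous r w \<longleftrightarrow> (\<forall>x\<in>Poly_Mapping.keys w. v_monomial (fst x) \<in> v_ideal_power r)"

lemma homogeneous_sum: "(\<And>a. a \<in> A \<Longrightarrow> homogeneous r (f a)) \<Longrightarrow> homogeneous r (sum f A)"
  using keys_sum[of f A] unfolding homogeneous_def by blast

text \<open>
  Basis vectors that occur on both sides cancel on the left and contribute twice on the right, and
  2 is \<open>v\<^sub>0\<close>.
\<close>

lemma realize_add:
  assumes "homogeneous r w" "homogeneous r w'"
  shows "realize (w + w') - (realize w + realize w') \<in> filt (Suc r)"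
proof -
  let ?g = "\<lambda>x. scale_tensor (v_monomial (fst x)) (z_tensor (snd x))"
  let ?A = "Poly_Mapping.keys w \<union> Poly_Mapping.keys w'"
  let ?t = "\<lambda>u x. if Poly_Mapping.lookup u x = 1 then ?g x else 0"
  have R: "realize u = (\<Sum>x\<in>?A. ?t u x)" if "Poly_Mapping.keys u \<subseteq> ?A" for u
    unfolding realize_def case_prod_beta
    by (rule sum.mono_neutral_cong_left) (use that in \<open>auto simp: in_keys_iff\<close>)
  have "realize (w + w') - (realize w + realize w') = (\<Sum>x\<in>?A. ?t (w + w') x - (?t w x + ?t w' x))"
    unfolding sum_subtractf sum.distrib using keys_add[of w w'] by (simp only: R Un_upper1 Un_upper2)
  also have "\<dots> \<in> filt (Suc r)"
  proof (rule filt_sum)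
    fix x assume x: "x \<in> ?A"
    show "?t (w + w') x - (?t w x + ?t w' x) \<in> filt (Suc r)"
    proof (cases "Poly_Mapping.lookup w x = 1 \<and> Poly_Mapping.lookup w' x = 1")
      case True
      then have "Poly_Mapping.lookup (w + w') x = 0" by (simp only: lookup_add bit_add_self)
      moreover have "?g x + ?g x \<in> filt (Suc r)"
      proof -
        have "v_monomial (fst x) \<in> v_ideal_power r"
          using assms x unfolding homogeneous_def by blast
        from v_ideal_power_mult[OF v_in_v_ideal_power_1[of 0] this] show ?thesis
          unfolding double_eq_scale_v_0 tensor.scale_scale by (intro scale_in_filt) simp
      qed
      moreover from True calculation(1) have "?t (w + w') x - (?t w x + ?t w' x) = - (?g x + ?g x)" by simp
      ultimately show ?thesis by (simp only: filt_neg)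
    next
      case False
      then have "?t (w + w') x - (?t w x + ?t w' x) = 0"
        by (cases "Poly_Mapping.lookup w x = 0"; cases "Poly_Mapping.lookup w' x = 0") (simp_all add: lookup_add)
      then show ?thesis by (simp only: filt_0)
    qed
  qed
  finally show ?thesis .
qed

lemma realize_0 [simp]: "realize 0 = 0" by (simp add: realize_def)

lemma realize_sum_cong:
  assumes "\<And>a. a \<in> A \<Longrightarrow> homogeneous r (f a)" "\<And>a. a \<in> A \<Longrightarrow> realize (f a) - y a \<in> filt (Suc r)"
  shows "realize (sum f A) - sum y A \<in> filt (Suc r)"
  using assms
proof (induction A rule: infinite_finite_induct)
  case (insert a A)
  have "realize (f a + sum f A) - (realize (f a) + realize (sum f A)) \<in> filt (Suc r)"
    using insert.prems by (intro realize_add homogeneous_sum) auto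
  moreover have "realize (f a) - y a \<in> filt (Suc r)" "realize (sum f A) - sum y A \<in> filt (Suc r)"
    using insert by auto
  ultimately have "(realize (f a + sum f A) - (realize (f a) + realize (sum f A))) +
    ((realize (f a) - y a) + (realize (sum f A) - sum y A)) \<in> filt (Suc r)"
    by (intro filt_add)
  moreover have "(realize (f a + sum f A) - (realize (f a) + realize (sum f A))) +
    ((realize (f a) - y a) + (realize (sum f A) - sum y A)) = realize (f a + sum f A) - (y a + sum y A)"
    by (simp add: algebra_simps)
  ultimately show ?case using insert.hyps by simp
qed (simp_all add: filt_0)

lemma v0_realize:
  fixes w :: "(nat \<Rightarrow>\<^sub>0 nat) \<times> ('k::finite \<Rightarrow> nat) \<Rightarrow>\<^sub>0 bit"
  assumes w: "w \<in> gr_space s"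
  shows "scale_tensor (v 0) (realize w) - realize (v_poly_act p0 w) \<in> filt (Suc (Suc s))"
proof -
  let ?K = "Poly_Mapping.keys w"
  let ?L = "\<lambda>I :: 'k \<Rightarrow> nat. {l. CARD('k) \<le> l \<and> poly_act (p0 l) I \<noteq> 0}"
  let ?J = "\<lambda>l I. Poly_Mapping.keys (poly_act (p0 l) I :: ('k \<Rightarrow> nat) \<Rightarrow>\<^sub>0 bit)"
  let ?s = "\<lambda>x l J. Poly_Mapping.single (Poly_Mapping.single l 1 + fst x, J :: 'k \<Rightarrow> nat) (1::bit)"
  let ?y = "\<lambda>x l J. scale_tensor (v_monomial (fst x)) (scale_tensor (v l) (z_tensor (J :: 'k \<Rightarrow> nat)))"
  have mon: "v_monomial (fst x) \<in> v_ideal_power s" if "x \<in> ?K" for x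
    using w that v_monomial_in_v_ideal_power[of "fst x"] by (auto simp: gr_space_def)
  have pos: "snd x j \<ge> 1" if "x \<in> ?K" for x j
    using w that by (auto simp: gr_space_def)
  have hom: "homogeneous (Suc s) (?s x l J)" if "x \<in> ?K" for x l J
    using v_ideal_power_mult[OF v_in_v_ideal_power_1[of l] mon[OF that]]
    by (simp add: homogeneous_def v_monomial_add v_monomial_single[simplified])
  have base: "realize (?s x l J) - ?y x l J \<in> filt (Suc (Suc s))" for x l J
    by (simp add: realize_def v_monomial_add v_monomial_single[simplified] filt_0 mult.commute)
  have 1: "realize (v_poly_act p0 w) - (\<Sum>x\<in>?K. \<Sum>l\<in>?L (snd x). \<Sum>J\<in>?J l (snd x). ?y x l J) \<in> filt (Suc (Suc s))"
    unfolding v_poly_act_def case_prod_beta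
    by (intro realize_sum_cong homogeneous_sum hom base)
  have 2: "scale_tensor (v 0) (realize w) - (\<Sum>x\<in>?K. \<Sum>l\<in>?L (snd x). \<Sum>J\<in>?J l (snd x). ?y x l J)
    \<in> filt (Suc (Suc s))"
  proof -
    have "scale_tensor (v 0) (realize w) - (\<Sum>x\<in>?K. \<Sum>l\<in>?L (snd x). \<Sum>J\<in>?J l (snd x). ?y x l J) =
      (\<Sum>x\<in>?K. scale_tensor (v_monomial (fst x)) (scale_tensor (v 0) (z_tensor (snd x)) -
        (\<Sum>l\<in>?L (snd x). \<Sum>J\<in>?J l (snd x). scale_tensor (v l) (z_tensor J))))"
      by (simp add: realize_def case_prod_beta tensor.scale_sum_right tensor.scale_right_diff_distrib
        sum_subtractf mult.commute)
    also have "\<dots> \<in> filt (s + 2)"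
      by (intro filt_sum scale_filt mon v0_z_tensor pos)
    finally show ?thesis by simp
  qed
  from filt_diff[OF 2 1] show ?thesis by simp
qed

text \<open>
  Multiplication by \<open>v\<^sub>0\<close> maps \<open>filt (s + 1)\<close> into \<open>filt (s + 2)\<close>, so the representative of the class
  in \<open>gr_mult\<close> is immaterial.
\<close>

lemma gr_mult_v0:
  fixes w :: "(nat \<Rightarrow>\<^sub>0 nat) \<times> ('k::finite \<Rightarrow> nat) \<Rightarrow>\<^sub>0 bit"
  assumes "w \<in> gr_space s"
  shows "gr_mult s (v 0) (gr_class s (realize w)) = gr_class (Suc s) (realize (v_poly_act p0 w))"
proof -
  let ?r = "realize w" and ?y = "realize (v_poly_act p0 w)"
  have ry: "scale_tensor (v 0) ?r - ?y \<in> filt (Suc (Suc s))" by (rule v0_realize[OF assms])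
  show ?thesis
  proof (intro equalityI subsetI)
    fix q' assume "q' \<in> gr_mult s (v 0) (gr_class s ?r)"
    then obtain q where q: "q - ?r \<in> filt (Suc s)" "q' - scale_tensor (v 0) q \<in> filt (Suc (Suc s))"
      by (auto simp: gr_mult_def gr_class_def)
    have "scale_tensor (v 0) (q - ?r) \<in> filt (Suc (Suc s))"
      using scale_filt[OF v_in_v_ideal_power_1 q(1)] by simp
    then have "(q' - scale_tensor (v 0) q) + (scale_tensor (v 0) (q - ?r) + (scale_tensor (v 0) ?r - ?y))
      \<in> filt (Suc (Suc s))"
      using q(2) ry by (intro filt_add)
    then show "q' \<in> gr_class (Suc s) ?y"
      by (simp add: gr_class_def tensor.scale_right_diff_distrib)
  next
    fix q' assume "q' \<in> gr_class (Suc s) ?y"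
    then have "q' - ?y \<in> filt (Suc (Suc s))" by (simp add: gr_class_def)
    from filt_diff[OF this ry] have "q' - scale_tensor (v 0) ?r \<in> filt (Suc (Suc s))" by simp
    moreover have "?r \<in> gr_class s ?r" by (simp add: gr_class_def filt_0)
    ultimately show "q' \<in> gr_mult s (v 0) (gr_class s ?r)"
      unfolding gr_mult_def gr_class_def by blast
  qed
qed

section \<open>The action of the prime\<close>

theorem theorem1p7:
  shows "(\<forall>s. \<forall>w \<in> (gr_space s :: ((nat \<Rightarrow>\<^sub>0 nat) \<times> ('k::finite \<Rightarrow> nat) \<Rightarrow>\<^sub>0 bit) set).
            gr_mult s (v 0) (gr_class s (realize w)) =
            gr_class (Suc s) (realize (v_poly_act p0 w)))
       \<and> (\<forall>l \<ge> CARD('k).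
            msym (map (\<lambda>i. 2 ^ i) [0..<CARD('k)]) \<noteq> (0 :: 'k poly2) \<and>
            p0 l * msym (map (\<lambda>i. 2 ^ i) [0..<CARD('k)]) =
              (msym (map (\<lambda>i. 2 ^ i) ([1..<CARD('k)] @ [l])) :: 'k poly2))
       \<and> (\<forall>l \<ge> CARD('k).
            (p0 l :: 'k poly2) =
            (\<Sum>S\<in>decreasing_partitions (CARD('k)) l. msym (map \<Sum> S)))"
proof (intro conjI allI ballI impI)
  fix s and w :: "(nat \<Rightarrow>\<^sub>0 nat) \<times> ('k \<Rightarrow> nat) \<Rightarrow>\<^sub>0 bit"
  assume "w \<in> gr_space s"
  then show "gr_mult s (v 0) (gr_class s (realize w)) = gr_class (Suc s) (realize (v_poly_act p0 w))"
    by (rule gr_mult_v0)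
next
  show "msym (map (\<lambda>i. 2 ^ i) [0..<CARD('k)]) \<noteq> (0 :: 'k poly2)"
    by (simp only: msym_powers_moore moore_neq_0 not_False_eq_True)
next
  fix l :: nat assume "CARD('k) \<le> l"
  then show "p0 l * msym (map (\<lambda>i. 2 ^ i) [0..<CARD('k)]) =
    (msym (map (\<lambda>i. 2 ^ i) ([1..<CARD('k)] @ [l])) :: 'k poly2)"
    unfolding msym_powers_moore by (rule p0_times_moore)
next
  fix l :: nat
  show "(p0 l :: 'k poly2) = (\<Sum>S\<in>decreasing_partitions (CARD('k)) l. msym (map \<Sum> S))"
    by (rule p0_decreasing_partitions)
qed

end
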